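(* Let $N>2$ and $k\ge 2$ be integers. Let $f_1\in C[0,\infty)\cap C^1(0,\infty)$ with $f_1(0)=0$, and put $F_1(s)=\int_0^s f_1(t)\,dt$. Assume: (a) there exists $b\ge 0$ such that $f_1(s)>0$ for $s>b$ and $f_1(s)\le 0$ for $s\in[0,b]$; moreover $f_1<0$ on $(0,\varepsilon)$ for some $\varepsilon>0$; and there exists a unique finite $\beta\ge b$ such that $F_1(\beta)=0$; (b) $(F_1/f_1)'(s)>\frac{N-2}{2N}$ for all $s>\beta$; (c) $s\mapsto f_1(s)/(s-b)$ is increasing for $s>b$; (d) $\alpha_*$ is an initial value such that the solution of $u''+\frac{N-1}{r}u'+f_1(u)=0$ $(r>0)$, $u(0)=\alpha_*$, $u'(0)=0$, is a ground state solution, i.e. $u(r)>0$ for all $r>0$ and $\lim_{r\to\infty}u(r)=0$. Let $\alpha_*<\gamma\le\infty$ and let $f_2,\dots,f_k$ be positive continuous functions on $[\alpha_*,\gamma)$. Then there exist constants $\epsilon_1,\dots,\epsilon_{k-1}>0$, $A_2,\dots,A_k>0$ and $\alpha_1,\dots,\alpha_{k-1}$ with $\alpha_1=\alpha_*+\epsilon_1$, $\alpha_*<\alpha_{i-1}+\epsilon_{i-1}<\alpha_i$ for $2\le i\le k-1$, and $\alpha_{k-1}+\epsilon_{k-1}<\gamma$, such that the problem $$\Delta u+f(u)=0 \ \text{ in } \mathbb R^N,\qquad \lim_{|x|\to\infty}u(x)=0,$$ has at least $k$ radially symmetric ground state solutions, where $f$ is the continuous function on $[0,\gamma)$ that equals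 $f_1$ on $[0,\alpha_*+\epsilon_1]$, equals $A_i^2f_i$ on $[\alpha_{i-1}+\epsilon_{i-1},\alpha_i]$ for $2\le i\le k-1$, equals $A_k^2f_k$ on $[\alpha_{k-1}+\epsilon_{k-1},\gamma)$, and on each interval $[\alpha_{i-1},\alpha_{i-1}+\epsilon_{i-1}]$, $2\le i\le k$, equals the affine function $L_{i-1}$ that makes $f$ continuous.
   Context: A ground state solution of $\Delta u+f(u)=0$ in $\mathbb R^N$, $\lim_{|x|\to\infty}u(x)=0$, is a nonconstant solution with $u(x)>0$ for all $x\in\mathbb R^N$. Radially symmetric (about the origin) ground states $u=u(r)$, $r=|x|$, are the solutions of $u''+\frac{N-1}{r}u'+f(u)=0$, $u(r)>0$ for all $r>0$, $u'(0)=0$, $\lim_{r\to\infty}u(r)=0$. *)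

theory Defs
  imports "HOL-Analysis.Analysis"
begin

definition partial_derivative ::
  "'n::finite \<Rightarrow> (real ^ 'n \<Rightarrow> real) \<Rightarrow> real ^ 'n \<Rightarrow> real" where
  "partial_derivative i u x = frechet_derivative u (at x) (axis i 1)"

definition C1_fun :: "(real ^ 'n::finite \<Rightarrow> real) \<Rightarrow> bool" where
  "C1_fun u \<longleftrightarrow> (\<forall>x. u differentiable (at x)) \<and>
     (\<forall>i. continuous_on UNIV (partial_derivative i u))"

definition C2_fun :: "(real ^ 'n::finite \<Rightarrow> real) \<Rightarrow> bool" where
  "C2_fun u \<longleftrightarrow> C1_fun u \<and> (\<forall>i. C1_fun (partial_derivative i u))"

definition laplacian :: "(real ^ 'n::finite \<Rightarrow> real) \<Rightarrow> real ^ 'n \<Rightarrow> real" where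
  "laplacian u x = (\<Sum>i\<in>UNIV. partial_derivative i (partial_derivative i u) x)"

text \<open>The nonlinearity f is only meaningful on the interval from 0 (included) to
  \<open>\<gamma>\<close> (excluded, possibly infinite), so a solution has to take its values there;
  the lower bound is part of positivity.  Solutions are classical.\<close>

definition ground_state ::
  "ereal \<Rightarrow> (real \<Rightarrow> real) \<Rightarrow> (real ^ 'n::finite \<Rightarrow> real) \<Rightarrow> bool" where
  "ground_state \<gamma> f u \<longleftrightarrow>
     C2_fun u \<and>
     (\<forall>x. u x > 0 \<and> ereal (u x) < \<gamma>) \<and>
     (\<forall>x. laplacian u x + f (u x) = 0) \<and>
     (u \<longlongrightarrow> 0) at_infinity \<and>
     \<not> u constant_on UNIV"

definition radially_symmetric :: "(real ^ 'n::finite \<Rightarrow> real) \<Rightarrow> bool" where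
  "radially_symmetric u \<longleftrightarrow> (\<forall>x y. norm x = norm y \<longrightarrow> u x = u y)"

text \<open>The radial initial value problem in dimension N.  The derivative at 0 is
  one-sided, and the values of u at negative arguments are irrelevant.\<close>

definition radial_ivp_solution ::
  "nat \<Rightarrow> (real \<Rightarrow> real) \<Rightarrow> real \<Rightarrow> (real \<Rightarrow> real) \<Rightarrow> bool" where
  "radial_ivp_solution N f \<alpha> u \<longleftrightarrow>
     u 0 = \<alpha> \<and>
     (\<exists>u' u''.
        (\<forall>r\<ge>0. (u has_real_derivative u' r) (at r within {0..})) \<and>
        u' 0 = 0 \<and>
        (\<forall>r>0. (u' has_real_derivative u'' r) (at r)) \<and>
        (\<forall>r>0. u'' r + (real N - 1) / r * u' r + f (u r) = 0))"

definition ground_state_initial_value ::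
  "nat \<Rightarrow> (real \<Rightarrow> real) \<Rightarrow> real \<Rightarrow> bool" where
  "ground_state_initial_value N f \<alpha> \<longleftrightarrow>
     (\<exists>u. radial_ivp_solution N f \<alpha> u \<and> (\<forall>r>0. u r > 0) \<and> (u \<longlongrightarrow> 0) at_top)"

definition primitive :: "(real \<Rightarrow> real) \<Rightarrow> real \<Rightarrow> real" where
  "primitive f s = integral {0..s} f"

text \<open>\<open>glued\<close> says that g is the piecewise function built from \<open>f 1\<close>, ..., \<open>f k\<close>.
  The affine pieces are determined by the continuity of g, so these conditions determine g
  on the interval from 0 to \<open>\<gamma>\<close>, which is all that \<open>ground_state \<gamma> g\<close> depends on.\<close>

definition glued ::
  "ereal \<Rightarrow> nat \<Rightarrow> (nat \<Rightarrow> real \<Rightarrow> real) \<Rightarrow> real \<Rightarrow>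
   (nat \<Rightarrow> real) \<Rightarrow> (nat \<Rightarrow> real) \<Rightarrow> (nat \<Rightarrow> real) \<Rightarrow> (real \<Rightarrow> real) \<Rightarrow> bool" where
  "glued \<gamma> k f \<alpha>s \<epsilon> A \<alpha> g \<longleftrightarrow>
     continuous_on {s. 0 \<le> s \<and> ereal s < \<gamma>} g \<and>
     (\<forall>s\<in>{0..\<alpha>s + \<epsilon> 1}. g s = f 1 s) \<and>
     (\<forall>i\<in>{2..k - 1}. \<forall>s\<in>{\<alpha> (i - 1) + \<epsilon> (i - 1)..\<alpha> i}. g s = (A i)\<^sup>2 * f i s) \<and>
     (\<forall>s. \<alpha> (k - 1) + \<epsilon> (k - 1) \<le> s \<and> ereal s < \<gamma> \<longrightarrow> g s = (A k)\<^sup>2 * f k s) \<and>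
     (\<forall>i\<in>{2..k}. \<exists>m c. \<forall>s\<in>{\<alpha> (i - 1)..\<alpha> (i - 1) + \<epsilon> (i - 1)}. g s = m * s + c)"

end

theory Submission
  imports Defs "HOL-Complex_Analysis.Great_Picard"
begin

text \<open>Let \<open>g\<close> be a nonlinearity that agrees with \<open>f 1\<close> up to a height
  slightly above \<open>\<alpha>s\<close> and is positive above that. Continue
  \<open>g\<close> by an affine piece to \<open>A\<^sup>2 * \<phi>\<close> on a further
  interval with upper end \<open>a\<close>, and look at the radial solution that starts at
  height \<open>a\<close>. The amplification \<open>A\<close> is the shooting parameter.

  If \<open>A\<close> is small, the solution needs a long time to leave the top interval. It
  then sits at a large radius with positive energy, friction is negligible, and it crosses
  zero. If \<open>A\<close> is large, it rushes through the top interval within a radius of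
  order \<open>1 / A\<close>. There the equation is invariant under scaling, so that what is
  left afterwards is a multiple of the fundamental solution \<open>r powr (2 - N)\<close> with
  coefficient tending to 0, plus a regular solution starting at an effective height \<open>h =
  u + r * u' / (N - 2)\<close>. The proportions of the pieces are such that \<open>h\<close>
  lies strictly between 0 and \<open>\<alpha>s\<close>, uniformly in \<open>A\<close>. A
  solution that starts below a ground state does not reach 0: its energy becomes negative
  (\<open>lower_start_negative_energy\<close>). Hence so does the energy of the original
  solution for large \<open>A\<close>. Between the two regimes some \<open>A\<close> gives a
  solution that neither crosses zero nor acquires negative energy, and such a solution is a
  ground state (\<open>new_ground_state\<close>). Its height is \<open>a\<close>, so the
  ground states of \<open>g\<close>, which start lower, are not affected; iterating gives
  \<open>k\<close> of them (\<open>staircase\<close>). All pieces can be placed in an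
  arbitrarily short interval above \<open>\<alpha>s\<close>, where each \<open>f i\<close> is
  nearly constant.

  Three points need care.

  The statement about lower starting heights is where the hypotheses on \<open>f 1\<close>
  enter. Two solutions are compared at equal heights, with the radius and the speed as
  functions of the height. The superlinearity makes the graphs intersect above
  \<open>b\<close> (a Sturm argument); the bound on the derivative of the quotient of the
  primitive and \<open>f 1\<close> keeps the order of a Pohozaev-type functional from there
  down to \<open>\<beta>\<close>; below \<open>\<beta>\<close> the gap between the two values
  of \<open>radius * sqrt (2 * energy)\<close> can only grow, which forces the upper solution
  to zero at a finite radius.

  The functions \<open>f i\<close> are merely continuous, so solutions need not be unique and do
  not depend continuously on \<open>A\<close>. The intermediate value argument is therefore
  made for approximate solutions with a delayed argument, which are computed step by step and
  do depend continuously on \<open>A\<close>; compactness turns them into a true solution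
  (\<open>shooting\<close>).

  Near 0 the function \<open>f 1\<close> need not be Lipschitz, so a solution might touch zero
  tangentially. This would make the integral of \<open>1 / sqrt (- 2 * F)\<close> at 0 finite,
  where \<open>F\<close> is the primitive of \<open>f 1\<close>, whereas the given ground
  state, which never reaches zero, makes it infinite (\<open>no_touch_transfer\<close>).\<close>

section \<open>Sources, fluxes and radial potentials\<close>

lemma integral_rescale:
  fixes f :: "real \<Rightarrow> real"
  assumes r: "0 \<le> r" and f: "continuous_on {0..r} f"
  shows "integral {0..r} f = r * integral {0..1} (\<lambda>x. f (r * x))"
proof (cases "r = 0")
  case False
  then have r0: "0 < r" using r by simp
  define I where "I = (\<lambda>x. integral {0..x} f)"
  have I: "(I has_real_derivative f t) (at t within {0..r})" if "t \<in> {0..r}" for t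
    unfolding I_def by (rule integral_has_real_derivative[OF f that])
  have "((\<lambda>x. I (r * x)) has_vector_derivative r * f (r * x)) (at x within {0..1})" if x: "x \<in> {0..1}" for x
  proof -
    have im: "(\<lambda>x. r * x) ` {0..1} \<subseteq> {0..r}"
      using r0 by (auto intro: mult_left_le)
    have "r * x \<in> {0..r}" using im x by blast
    then have "(I has_real_derivative f (r * x)) (at (r * x) within (\<lambda>x. r * x) ` {0..1})"
      using I im DERIV_subset by blast
    moreover have "((\<lambda>x. r * x) has_real_derivative r) (at x within {0..1})"
      by (auto intro!: derivative_eq_intros)
    ultimately have "(I \<circ> (\<lambda>x. r * x) has_real_derivative f (r * x) * r) (at x within {0..1})"
      by (rule DERIV_image_chain)
    then show ?thesis
      by (simp add: o_def has_real_derivative_iff_has_vector_derivative mult.commute)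
  qed
  then have "((\<lambda>x. r * f (r * x)) has_integral I (r * 1) - I (r * 0)) {0..1}"
    by (intro fundamental_theorem_of_calculus) auto
  then have "integral {0..1} (\<lambda>x. r * f (r * x)) = I (r * 1) - I (r * 0)"
    by (rule integral_unique)
  also have "\<dots> = integral {0..r} f" by (simp add: I_def)
  finally have "integral {0..1} (\<lambda>x. r * f (r * x)) = integral {0..r} f" .
  then show ?thesis by (simp only: integral_mult_right)
qed simp

text \<open>The radial equation \<open>(r ^ (N - 1) * u')' = - r ^ (N - 1) * h r\<close> with a regular
  centre gives \<open>- u' r = r powr (1 - N) * (integral of t ^ (N - 1) * h t over
  {0..r})\<close>. The substitution \<open>t = r * x\<close> removes the singularity at
  \<open>r = 0\<close> and makes the dependence on \<open>r\<close> and on further parameters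
  an instance of the continuity of parameter integrals.\<close>

definition flux :: "nat \<Rightarrow> (real \<Rightarrow> real) \<Rightarrow> real \<Rightarrow> real" where
  "flux N h r = r * integral {0..1} (\<lambda>x. x ^ (N - 1) * h (r * x))"

definition potential :: "nat \<Rightarrow> real \<Rightarrow> (real \<Rightarrow> real) \<Rightarrow> real \<Rightarrow> real" where
  "potential N a h r = a - integral {0..r} (flux N h)"

lemma flux_0 [simp]: "flux N h 0 = 0"
  by (simp add: flux_def)

lemma potential_0 [simp]: "potential N a h 0 = a"
  by (simp add: potential_def)

lemma flux_integrand_continuous:
  fixes h :: "real \<Rightarrow> real"
  assumes "continuous_on {0..r} h" "0 \<le> r"
  shows "continuous_on {0..1} (\<lambda>x. x ^ k * h (r * x))"
proof -
  have "continuous_on {0..1} (\<lambda>x. h (r * x))"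
    using assms(2) by (intro continuous_on_compose2[OF assms(1)] continuous_intros) (auto intro: mult_left_le)
  then show ?thesis by (intro continuous_intros)
qed

lemma power_weighted_flux:
  assumes r: "0 \<le> r" and h: "continuous_on {0..r} h"
  shows "r ^ (N - 1) * flux N h r = integral {0..r} (\<lambda>t. t ^ (N - 1) * h t)"
proof -
  have "integral {0..r} (\<lambda>t. t ^ (N - 1) * h t) = r * integral {0..1} (\<lambda>x. (r * x) ^ (N - 1) * h (r * x))"
    using h by (intro integral_rescale[OF r]) (auto intro!: continuous_intros)
  also have "\<dots> = r * integral {0..1} (\<lambda>x. r ^ (N - 1) * (x ^ (N - 1) * h (r * x)))"
    by (simp add: power_mult_distrib mult.assoc)
  also have "\<dots> = r ^ (N - 1) * flux N h r"
    by (simp only: integral_mult_right) (simp add: flux_def)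
  finally show ?thesis by simp
qed

lemma flux_mono_on:
  assumes r: "0 \<le> r" and h: "continuous_on {0..r} h" and k: "continuous_on {0..r} k"
    and le: "\<And>t. 0 \<le> t \<Longrightarrow> t \<le> r \<Longrightarrow> h t \<le> k t"
  shows "flux N h r \<le> flux N k r"
proof -
  have "integral {0..1} (\<lambda>x. x ^ (N - 1) * h (r * x)) \<le> integral {0..1} (\<lambda>x. x ^ (N - 1) * k (r * x))"
  proof (rule integral_le)
    show "(\<lambda>x. x ^ (N - 1) * h (r * x)) integrable_on {0..1}"
      by (rule integrable_continuous_interval[OF flux_integrand_continuous[OF h r]])
    show "(\<lambda>x. x ^ (N - 1) * k (r * x)) integrable_on {0..1}"
      by (rule integrable_continuous_interval[OF flux_integrand_continuous[OF k r]])
    fix x :: real assume "x \<in> {0..1}"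
    then show "x ^ (N - 1) * h (r * x) \<le> x ^ (N - 1) * k (r * x)"
      using r by (intro mult_left_mono le) (auto intro: mult_left_le)
  qed
  then show ?thesis using r by (simp add: flux_def mult_left_mono)
qed

lemma flux_const:
  assumes "0 < N" shows "flux N (\<lambda>_. c) r = c * r / N"
proof -
  have "((\<lambda>x::real. x ^ (N - 1)) has_integral 1 ^ N / N - 0 ^ N / N) {0..1}"
    using assms
    by (intro fundamental_theorem_of_calculus)
       (auto intro!: derivative_eq_intros simp flip: has_real_derivative_iff_has_vector_derivative)
  then have "integral {0..1} (\<lambda>x::real. x ^ (N - 1)) = 1 / N"
    using assms by (simp add: integral_unique)
  then show ?thesis by (simp add: flux_def)
qed

lemma flux_le:
  assumes "0 < N" "0 \<le> r" "continuous_on {0..r} h" "\<And>t. 0 \<le> t \<Longrightarrow> t \<le> r \<Longrightarrow> h t \<le> M"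
  shows "flux N h r \<le> M * r / N"
  using flux_mono_on[of r h "\<lambda>_. M" N] assms by (simp add: flux_const continuous_on_const)

lemma flux_ge:
  assumes "0 < N" "0 \<le> r" "continuous_on {0..r} h" "\<And>t. 0 \<le> t \<Longrightarrow> t \<le> r \<Longrightarrow> m \<le> h t"
  shows "m * r / N \<le> flux N h r"
  using flux_mono_on[of r "\<lambda>_. m" h N] assms by (simp add: flux_const continuous_on_const)

lemma flux_diff:
  assumes "0 \<le> r" "continuous_on {0..r} h" "continuous_on {0..r} k"
  shows "flux N (\<lambda>t. h t - k t) r = flux N h r - flux N k r"
proof -
  have "integral {0..1} (\<lambda>x. x ^ (N - 1) * h (r * x) - x ^ (N - 1) * k (r * x))
    = integral {0..1} (\<lambda>x. x ^ (N - 1) * h (r * x)) - integral {0..1} (\<lambda>x. x ^ (N - 1) * k (r * x))"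
    using flux_integrand_continuous[OF assms(2,1)] flux_integrand_continuous[OF assms(3,1)]
    by (intro integral_diff integrable_continuous_interval)
  moreover have "(\<lambda>x. x ^ (N - 1) * (h (r * x) - k (r * x))) = (\<lambda>x. x ^ (N - 1) * h (r * x) - x ^ (N - 1) * k (r * x))"
    by (simp add: right_diff_distrib)
  ultimately show ?thesis by (simp only: flux_def right_diff_distrib)
qed

lemma flux_abs_le:
  assumes "0 < N" "0 \<le> r" "continuous_on {0..r} h" "\<And>t. 0 \<le> t \<Longrightarrow> t \<le> r \<Longrightarrow> \<bar>h t\<bar> \<le> M"
  shows "\<bar>flux N h r\<bar> \<le> M * r / N"
  using flux_le[of N r h M] flux_ge[of N r h "- M"] assms by (force simp: abs_le_iff)

lemma flux_cong:
  assumes "0 \<le> r" "\<And>t. 0 \<le> t \<Longrightarrow> t \<le> r \<Longrightarrow> h t = k t"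
  shows "flux N h r = flux N k r"
proof -
  have "h (r * x) = k (r * x)" if "x \<in> {0..1}" for x
    using that assms(1) by (intro assms(2)) (auto intro: mult_left_le)
  then show ?thesis
    unfolding flux_def by (intro arg_cong2[where f="(*)"] integral_cong refl) simp
qed

lemma continuous_on_flux_param:
  fixes k :: "'a::topological_space \<Rightarrow> real \<Rightarrow> real"
  assumes "continuous_on (S \<times> {0..}) (\<lambda>(c, t). k c t)"
  shows "continuous_on (S \<times> {0..}) (\<lambda>(c, r). flux N (k c) r)"
proof -
  have "continuous_on ((S \<times> {0..}) \<times> cbox 0 (1::real)) (\<lambda>(q, x). x ^ (N - 1) * k (fst q) (snd q * x))"
    unfolding case_prod_beta
    by (intro continuous_intros continuous_on_compose2[OF assms, of _ "\<lambda>p. (fst (fst p), snd (fst p) * snd p)", simplified])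
       auto
  then have "continuous_on (S \<times> {0..}) (\<lambda>q. integral (cbox 0 1) (\<lambda>x. x ^ (N - 1) * k (fst q) (snd q * x)))"
    by (rule integral_continuous_on_param)
  then show ?thesis
    unfolding flux_def case_prod_beta by (intro continuous_intros) simp
qed

lemma continuous_on_flux:
  assumes "continuous_on {0..} h"
  shows "continuous_on {0..} (flux N h)"
proof -
  have "continuous_on (UNIV \<times> {0..}) (\<lambda>(c::real, t). h t)"
    unfolding case_prod_beta by (intro continuous_on_compose2[OF assms] continuous_intros) auto
  then have "continuous_on (UNIV \<times> {0..}) (\<lambda>(c::real, r). flux N h r)"
    by (rule continuous_on_flux_param)
  from continuous_on_compose2[OF this, of "{0..}" "Pair 0"] show ?thesis
    by (force simp: continuous_on_Pair)
qed

lemma continuous_on_potential_param: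
  fixes k :: "'a::topological_space \<Rightarrow> real \<Rightarrow> real"
  assumes k: "continuous_on (S \<times> {0..}) (\<lambda>(c, t). k c t)"
  shows "continuous_on (S \<times> {0..}) (\<lambda>(c, r). potential N a (k c) r)"
proof -
  note fl = continuous_on_flux_param[OF k, of N]
  have "continuous_on ((S \<times> {0..}) \<times> cbox 0 (1::real)) (\<lambda>(q, x). flux N (k (fst q)) (snd q * x))"
    unfolding case_prod_beta
    by (intro continuous_intros continuous_on_compose2[OF fl, of _ "\<lambda>p. (fst (fst p), snd (fst p) * snd p)", simplified])
       auto
  then have "continuous_on (S \<times> {0..}) (\<lambda>q. integral (cbox 0 1) (\<lambda>x. flux N (k (fst q)) (snd q * x)))"
    by (rule integral_continuous_on_param)
  then have 1: "continuous_on (S \<times> {0..}) (\<lambda>q. a - snd q * integral {0..1} (\<lambda>x. flux N (k (fst q)) (snd q * x)))"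
    by (intro continuous_intros) simp
  have 2: "potential N a (k c) r = a - r * integral {0..1} (\<lambda>x. flux N (k c) (r * x))" if "c \<in> S" "0 \<le> r" for c r
  proof -
    have "continuous_on {0..} (k c)"
      using continuous_on_compose2[OF k, of "{0..}" "Pair c"] that by (auto simp: continuous_on_Pair)
    then have "continuous_on {0..r} (flux N (k c))"
      by (rule continuous_on_subset[OF continuous_on_flux]) auto
    then show ?thesis unfolding potential_def using integral_rescale[OF that(2)] by simp
  qed
  show ?thesis
    by (rule continuous_on_eq[OF 1]) (auto simp: 2)
qed

lemma power_weighted_flux_deriv:
  assumes r: "0 < r" and h: "continuous_on {0..} h"
  shows "((\<lambda>r. r ^ (N - 1) * flux N h r) has_real_derivative r ^ (N - 1) * h r) (at r)"
proof -
  let ?I = "\<lambda>x. integral {0..x} (\<lambda>t. t ^ (N - 1) * h t)"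
  have c: "continuous_on {0..r + 1} (\<lambda>t. t ^ (N - 1) * h t)"
    by (intro continuous_intros continuous_on_subset[OF h]) auto
  have "(?I has_real_derivative r ^ (N - 1) * h r) (at r within {0..r + 1})"
    using integral_has_real_derivative[OF c, of r] r by auto
  then have "(?I has_real_derivative r ^ (N - 1) * h r) (at r)"
    using r by (simp add: at_within_Icc_at)
  then show ?thesis
    by (rule has_field_derivative_transform_within_open[of _ _ _ "{0<..}"])
       (use r h in \<open>auto simp del: One_nat_def simp: power_weighted_flux continuous_on_subset\<close>)
qed

lemma flux_deriv:
  assumes r: "0 < r" and N: "0 < N" and h: "continuous_on {0..} h"
  shows "(flux N h has_real_derivative h r - (real N - 1) / r * flux N h r) (at r)"
proof -
  have "((\<lambda>r. (r ^ (N - 1) * flux N h r) / r ^ (N - 1)) has_real_derivative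
      ((r ^ (N - 1) * h r) * r ^ (N - 1) - (r ^ (N - 1) * flux N h r) * (real (N - 1) * r ^ (N - 1 - 1)))
        / (r ^ (N - 1) * r ^ (N - 1))) (at r)"
    using r by (intro DERIV_divide power_weighted_flux_deriv h) (auto intro!: derivative_eq_intros)
  moreover have "((r ^ (N - 1) * h r) * r ^ (N - 1) - (r ^ (N - 1) * flux N h r) * (real (N - 1) * r ^ (N - 1 - 1)))
        / (r ^ (N - 1) * r ^ (N - 1)) = h r - (real N - 1) / r * flux N h r"
  proof (cases "N = 1")
    case False
    then obtain m where m: "N = Suc (Suc m)" using N by (metis One_nat_def not0_implies_Suc not_gr0)
    show ?thesis using r unfolding m by (simp add: field_simps)
  qed simp
  ultimately have "((\<lambda>r. (r ^ (N - 1) * flux N h r) / r ^ (N - 1)) has_real_derivative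
      h r - (real N - 1) / r * flux N h r) (at r)" by simp
  then show ?thesis
    by (rule has_field_derivative_transform_within_open[of _ _ _ "{0<..}"]) (use r in auto)
qed

lemma potential_deriv:
  assumes r: "0 \<le> r" and h: "continuous_on {0..} h"
  shows "(potential N a h has_real_derivative - flux N h r) (at r within {0..})"
proof -
  have c: "continuous_on {0..r + 1} (flux N h)"
    by (rule continuous_on_subset[OF continuous_on_flux[OF h]]) auto
  have "((\<lambda>x. integral {0..x} (flux N h)) has_real_derivative flux N h r) (at r within {0..r + 1})"
    using integral_has_real_derivative[OF c, of r] r by auto
  then have "(potential N a h has_real_derivative - flux N h r) (at r within {0..r + 1})"
    unfolding potential_def by (auto intro!: derivative_eq_intros)
  moreover have "at r within {0..r + 1} = at r within {0..}"
    by (rule at_within_nhd[of _ "{..<r + 1}"]) auto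
  ultimately show ?thesis by simp
qed

lemma potential_deriv_at:
  assumes "0 < r" "continuous_on {0..} h"
  shows "(potential N a h has_real_derivative - flux N h r) (at r)"
proof -
  have "(potential N a h has_real_derivative - flux N h r) (at r within {0<..})"
    by (rule DERIV_subset[OF potential_deriv]) (use assms in auto)
  then show ?thesis using assms by (simp add: at_within_open[of r "{0<..}"])
qed

lemma potential_continuous:
  assumes "continuous_on {0..} h"
  shows "continuous_on {0..} (potential N a h)"
  by (rule DERIV_continuous_on[OF potential_deriv]) (use assms in auto)

lemma potential_lipschitz:
  assumes N: "0 < N" and h: "continuous_on {0..} h" and M: "\<And>t. 0 \<le> t \<Longrightarrow> t \<le> R \<Longrightarrow> \<bar>h t\<bar> \<le> M"
    and x: "0 \<le> x" "x \<le> y" "y \<le> R"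
  shows "\<bar>potential N a h y - potential N a h x\<bar> \<le> M * R / N * \<bar>y - x\<bar>"
proof -
  have M0: "0 \<le> M" using M[of 0] x by simp
  have "norm (potential N a h y - potential N a h x) \<le> M * R / N * norm (y - x)"
  proof (rule differentiable_bound[of "{0..R}" _ "\<lambda>r. (*) (- flux N h r)"])
    fix r assume r: "r \<in> {0..R}"
    have "(potential N a h has_real_derivative (- flux N h r)) (at r within {0..R})"
      using DERIV_subset[OF potential_deriv[of r h N a], of "{0..R}"] r h by auto
    then show "(potential N a h has_derivative (*) (- flux N h r)) (at r within {0..R})"
      by (simp add: has_field_derivative_def)
    have "\<bar>flux N h r\<bar> \<le> M * r / N"
      using r by (intro flux_abs_le N continuous_on_subset[OF h] M) auto
    also have "\<dots> \<le> M * R / N" using r M0 by (simp add: divide_right_mono mult_left_mono)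
    finally have "\<bar>flux N h r\<bar> \<le> M * R / N" .
    then show "onorm ((*) (- flux N h r)) \<le> M * R / N"
      by (intro onorm_le) (use mult_right_mono[OF \<open>\<bar>flux N h r\<bar> \<le> M * R / N\<close> abs_ge_zero] in \<open>simp add: abs_mult\<close>)
  qed (use x in auto)
  then show ?thesis by simp
qed

section \<open>Radial solutions and their energy\<close>

lemma first_nonpos:
  fixes f :: "real \<Rightarrow> real"
  assumes f: "continuous_on {l..m} f" and l: "0 < f l" and m: "f m \<le> 0" and lm: "l \<le> m"
  obtains c where "l < c" "c \<le> m" "f c = 0" "\<And>x. l \<le> x \<Longrightarrow> x < c \<Longrightarrow> 0 < f x"
proof -
  define S where "S = {x \<in> {l..m}. f x = 0}"
  have "closed S"
    unfolding S_def by (rule continuous_closed_preimage_constant[OF f]) simp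
  moreover have "bounded S"
    by (rule bounded_subset[of "{l..m}"]) (auto simp: S_def)
  ultimately have "compact S"
    by (simp add: compact_eq_bounded_closed)
  obtain x0 where "l \<le> x0" "x0 \<le> m" "f x0 = 0"
    using IVT2'[of f m 0 l] assms by auto
  then have ne: "S \<noteq> {}" by (auto simp: S_def)
  obtain c where c: "c \<in> S" "\<And>x. x \<in> S \<Longrightarrow> c \<le> x"
    using compact_attains_inf[OF \<open>compact S\<close> ne] by blast
  have pos: "0 < f x" if "l \<le> x" "x < c" for x
  proof (rule ccontr)
    assume "\<not> 0 < f x"
    moreover have "continuous_on {l..x} f"
      using c that by (intro continuous_on_subset[OF f]) (auto simp: S_def)
    ultimately have "\<exists>y\<ge>l. y \<le> x \<and> f y = 0"
      using l that by (intro IVT2') auto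
    then obtain y where "l \<le> y" "y \<le> x" "f y = 0" by blast
    then have "c \<le> y" using c that by (auto simp: S_def)
    then show False using \<open>y \<le> x\<close> that by simp
  qed
  have "l \<le> c" "c \<le> m" "f c = 0" using c(1) by (auto simp: S_def)
  moreover have "l \<noteq> c" using \<open>f c = 0\<close> l by auto
  ultimately show ?thesis using pos by (intro that[of c]) auto
qed

text \<open>This and the following lemma ask for a derivative at interior points only, since most
  functions below are differentiable only away from the centre \<open>r = 0\<close>.\<close>

lemma strict_decreasing_of_deriv:
  fixes f :: "real \<Rightarrow> real"
  assumes "x < y" "continuous_on {x..y} f"
    and "\<And>t. x < t \<Longrightarrow> t < y \<Longrightarrow> \<exists>d. (f has_real_derivative d) (at t) \<and> d < 0"
  shows "f y < f x"
  using DERIV_neg_imp_decreasing_open[of x y f] assms by blast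

lemma decreasing_of_deriv:
  fixes f :: "real \<Rightarrow> real"
  assumes "x \<le> y" "continuous_on {x..y} f"
    and "\<And>t. x < t \<Longrightarrow> t < y \<Longrightarrow> \<exists>d. (f has_real_derivative d) (at t) \<and> d \<le> 0"
  shows "f y \<le> f x"
  using DERIV_nonpos_imp_decreasing_open[of x y f] assms by blast

text \<open>The integrated form of the radial problem. It has no singular term at the centre and survives
  uniform limits, so that existence by compactness needs no extra regularity argument.\<close>

definition radial_sol :: "nat \<Rightarrow> (real \<Rightarrow> real) \<Rightarrow> real \<Rightarrow> (real \<Rightarrow> real) \<Rightarrow> bool" where
  "radial_sol N g a u \<longleftrightarrow>
     continuous_on {0..} u \<and> (\<forall>r\<ge>0. u r = potential N a (\<lambda>t. g (u t)) r)"

text \<open>The sign conditions are those of \<open>f 1\<close>, required only up to the starting height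
  \<open>a\<close>. The continuation by 0 to negative values makes the primitive vanish there,
  so that a solution with negative energy is positive, and a solution that has crossed zero is
  harmonic and cannot come back.\<close>

locale well =
  fixes N :: nat and g :: "real \<Rightarrow> real" and b a :: real
  assumes N: "N > 2"
    and g_cont: "continuous_on UNIV g"
    and g_0: "s \<le> 0 \<Longrightarrow> g s = 0"
    and b: "0 < b"
    and g_nonpos: "0 \<le> s \<Longrightarrow> s \<le> b \<Longrightarrow> g s \<le> 0"
    and g_neg: "\<exists>e>0. \<forall>s\<in>{0<..<e}. g s < 0"
    and g_pos: "b < s \<Longrightarrow> s \<le> a \<Longrightarrow> 0 < g s"
begin

lemma primitive_0: "s \<le> 0 \<Longrightarrow> primitive g s = 0"
  by (cases "s = 0") (auto simp: primitive_def)

text \<open>The primitive is constant on the negative half line because integrals over reversed intervals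
  are 0; since \<open>g\<close> vanishes there, it is nevertheless differentiable at 0.\<close>

lemma primitive_deriv: "(primitive g has_real_derivative g s) (at s)"
proof (cases "s < 0")
  case True
  have "((\<lambda>_. 0) has_real_derivative g s) (at s)"
    using True by (simp add: g_0)
  then show ?thesis
    by (rule has_field_derivative_transform_within_open[of _ _ _ "{..<0}"])
       (use True in \<open>auto simp: primitive_0\<close>)
next
  case False
  have eq: "integral {-1..x} g = primitive g x" if "-1 < x" for x
  proof (cases "x \<le> 0")
    case True
    have "integral {-1..x} g = integral {-1..x} (\<lambda>_. 0)"
      using True by (intro integral_cong) (auto simp: g_0)
    then show ?thesis using True by (simp add: primitive_0)
  next
    case False
    have "integral {-1..0} g + integral {0..x} g = integral {-1..x} g"
      using False by (intro Henstock_Kurzweil_Integration.integral_combine integrable_continuous_interval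
          continuous_on_subset[OF g_cont]) auto
    moreover have "integral {-1..0} g = integral {-1..0::real} (\<lambda>_. 0)"
      by (intro integral_cong) (auto simp: g_0)
    ultimately show ?thesis by (simp add: primitive_def)
  qed
  have "((\<lambda>x. integral {-1..x} g) has_real_derivative g s) (at s within {-1..s + 1})"
    using False by (intro integral_has_real_derivative continuous_on_subset[OF g_cont]) auto
  moreover have "at s within {-1..s + 1} = at s"
    using False by (intro at_within_Icc_at) auto
  ultimately have "((\<lambda>x. integral {-1..x} g) has_real_derivative g s) (at s)" by simp
  then show ?thesis
    by (rule has_field_derivative_transform_within_open[of _ _ _ "{-1<..}"])
       (use False eq in auto)
qed

lemma primitive_cont: "continuous_on S (primitive g)"
  by (rule continuous_on_subset[OF DERIV_continuous_on[OF has_field_derivative_at_within[OF primitive_deriv], of UNIV]]) auto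

lemma primitive_neg:
  assumes "0 < s" "s \<le> b" shows "primitive g s < 0"
proof -
  obtain e where e: "e > 0" "\<And>s. 0 < s \<Longrightarrow> s < e \<Longrightarrow> g s < 0" using g_neg by auto
  define t where "t = min s (e / 2)"
  have "primitive g t < primitive g 0"
    by (rule strict_decreasing_of_deriv)
       (use assms e in \<open>auto simp: t_def intro!: primitive_cont exI[of _ "g _"] primitive_deriv\<close>)
  moreover have "primitive g s \<le> primitive g t"
    by (rule decreasing_of_deriv)
       (use assms e in \<open>auto simp: t_def intro!: primitive_cont exI[of _ "g _"] primitive_deriv g_nonpos\<close>)
  ultimately show ?thesis by (simp add: primitive_0)
qed

end

locale shot = well +
  fixes u :: "real \<Rightarrow> real"
  assumes sol: "radial_sol N g a u"
begin

abbreviation V :: "real \<Rightarrow> real" where "V \<equiv> flux N (\<lambda>t. g (u t))"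

definition E :: "real \<Rightarrow> real" where "E r = (V r)\<^sup>2 / 2 + primitive g (u r)"

lemma u_cont: "continuous_on {0..} u"
  using sol by (simp add: radial_sol_def)

lemma u_eq: "0 \<le> r \<Longrightarrow> u r = potential N a (\<lambda>t. g (u t)) r"
  using sol by (simp add: radial_sol_def)

lemma u_0: "u 0 = a"
  by (simp add: u_eq)

lemma source_cont: "continuous_on {0..} (\<lambda>t. g (u t))"
  by (rule continuous_on_compose2[OF g_cont u_cont]) auto

lemma V_cont: "continuous_on {0..} V"
  by (rule continuous_on_flux[OF source_cont])

lemma u_deriv: "0 < r \<Longrightarrow> (u has_real_derivative - V r) (at r)"
  by (rule has_field_derivative_transform_within_open[OF potential_deriv_at[of r "\<lambda>t. g (u t)" N a] , of "{0<..}"])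
     (auto simp: source_cont u_eq[symmetric])

lemma V_deriv: "0 < r \<Longrightarrow> (V has_real_derivative g (u r) - (real N - 1) / r * V r) (at r)"
  by (rule flux_deriv) (use N source_cont in auto)

lemma W_deriv: "0 < r \<Longrightarrow> ((\<lambda>r. r ^ (N - 1) * V r) has_real_derivative r ^ (N - 1) * g (u r)) (at r)"
  by (rule power_weighted_flux_deriv[OF _ source_cont])

lemma E_deriv:
  assumes "0 < r" shows "(E has_real_derivative - (real N - 1) / r * (V r)\<^sup>2) (at r)"
proof -
  have "((\<lambda>r. primitive g (u r)) has_real_derivative g (u r) * (- V r)) (at r)"
    by (rule DERIV_chain2[OF primitive_deriv u_deriv[OF assms]])
  then have "((\<lambda>r. (V r)\<^sup>2 / 2 + primitive g (u r)) has_real_derivative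
     V r * (g (u r) - (real N - 1) / r * V r) + g (u r) * (- V r)) (at r)"
    by (auto intro!: derivative_eq_intros V_deriv assms)
  moreover have "V r * (g (u r) - (real N - 1) / r * V r) + g (u r) * (- V r) = - (real N - 1) / r * (V r)\<^sup>2"
    using assms by (simp add: field_simps power2_eq_square)
  ultimately show ?thesis unfolding E_def[abs_def] by simp
qed

lemma E_deriv_sign:
  assumes "0 < r"
  shows "- (real N - 1) / r * (V r)\<^sup>2 \<le> 0" "V r \<noteq> 0 \<Longrightarrow> - (real N - 1) / r * (V r)\<^sup>2 < 0"
  using assms N by (auto simp: mult_nonpos_nonneg divide_nonpos_pos divide_neg_pos mult_neg_pos)

lemma E_cont: "continuous_on {0..} E"
  unfolding E_def[abs_def]
  by (intro continuous_intros V_cont continuous_on_compose2[OF primitive_cont u_cont]) auto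

lemma E_antimono:
  assumes "0 \<le> r" "r \<le> t" shows "E t \<le> E r"
proof (rule decreasing_of_deriv[of r t E])
  fix x assume "r < x" "x < t"
  then show "\<exists>d. (E has_real_derivative d) (at x) \<and> d \<le> 0"
    using E_deriv[of x] E_deriv_sign(1)[of x] assms(1) by force
qed (use assms in \<open>auto intro: continuous_on_subset[OF E_cont]\<close>)

lemma E_strict_antimono:
  assumes "0 \<le> r" "r < t" "\<And>x. r < x \<Longrightarrow> x < t \<Longrightarrow> V x \<noteq> 0" shows "E t < E r"
proof (rule strict_decreasing_of_deriv[of r t E])
  fix x assume x: "r < x" "x < t"
  then show "\<exists>d. (E has_real_derivative d) (at x) \<and> d < 0"
    using E_deriv[of x] E_deriv_sign(2)[of x] assms(1,3) by force
qed (use assms in \<open>auto intro: continuous_on_subset[OF E_cont]\<close>)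

lemma u_antimono:
  assumes "0 \<le> r" "r \<le> t" "\<And>x. r < x \<Longrightarrow> x < t \<Longrightarrow> 0 \<le> V x" shows "u t \<le> u r"
proof (rule decreasing_of_deriv[of r t u])
  fix x assume "r < x" "x < t"
  then show "\<exists>d. (u has_real_derivative d) (at x) \<and> d \<le> 0"
    using u_deriv[of x] assms by (intro exI conjI) auto
qed (use assms in \<open>auto intro: continuous_on_subset[OF u_cont]\<close>)

lemma u_strict_antimono:
  assumes "0 \<le> r" "r < t" "\<And>x. r < x \<Longrightarrow> x < t \<Longrightarrow> 0 < V x" shows "u t < u r"
proof (rule strict_decreasing_of_deriv[of r t u])
  fix x assume "r < x" "x < t"
  then show "\<exists>d. (u has_real_derivative d) (at x) \<and> d < 0"
    using u_deriv[of x] assms by (intro exI conjI) auto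
qed (use assms in \<open>auto intro: continuous_on_subset[OF u_cont]\<close>)

lemma E_0: "E 0 = primitive g a"
  by (simp add: E_def u_0)

lemma V_pos_near_0:
  assumes "0 < g a" obtains \<eta> where "0 < \<eta>" "\<And>r. 0 < r \<Longrightarrow> r \<le> \<eta> \<Longrightarrow> 0 < V r"
proof -
  have "continuous_on {0..} (\<lambda>t. g (u t))" by (rule source_cont)
  then obtain d where d: "d > 0" "\<And>t. t \<in> {0..} \<Longrightarrow> dist t 0 < d \<Longrightarrow> dist (g (u t)) (g (u 0)) < g a / 2"
    unfolding continuous_on_iff using assms by (elim ballE[of _ _ 0] allE[of _ "g a / 2"]) auto
  have "0 < V r" if r: "0 < r" "r \<le> d / 2" for r
  proof -
    have "g a / 2 * r / N \<le> V r"
    proof (rule flux_ge)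
      fix t assume t: "0 \<le> t" "t \<le> r"
      then have "dist (g (u t)) (g (u 0)) < g a / 2" using d r by (intro d) auto
      then show "g a / 2 \<le> g (u t)" unfolding dist_real_def u_0 by linarith
    qed (use N r in \<open>auto intro: continuous_on_subset[OF source_cont]\<close>)
    moreover have "0 < g a / 2 * r / N" using assms r N by simp
    ultimately show ?thesis by linarith
  qed
  then show ?thesis using that[of "d / 2"] d by auto
qed

text \<open>Harmonic functions have constant weighted flux, and \<open>u\<close> is harmonic where it is
  not positive.\<close>

lemma V_const_weight:
  assumes "0 \<le> r" "r < t" "\<And>x. r < x \<Longrightarrow> x < t \<Longrightarrow> u x \<le> 0"
  shows "t ^ (N - 1) * V t = r ^ (N - 1) * V r"
proof (rule DERIV_isconst_end[OF assms(2)])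
  show "continuous_on {r..t} (\<lambda>r. r ^ (N - 1) * V r)"
    using assms by (intro continuous_intros continuous_on_subset[OF V_cont]) auto
  fix x assume x: "r < x" "x < t"
  then show "((\<lambda>r. r ^ (N - 1) * V r) has_real_derivative 0) (at x)"
    using W_deriv[of x] assms by (simp add: g_0)
qed

lemma drift:
  assumes "0 \<le> R" "0 < c" "\<And>r. R < r \<Longrightarrow> c \<le> V r"
  obtains r where "R < r" "u r < 0"
proof -
  define r where "r = R + (\<bar>u R\<bar> + 1) / c"
  have r: "R < r" using assms by (simp add: r_def add_pos_nonneg)
  have "(\<lambda>x. u x + c * x) r \<le> (\<lambda>x. u x + c * x) R"
  proof (rule decreasing_of_deriv[of R r "\<lambda>x. u x + c * x"])
    fix x assume "R < x" "x < r"
    then show "\<exists>d. ((\<lambda>x. u x + c * x) has_real_derivative d) (at x) \<and> d \<le> 0"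
      using assms by (intro exI[of _ "- V x + c"]) (auto intro!: derivative_eq_intros u_deriv)
  next
    show "continuous_on {R..r} (\<lambda>x. u x + c * x)"
      using assms by (intro continuous_intros continuous_on_subset[OF u_cont]) auto
  qed (use r in auto)
  moreover have "c * r = c * R + \<bar>u R\<bar> + 1" using assms by (simp add: r_def field_simps)
  ultimately have "u r < 0" by simp
  then show ?thesis by (rule that[OF r])
qed

end

text \<open>Where \<open>g\<close> is not Lipschitz, a solution can reach 0 with zero speed and continue
  in more than one way; such a solution is neither a ground state nor a crossing one. The
  assumption excludes this and is verified later by \<open>no_touch_transfer\<close>.\<close>

locale transversal_shot = shot +
  assumes a: "0 < a"
    and no_touch: "0 < r0 \<Longrightarrow> (\<And>r. 0 \<le> r \<Longrightarrow> r < r0 \<Longrightarrow> 0 < u r) \<Longrightarrow> u r0 = 0 \<Longrightarrow> V r0 \<noteq> 0"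
begin

lemma a_gt_b: "0 \<le> E 0 \<Longrightarrow> b < a"
  using primitive_neg[of a] a by (force simp: E_0)

text \<open>At the first radius where the speed vanishes the solution has a critical point after a
  decrease, so \<open>g\<close> is not positive there and the height is at most
  \<open>b\<close>. The energy at that point is the primitive, which is negative on
  \<open>{0<..b}\<close>; hence the height is 0, and this is a tangential zero.\<close>

lemma V_pos:
  assumes E: "0 \<le> E T" and r: "0 < r" "r \<le> T"
  shows "0 < V r"
proof (rule ccontr)
  assume neg: "\<not> 0 < V r"
  have E': "0 \<le> E t" if "0 \<le> t" "t \<le> T" for t using E_antimono[of t T] that E by simp
  have ab: "b < a" using a_gt_b E' r by simp
  obtain \<eta> where \<eta>: "0 < \<eta>" "\<And>r. 0 < r \<Longrightarrow> r \<le> \<eta> \<Longrightarrow> 0 < V r"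
    using V_pos_near_0 g_pos[of a] ab by auto
  have r\<eta>: "\<eta> < r" using \<eta> neg r by force
  obtain c where c: "\<eta> < c" "c \<le> r" "V c = 0" "\<And>x. \<eta> \<le> x \<Longrightarrow> x < c \<Longrightarrow> 0 < V x"
    by (rule first_nonpos[of \<eta> r V])
       (use \<eta> r\<eta> neg in \<open>auto intro: continuous_on_subset[OF V_cont]\<close>)
  have c0: "0 < c" using c \<eta> by simp
  have Vc: "0 < V x" if "0 < x" "x < c" for x
    using \<eta> c that by (cases "x \<le> \<eta>") auto
  have "u c \<le> u 0" by (rule u_antimono) (use c0 Vc in \<open>simp_all add: less_imp_le\<close>)
  then have "u c \<le> a" by (simp add: u_0)
  have "g (u c) \<le> 0"
  proof (rule ccontr)
    assume "\<not> g (u c) \<le> 0"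
    then have "(V has_real_derivative g (u c)) (at c)" "0 < g (u c)"
      using V_deriv[OF c0] c by auto
    then obtain d where d: "d > 0" "\<And>h. h > 0 \<Longrightarrow> h < d \<Longrightarrow> V (c - h) < V c"
      using DERIV_pos_inc_left by blast
    have "V (c - min (d / 2) (c / 2)) < V c" using d c0 by (intro d) auto
    moreover have "0 < V (c - min (d / 2) (c / 2))" using d c0 by (intro Vc) auto
    ultimately show False using c by simp
  qed
  then have "u c \<le> b" using g_pos[of "u c"] \<open>u c \<le> a\<close> by force
  moreover have "0 \<le> primitive g (u c)" using E'[of c] c c0 r by (simp add: E_def)
  ultimately have uc: "u c \<le> 0" using primitive_neg[of "u c"] by force
  have "u c = 0"
  proof (rule ccontr)
    assume "u c \<noteq> 0"
    then have "u c < 0" using uc by simp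
    moreover have "isCont u c" using u_deriv[OF c0] DERIV_isCont by blast
    ultimately obtain d where d: "d > 0" "\<And>x. dist x c < d \<Longrightarrow> dist (u x) (u c) < - u c"
      unfolding continuous_at_eps_delta by (metis neg_0_less_iff_less)
    define y where "y = c - min (d / 2) (c / 2)"
    have y: "0 < y" "y < c" using d c0 by (auto simp: y_def)
    have "u x \<le> 0" if "y < x" "x < c" for x
      using d(2)[of x] that d(1) unfolding y_def dist_real_def by (smt (verit) field_sum_of_halves)
    then have "c ^ (N - 1) * V c = y ^ (N - 1) * V y"
      using y by (intro V_const_weight) auto
    then have "V y = 0" using y c by simp
    then show False using Vc[OF y] by simp
  qed
  moreover have "0 < u x" if x: "0 \<le> x" "x < c" for x
  proof -
    have "u c < u x" using x Vc by (intro u_strict_antimono) auto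
    then show ?thesis using \<open>u c = 0\<close> by simp
  qed
  ultimately show False using no_touch[OF c0] c by blast
qed

text \<open>The solution decreases to some limit \<open>l\<close>. If \<open>l > 0\<close>, the speed
  stays away from 0: for \<open>l \<le> b\<close> because the primitive at \<open>l\<close> is
  negative while the energy is not, and for \<open>l > b\<close> because \<open>g\<close> has
  a positive lower bound along the solution. Then \<open>u\<close> would become negative.\<close>

lemma decreasing_to_zero:
  assumes E: "\<And>r. 0 \<le> r \<Longrightarrow> 0 \<le> E r" and u: "\<And>r. 0 \<le> r \<Longrightarrow> 0 \<le> u r"
  shows "(u \<longlongrightarrow> 0) at_top"
proof -
  have V: "0 < V r" if "0 < r" for r using V_pos[of r r] E that by simp
  have mono: "u t \<le> u r" if "0 \<le> r" "r \<le> t" for r t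
    by (rule u_antimono[OF that]) (use V that in \<open>simp add: less_imp_le\<close>)
  have "decseq (\<lambda>n. u (real n))" using mono by (auto simp: decseq_def)
  then obtain l where l: "(\<lambda>n. u (real n)) \<longlonglongrightarrow> l" "\<And>n. l \<le> u (real n)"
    using decseq_convergent[of "\<lambda>n. u (real n)" 0] u by auto
  have lim_pos: "0 \<le> l" using LIMSEQ_le_const[OF l(1)] u by auto
  have lim_le: "l \<le> u r" if "0 \<le> r" for r
    using l(2)[of "nat \<lceil>r\<rceil>"] mono[of r "real (nat \<lceil>r\<rceil>)"] that by linarith
  have lim: "(u \<longlongrightarrow> l) at_top"
  proof (rule decreasing_tendsto)
    show "\<forall>\<^sub>F r in at_top. l \<le> u r"
      using lim_le by (auto intro: eventually_mono[OF eventually_ge_at_top[of 0]])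
    fix x assume "l < x"
    then have "\<forall>\<^sub>F n in sequentially. u (real n) < x" using l(1) order_tendstoD(2) by blast
    then obtain n where n: "u (real n) < x" by (auto simp: eventually_sequentially)
    show "\<forall>\<^sub>F r in at_top. u r < x"
      by (rule eventually_mono[OF eventually_ge_at_top[of "real n"]])
         (use mono[of "real n"] n in \<open>auto intro: le_less_trans\<close>)
  qed
  have "l = 0"
  proof (rule ccontr)
    assume "l \<noteq> 0"
    then have lim_pos: "0 < l" using lim_pos by simp
    have "\<exists>R c. 0 \<le> R \<and> 0 < c \<and> (\<forall>r>R. c \<le> V r)"
    proof (cases "l \<le> b")
      case True
      define G where "G = primitive g l"
      have G: "G < 0" using primitive_neg lim_pos True by (simp add: G_def)
      have "isCont (primitive g) l" using primitive_deriv DERIV_isCont by blast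
      then have "((\<lambda>r. primitive g (u r)) \<longlongrightarrow> G) at_top"
        unfolding G_def using lim isCont_tendsto_compose by blast
      then have "\<forall>\<^sub>F r in at_top. primitive g (u r) < G / 2"
        using G by (intro order_tendstoD(2)) auto
      then obtain R where R: "\<And>r. r \<ge> R \<Longrightarrow> primitive g (u r) < G / 2"
        by (auto simp: eventually_at_top_linorder)
      have "sqrt (- G) \<le> V r" if "r > max R 0" for r
      proof (rule real_le_lsqrt)
        show "- G \<le> (V r)\<^sup>2" using E[of r] R[of r] that unfolding E_def by auto
      qed (use V[of r] that G in auto)
      then show ?thesis using G by (intro exI[of _ "max R 0"] exI[of _ "sqrt (- G)"]) auto
    next
      case False
      have "compact {l..a}" "{l..a} \<noteq> {}" using lim_le[of 0] u_0 by auto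
      then obtain s where s: "s \<in> {l..a}" "\<And>x. x \<in> {l..a} \<Longrightarrow> g s \<le> g x"
        using continuous_attains_inf[of "{l..a}" g] continuous_on_subset[OF g_cont, of "{l..a}"] by auto
      have gs: "0 < g s" using g_pos[of s] s False by auto
      have "g s / N \<le> V r" if "r > 1" for r
      proof -
        have "g s * r / N \<le> V r"
          by (rule flux_ge) (use N that lim_le mono[of 0] u_0 s in \<open>auto intro: continuous_on_subset[OF source_cont]\<close>)
        moreover have "g s / N \<le> g s * r / N" using gs that N by (simp add: divide_right_mono)
        ultimately show ?thesis by simp
      qed
      then show ?thesis using gs N by (intro exI[of _ 1] exI[of _ "g s / N"]) auto
    qed
    then obtain R c where "0 \<le> R" "0 < c" "\<And>r. r > R \<Longrightarrow> c \<le> V r" by blast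
    then obtain r where "R < r" "u r < 0" using drift by metis
    then show False using u[of r] \<open>0 \<le> R\<close> by simp
  qed
  then show ?thesis using lim by simp
qed

lemma attains_all_heights:
  assumes E: "\<And>r. 0 \<le> r \<Longrightarrow> 0 \<le> E r" and s: "0 < s" "s \<le> a"
  obtains r where "0 \<le> r" "u r = s"
proof -
  have "\<exists>R\<ge>0. u R \<le> s"
  proof (cases "\<forall>r\<ge>0. 0 \<le> u r")
    case True
    then have "(u \<longlongrightarrow> 0) at_top" using decreasing_to_zero E by blast
    then have "\<forall>\<^sub>F r in at_top. u r < s" using s order_tendstoD(2) by blast
    then obtain R where "\<And>r. r \<ge> R \<Longrightarrow> u r < s" by (auto simp: eventually_at_top_linorder)
    then show ?thesis by (intro exI[of _ "max R 0"]) (simp add: less_imp_le)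
  next
    case False
    then show ?thesis using s by force
  qed
  then obtain R where "0 \<le> R" "u R \<le> s" by blast
  then show ?thesis
    using IVT2'[of u R s 0] s that u_0 continuous_on_subset[OF u_cont, of "{0..R}"] by force
qed

text \<open>At the first zero the energy is not negative, so the speed is positive by
  \<open>V_pos\<close>; afterwards the solution is harmonic and its weighted flux keeps this
  sign.\<close>

lemma crossing:
  assumes r: "0 \<le> r" "u r \<le> 0"
  shows "\<exists>c>0. c \<le> r \<and> u c = 0 \<and> 0 < V c \<and> (\<forall>x>c. u x < 0)"
proof -
  obtain c where c: "0 < c" "c \<le> r" "u c = 0" "\<And>x. 0 \<le> x \<Longrightarrow> x < c \<Longrightarrow> 0 < u x"
    by (rule first_nonpos[of 0 r u])
       (use r u_0 a in \<open>auto intro: continuous_on_subset[OF u_cont]\<close>)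
  have "0 \<le> E c" using c by (simp add: E_def primitive_0)
  then have Vc: "0 < V c" using V_pos[of c c] c by simp
  have after: "u x < 0" if x: "c < x" for x
  proof (rule ccontr)
    assume neg: "\<not> u x < 0"
    obtain d where d: "d > 0" "\<And>h. h > 0 \<Longrightarrow> h < d \<Longrightarrow> u (c + h) < u c"
      using DERIV_neg_dec_right[OF u_deriv[OF c(1)]] Vc by auto
    define y where "y = c + min (d / 2) ((x - c) / 2)"
    have y: "c < y" "y < x" using d x by (auto simp: y_def min_def field_simps)
    have uy: "u y < 0" unfolding y_def using d(2)[of "min (d / 2) ((x - c) / 2)"] d(1) x c by auto
    obtain z where z: "y < z" "z \<le> x" "- u z = 0" "\<And>t. y \<le> t \<Longrightarrow> t < z \<Longrightarrow> 0 < - u t"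
      by (rule first_nonpos[of y x "\<lambda>t. - u t"])
         (use y uy neg c in \<open>auto intro!: continuous_intros continuous_on_subset[OF u_cont]\<close>)
    have less: "u t < 0" if "c < t" "t < z" for t
    proof (cases "t < y")
      case True
      then have "t - c < d"
        using d(1) min.cobounded1[of "d / 2" "(x - c) / 2"] unfolding y_def by linarith
      then show ?thesis using d(2)[of "t - c"] that c by simp
    qed (use z that in force)
    have "u z < u c"
    proof (rule u_strict_antimono)
      fix t assume t: "c < t" "t < z"
      have "t ^ (N - 1) * V t = c ^ (N - 1) * V c"
        using t c less_imp_le[OF less] by (intro V_const_weight) auto
      then have "0 < t ^ (N - 1) * V t" using c Vc by simp
      then show "0 < V t" using c t by (simp add: zero_less_mult_iff)
    qed (use c y z in auto)
    then show False using z c by simp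
  qed
  show ?thesis using c(1-3) Vc after by blast
qed

text \<open>Negative energy and a zero exclude each other. Together with the next two lemmas this gives
  the trichotomy behind the shooting argument: negative energy, crossing, or ground state.\<close>

lemma positive_before_negative_energy:
  assumes "E r < 0" "0 \<le> t" "t \<le> r" shows "0 < u t"
proof (rule ccontr)
  assume "\<not> 0 < u t"
  then have "u t \<le> 0" by simp
  then obtain c where c: "0 < c" "c \<le> t" "u c = 0" "0 < V c" "\<And>x. c < x \<Longrightarrow> u x < 0"
    using crossing[OF assms(2)] by blast
  have "u r \<le> 0" using c assms less_imp_le[of "u r" 0] by (cases "r = c") auto
  then have "0 \<le> E r" by (simp add: E_def primitive_0)
  then show False using assms by simp
qed

lemma positive_energy_before_crossing:
  assumes "u r < 0" "0 \<le> r"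
  obtains r' where "0 < r'" "u r' < 0" "0 < E r'"
proof -
  obtain c where c: "0 < c" "c \<le> r" "u c = 0" "0 < V c" "\<And>x. c < x \<Longrightarrow> u x < 0"
    using crossing[OF assms(2) less_imp_le[OF assms(1)]] by blast
  have "c \<noteq> r" using c assms by auto
  have "0 < V r"
  proof -
    have "r ^ (N - 1) * V r = c ^ (N - 1) * V c"
      using c \<open>c \<noteq> r\<close> less_imp_le[OF c(5)] by (intro V_const_weight) auto
    then have "0 < r ^ (N - 1) * V r" using c by simp
    then show ?thesis using c by (simp add: zero_less_mult_iff)
  qed
  then have "0 < E r" using assms by (simp add: E_def primitive_0)
  moreover have "0 < r" using c by simp
  ultimately show ?thesis using assms(1) by (intro that[of r])
qed

lemma ground_profile:
  assumes E: "\<And>r. 0 \<le> r \<Longrightarrow> 0 \<le> E r" and u: "\<And>r. 0 \<le> r \<Longrightarrow> 0 \<le> u r"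
  shows "\<And>r. 0 \<le> r \<Longrightarrow> 0 < u r" "(u \<longlongrightarrow> 0) at_top"
proof -
  show "(u \<longlongrightarrow> 0) at_top" using decreasing_to_zero assms by blast
  fix r :: real assume r: "0 \<le> r"
  show "0 < u r"
  proof (rule ccontr)
    assume "\<not> 0 < u r"
    then have "u r \<le> 0" by simp
    then obtain c where c: "0 < c" "c \<le> r" "u c = 0" "0 < V c" "\<And>x. c < x \<Longrightarrow> u x < 0"
      using crossing[OF r] by blast
    have "u (r + 1) < 0" using c by (intro c(5)) simp
    then show False using u[of "r + 1"] r by simp
  qed
qed

end

section \<open>Absence of tangential zeros and the classical initial value problem\<close>

text \<open>The energy decreases and is at least the primitive at \<open>u\<close>, which tends to 0.\<close>

lemma (in shot) tends_to_zero_imp_energy_nonneg: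
  assumes "(u \<longlongrightarrow> 0) at_top" "0 \<le> r" shows "0 \<le> E r"
proof (rule ccontr)
  assume "\<not> 0 \<le> E r"
  then have neg: "E r < 0" by simp
  have "isCont (primitive g) 0" using primitive_deriv DERIV_isCont by blast
  then have "((\<lambda>r. primitive g (u r)) \<longlongrightarrow> 0) at_top"
    using isCont_tendsto_compose[OF _ assms(1), of "primitive g"] by (simp add: primitive_0)
  then have "\<forall>\<^sub>F t in at_top. E r < primitive g (u t)"
    using neg by (rule order_tendstoD)
  then obtain R where R: "\<And>t. t \<ge> R \<Longrightarrow> E r < primitive g (u t)"
    by (auto simp: eventually_at_top_linorder)
  have "E (max R r) \<le> E r" using assms by (intro E_antimono) auto
  moreover have "primitive g (u (max R r)) \<le> E (max R r)" by (simp add: E_def)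
  ultimately show False using R[of "max R r"] by simp
qed

text \<open>Let \<open>F\<close> be the common primitive near 0 and \<open>J\<close> an antiderivative of
  \<open>- 1 / sqrt (- 2 * F)\<close>. If \<open>u\<close> had a tangential zero at
  \<open>r0\<close>, integrating \<open>(r ^ (N - 1) * u')\<^sup>2\<close> back from
  \<open>r0\<close> would bound the speed by a multiple of \<open>sqrt (- 2 * F u)\<close>, so
  \<open>J\<close> would stay bounded along \<open>u\<close> as \<open>u\<close> tends to 0.
  The ground state \<open>U\<close> has energy at least 0, hence speed at least \<open>sqrt (-
  2 * F U)\<close>, so \<open>J\<close> grows at least like \<open>r\<close> along
  \<open>U\<close> and is unbounded at 0.\<close>

lemma no_touch_transfer:
  assumes "shot N gU bU aU U" and Upos: "\<And>r. 0 \<le> r \<Longrightarrow> 0 < U r" and U0: "(U \<longlongrightarrow> 0) at_top"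
    and "shot N g b a u"
    and s1: "0 < s1" "\<And>s. 0 \<le> s \<Longrightarrow> s \<le> s1 \<Longrightarrow> g s = gU s"
    and r0: "0 < r0" and pos: "\<And>r. 0 \<le> r \<Longrightarrow> r < r0 \<Longrightarrow> 0 < u r" and ur0: "u r0 = 0"
  shows "flux N (\<lambda>t. g (u t)) r0 \<noteq> 0"
proof
  assume V0: "flux N (\<lambda>t. g (u t)) r0 = 0"
  interpret S: shot N g b a u by fact
  interpret T: shot N gU bU aU U by fact
  interpret T: transversal_shot N gU bU aU U
  proof
    show "0 < aU" using Upos[of 0] T.u_0 by simp
  qed (use Upos in \<open>force dest: less_imp_le\<close>)
  have TE: "0 \<le> T.E r" if "0 \<le> r" for r using T.tends_to_zero_imp_energy_nonneg[OF U0 that] .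
  have TV: "0 < T.V r" if "0 < r" for r using T.V_pos[of r r] TE that by simp
  obtain e0 where e0: "0 < e0" "\<And>s. 0 < s \<Longrightarrow> s < e0 \<Longrightarrow> g s < 0" using S.g_neg by auto
  define e where "e = min (min e0 s1) (min b bU) / 2"
  have e: "0 < e" "e < e0" "e < s1" "e < b" "e < bU"
    using e0 s1 S.b T.b by (auto simp: e_def min_def)
  define F where "F = primitive g"
  have Feq: "F s = primitive gU s" if "s \<le> e" for s
    unfolding F_def primitive_def using that e s1 by (intro integral_cong) auto
  have Fneg: "F s < 0" if "0 < s" "s \<le> e" for s
    unfolding F_def using that e by (intro S.primitive_neg) auto
  define \<phi> where "\<phi> = (\<lambda>s. 1 / sqrt (- 2 * F s))"
  define J where "J = (\<lambda>s. integral {s..e} \<phi>)"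
  have \<phi>pos: "0 < \<phi> s" if "0 < s" "s \<le> e" for s using Fneg[OF that] by (simp add: \<phi>_def)
  have J: "(J has_real_derivative - \<phi> s) (at s)" if s: "0 < s" "s < e" for s
  proof -
    have "F x < 0" if "x \<in> {s / 2..e}" for x
      using that s by (intro Fneg) auto
    then have "\<forall>x\<in>{s / 2..e}. sqrt (- 2 * F x) \<noteq> 0"
      by (force simp: less_le)
    then have "continuous_on {s / 2..e} \<phi>"
      unfolding \<phi>_def F_def
      by (intro continuous_intros S.primitive_cont)
    then have "(J has_real_derivative - \<phi> s) (at s within {s / 2..e})"
      unfolding J_def using s by (intro integral_has_real_derivative') auto
    then show ?thesis using s by (simp add: at_within_Icc_at)
  qed
  have Jmono: "J t \<le> J s" if "0 < s" "s \<le> t" "t < e" for s t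
  proof (rule decreasing_of_deriv[OF that(2)])
    show "continuous_on {s..t} J"
      using that by (intro continuous_at_imp_continuous_on ballI DERIV_isCont[OF J]) auto
    fix x assume "s < x" "x < t"
    then show "\<exists>d. (J has_real_derivative d) (at x) \<and> d \<le> 0"
      using J[of x] \<phi>pos[of x] that by (intro exI[of _ "- \<phi> x"]) auto
  qed
  \<comment> \<open>near \<open>r0\<close> the speed of \<open>u\<close> is at most a multiple of \<open>sqrt (- 2 * F u)\<close>\<close>
  have "isCont u r0" using S.u_deriv[OF r0] DERIV_isCont by blast
  then obtain d where d: "d > 0" "\<And>x. dist x r0 < d \<Longrightarrow> dist (u x) (u r0) < e"
    unfolding continuous_at_eps_delta using e by blast
  define r1 where "r1 = r0 - min d r0 / 2"
  have r1: "0 < r1" "r1 < r0" using d r0 by (auto simp: r1_def)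
  have ue: "u x < e" "0 < u x" if "r1 \<le> x" "x < r0" for x
    using d(2)[of x] that d(1) r0 ur0 r1 pos[of x] by (auto simp: r1_def dist_real_def)
  have ug: "g (u x) < 0" if "r1 \<le> x" "x < r0" for x
    using ue[OF that] e e0 by simp
  have SV: "0 < S.V x" if x: "r1 \<le> x" "x < r0" for x
  proof -
    have "r0 ^ (N - 1) * S.V r0 < x ^ (N - 1) * S.V x"
    proof (rule strict_decreasing_of_deriv[of x r0 "\<lambda>x. x ^ (N - 1) * S.V x"])
      show "continuous_on {x..r0} (\<lambda>x. x ^ (N - 1) * S.V x)"
        using x r1 by (intro continuous_intros continuous_on_subset[OF S.V_cont]) auto
      fix t assume "x < t" "t < r0"
      then show "\<exists>d. ((\<lambda>x. x ^ (N - 1) * S.V x) has_real_derivative d) (at t) \<and> d < 0"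
        using S.W_deriv[of t] ug[of t] x r1
        by (intro exI[of _ "t ^ (N - 1) * g (u t)"] conjI) (auto simp: mult_pos_neg)
    qed (use x in auto)
    then have "0 < x ^ (N - 1) * S.V x" using V0 by simp
    then show ?thesis using x r1 by (simp add: zero_less_mult_iff)
  qed
  \<comment> \<open>the loss from comparing the weights \<open>r ^ (N - 1)\<close> at the two ends of \<open>{r1..r0}\<close>\<close>
  define c where "c = (r0 / r1) ^ (N - 1)"
  have c0: "0 < c" using r0 r1 by (simp add: c_def)
  define w where "w = (\<lambda>x. x ^ (N - 1) * S.V x)"
  have w: "(w has_real_derivative t ^ (N - 1) * g (u t)) (at t)" if "0 < t" for t
    unfolding w_def by (rule S.W_deriv[OF that])
  have bound: "S.V x \<le> c * sqrt (- 2 * F (u x))" if x: "r1 \<le> x" "x < r0" for x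
  proof -
    let ?\<Phi> = "\<lambda>x. - ((x ^ (N - 1) * S.V x)\<^sup>2 / 2 + (r0 ^ (N - 1))\<^sup>2 * F (u x))"
    have "?\<Phi> r0 \<le> ?\<Phi> x"
    proof (rule decreasing_of_deriv[of x r0 ?\<Phi>])
      show "continuous_on {x..r0} ?\<Phi>"
        unfolding F_def using x r1
        by (intro continuous_intros continuous_on_subset[OF S.V_cont]
            continuous_on_compose2[OF S.primitive_cont continuous_on_subset[OF S.u_cont]]) auto
      fix t assume t: "x < t" "t < r0"
      let ?d = "- ((t ^ (N - 1) * S.V t) * (t ^ (N - 1) * g (u t)) + (r0 ^ (N - 1))\<^sup>2 * (g (u t) * (- S.V t)))"
      have t0: "0 < t" using t x r1 by simp
      have "((\<lambda>x. F (u x)) has_real_derivative g (u t) * (- S.V t)) (at t)"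
        unfolding F_def by (rule DERIV_chain2[OF S.primitive_deriv S.u_deriv[OF t0]])
      then have "((\<lambda>x. - ((w x)\<^sup>2 / 2 + (r0 ^ (N - 1))\<^sup>2 * F (u x))) has_real_derivative
          - (w t * (t ^ (N - 1) * g (u t)) + (r0 ^ (N - 1))\<^sup>2 * (g (u t) * (- S.V t)))) (at t)"
        by (auto intro!: derivative_eq_intros w[OF t0])
      then have "(?\<Phi> has_real_derivative ?d) (at t)"
        by (simp only: w_def)
      moreover have "?d = (g (u t) * S.V t) * ((r0 ^ (N - 1))\<^sup>2 - (t ^ (N - 1))\<^sup>2)"
        by (simp add: algebra_simps power2_eq_square)
      moreover have "g (u t) * S.V t \<le> 0" using ug[of t] SV[of t] t x by (simp add: mult_nonpos_nonneg)
      moreover have "(t ^ (N - 1))\<^sup>2 \<le> (r0 ^ (N - 1))\<^sup>2" using t t0 by (intro power_mono) auto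
      ultimately show "\<exists>d. (?\<Phi> has_real_derivative d) (at t) \<and> d \<le> 0"
        by (intro exI[of _ ?d]) (auto simp: mult_nonpos_nonneg)
    qed (use x in auto)
    then have "(x ^ (N - 1) * S.V x)\<^sup>2 \<le> (r0 ^ (N - 1))\<^sup>2 * (- 2 * F (u x))"
      using V0 ur0 by (simp add: F_def S.primitive_0)
    then have "sqrt ((x ^ (N - 1) * S.V x)\<^sup>2) \<le> sqrt ((r0 ^ (N - 1))\<^sup>2 * (- 2 * F (u x)))"
      by (rule real_sqrt_le_mono)
    moreover have "0 \<le> x ^ (N - 1) * S.V x" using SV[OF x] x r1 by auto
    ultimately have "x ^ (N - 1) * S.V x \<le> r0 ^ (N - 1) * sqrt (- 2 * F (u x))"
      using r0 unfolding real_sqrt_mult by simp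
    moreover have "r1 ^ (N - 1) * S.V x \<le> x ^ (N - 1) * S.V x"
      using SV[OF x] x r1 by (intro mult_right_mono power_mono) auto
    ultimately have "r1 ^ (N - 1) * S.V x \<le> r0 ^ (N - 1) * sqrt (- 2 * F (u x))" by simp
    then show ?thesis using r1 by (simp add: c_def power_divide field_simps)
  qed
  have upper: "J (u x) \<le> J (u r1) + c * (r0 - r1)" if x: "r1 \<le> x" "x < r0" for x
  proof -
    have Ju: "((\<lambda>x. J (u x)) has_real_derivative - \<phi> (u t) * (- S.V t)) (at t)" if "r1 \<le> t" "t \<le> x" for t
      using ue[of t] that x r1 by (intro DERIV_chain2[OF J S.u_deriv]) auto
    have "(\<lambda>x. J (u x) - c * x) x \<le> (\<lambda>x. J (u x) - c * x) r1"
    proof (rule decreasing_of_deriv[of r1 x "\<lambda>x. J (u x) - c * x"])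
      show "continuous_on {r1..x} (\<lambda>x. J (u x) - c * x)"
        by (intro continuous_intros continuous_at_imp_continuous_on ballI DERIV_isCont[OF Ju]) auto
      fix t assume t: "r1 < t" "t < x"
      have "\<phi> (u t) * S.V t \<le> \<phi> (u t) * (c * sqrt (- 2 * F (u t)))"
        using \<phi>pos[of "u t"] ue[of t] t x bound[of t] by (intro mult_left_mono) auto
      also have "\<dots> = c" using Fneg[of "u t"] ue[of t] t x by (simp add: \<phi>_def)
      finally show "\<exists>d. ((\<lambda>x. J (u x) - c * x) has_real_derivative d) (at t) \<and> d \<le> 0"
        using t by (intro exI[of _ "\<phi> (u t) * S.V t - c"]) (auto intro!: derivative_eq_intros Ju)
    qed (use x in auto)
    moreover have "c * x \<le> c * r0" using x c0 by simp
    ultimately show ?thesis by (simp add: algebra_simps)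
  qed
  \<comment> \<open>along \<open>U\<close> the same antiderivative grows without bound\<close>
  have "\<forall>\<^sub>F r in at_top. U r < e" using U0 e order_tendstoD(2) by blast
  then obtain R0 where R0: "\<And>r. r \<ge> R0 \<Longrightarrow> U r < e" by (auto simp: eventually_at_top_linorder)
  define R where "R = max R0 1"
  have RU: "0 < U r" "U r < e" if "R \<le> r" for r using R0 Upos that by (auto simp: R_def)
  have lower: "J (U R) + (r - R) \<le> J (U r)" if r: "R \<le> r" for r
  proof -
    have JU: "((\<lambda>x. J (U x)) has_real_derivative - \<phi> (U t) * (- T.V t)) (at t)" if "R \<le> t" for t
      using RU[of t] that by (intro DERIV_chain2[OF J T.u_deriv]) (auto simp: R_def)
    have "(\<lambda>x. x - J (U x)) r \<le> (\<lambda>x. x - J (U x)) R"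
    proof (rule decreasing_of_deriv[OF r, of "\<lambda>x. x - J (U x)"])
      show "continuous_on {R..r} (\<lambda>x. x - J (U x))"
        by (intro continuous_intros continuous_at_imp_continuous_on ballI DERIV_isCont[OF JU]) auto
      fix t assume t: "R < t" "t < r"
      have Ft: "F (U t) < 0" using Fneg RU[of t] t by simp
      have "sqrt (- 2 * F (U t)) \<le> T.V t"
      proof (rule real_le_lsqrt)
        show "- 2 * F (U t) \<le> (T.V t)\<^sup>2"
          using TE[of t] t Feq[of "U t"] RU[of t] by (simp add: T.E_def R_def)
      qed (use TV[of t] t Ft in \<open>auto simp: R_def\<close>)
      then have "1 \<le> \<phi> (U t) * T.V t" using Ft by (simp add: \<phi>_def)
      then show "\<exists>d. ((\<lambda>x. x - J (U x)) has_real_derivative d) (at t) \<and> d \<le> 0"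
        using t by (intro exI[of _ "1 - \<phi> (U t) * T.V t"]) (auto intro!: derivative_eq_intros JU)
    qed
    then show ?thesis by simp
  qed
  define r where "r = R + \<bar>J (u r1) + c * (r0 - r1) - J (U R)\<bar> + 1"
  have big: "J (u r1) + c * (r0 - r1) < J (U r)"
    using lower[of r] by (simp add: r_def)
  obtain x where x: "r1 \<le> x" "x < r0" "u x \<le> U r"
  proof -
    obtain d where d: "d > 0" "\<And>x. dist x r0 < d \<Longrightarrow> dist (u x) (u r0) < U r"
      using \<open>isCont u r0\<close> Upos[of r] unfolding continuous_at_eps_delta by (metis R_def add_nonneg_nonneg abs_ge_zero max.cobounded2 order_trans r_def zero_le_one)
    define x where "x = max r1 (r0 - d / 2)"
    have x: "r1 \<le> x" "x < r0" "r0 - d / 2 \<le> x" using d r1 by (auto simp: x_def)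
    then have "dist x r0 < d" using d(1) by (simp add: dist_real_def)
    then have "\<bar>u x\<bar> < U r" using d(2)[of x] ur0 by (simp add: dist_real_def)
    then show ?thesis using that[of x] x by simp
  qed
  have "J (U r) \<le> J (u x)"
    using x ue[of x] RU[of r] by (intro Jmono) (auto simp: r_def)
  then show False using upper[of x] x big by simp
qed

text \<open>The initial value problem says nothing about the continuity of \<open>u'\<close> at the
  centre, so integration leaves a term \<open>C / r ^ (N - 1)\<close> in \<open>u'\<close>. By
  the mean value theorem \<open>C \<noteq> 0\<close> would keep the difference quotient at 0
  away from its limit.\<close>

lemma radial_ivp_imp_radial_sol:
  assumes N: "N > 2" and ivp: "radial_ivp_solution N f \<alpha> u" and pos: "\<And>r. 0 < r \<Longrightarrow> 0 < u r"
    and f: "continuous_on {0..} f"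
  shows "radial_sol N (\<lambda>s. f (max s 0)) \<alpha> u"
proof -
  from ivp obtain u' u'' where u0: "u 0 = \<alpha>"
    and u': "\<And>r. 0 \<le> r \<Longrightarrow> (u has_real_derivative u' r) (at r within {0..})" and u'0: "u' 0 = 0"
    and u'': "\<And>r. 0 < r \<Longrightarrow> (u' has_real_derivative u'' r) (at r)"
    and eq: "\<And>r. 0 < r \<Longrightarrow> u'' r + (real N - 1) / r * u' r + f (u r) = 0"
    unfolding radial_ivp_solution_def by blast
  have u_cont: "continuous_on {0..} u" by (rule DERIV_continuous_on[OF u']) auto
  define h where "h = (\<lambda>t. f (max (u t) 0))"
  have h: "continuous_on {0..} h"
    unfolding h_def by (intro continuous_on_compose2[OF f] continuous_intros u_cont) auto
  let ?V = "flux N h"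
  have u'_at: "(u has_real_derivative u' r) (at r)" if "0 < r" for r
    using DERIV_subset[OF u'[of r], of "{0<..}"] that by (simp add: at_within_open[of r "{0<..}"] subset_iff)
  define J where "J = (\<lambda>r. r ^ (N - 1) * u' r + r ^ (N - 1) * ?V r)"
  have "(J has_real_derivative 0) (at r within {0<..})" if r: "r \<in> {0<..}" for r
  proof -
    have r0: "0 < r" using r by simp
    obtain m where m: "N = Suc (Suc m)" using N by (metis Suc_lessD less_natE add_2_eq_Suc add.commute plus_1_eq_Suc add_Suc)
    have "(J has_real_derivative (real (N - 1) * r ^ (N - 1 - 1) * u' r + r ^ (N - 1) * u'' r) + r ^ (N - 1) * h r) (at r)"
      unfolding J_def
      by (rule DERIV_add[OF _ power_weighted_flux_deriv[OF r0 h]])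
         (use r0 in \<open>auto intro!: derivative_eq_intros u''\<close>)
    moreover have "(real (N - 1) * r ^ (N - 1 - 1) * u' r + r ^ (N - 1) * u'' r) + r ^ (N - 1) * h r
       = r ^ (N - 1) * (u'' r + (real N - 1) / r * u' r + f (u r))"
      using r0 pos[OF r0] unfolding m h_def by (simp add: field_simps)
    ultimately show ?thesis using eq[OF r0] by (simp add: has_field_derivative_at_within)
  qed
  then obtain C where C: "\<And>r. 0 < r \<Longrightarrow> J r = C"
    using has_field_derivative_zero_constant[of "{0<..}" J] by (metis convex_real_interval(3) greaterThan_iff)
  define y where "y = (\<lambda>r. u r - potential N \<alpha> h r)"
  have y_cont: "continuous_on {0..} y"
    unfolding y_def by (intro continuous_intros u_cont potential_continuous h)
  have y0: "y 0 = 0" by (simp add: y_def u0)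
  have y': "(y has_real_derivative C / r ^ (N - 1)) (at r)" if "0 < r" for r
  proof -
    have "(y has_real_derivative u' r - (- ?V r)) (at r)"
      unfolding y_def by (rule DERIV_diff[OF u'_at potential_deriv_at[OF _ h]]) (use that in auto)
    moreover have "u' r + ?V r = C / r ^ (N - 1)"
      using C[OF that] that by (simp add: J_def field_simps)
    ultimately show ?thesis by simp
  qed
  have "(y has_real_derivative u' 0 - (- ?V 0)) (at 0 within {0..})"
    unfolding y_def by (rule DERIV_diff[OF u' potential_deriv[OF _ h]]) auto
  then have lim: "((\<lambda>r. y r / r) \<longlongrightarrow> 0) (at 0 within {0..})"
    by (simp add: has_field_derivative_iff y0 u'0)
  have "\<bar>C\<bar> \<le> \<bar>y r / r\<bar>" if r: "0 < r" "r \<le> 1" for r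
  proof -
    have "\<exists>l z. 0 < z \<and> z < r \<and> (y has_real_derivative l) (at z) \<and> y r - y 0 = (r - 0) * l"
      using r y' by (intro MVT continuous_on_subset[OF y_cont]) (auto simp: real_differentiable_def)
    then obtain \<xi> l where \<xi>: "0 < \<xi>" "\<xi> < r" and l: "(y has_real_derivative l) (at \<xi>)" "y r - y 0 = (r - 0) * l"
      by blast
    have \<xi>l: "y r - y 0 = (r - 0) * (C / \<xi> ^ (N - 1))"
      using l DERIV_unique[OF l(1) y'[OF \<xi>(1)]] by simp
    have "\<xi> ^ (N - 1) \<le> 1" using \<xi> r by (intro power_le_one) auto
    then have "\<bar>C\<bar> \<le> \<bar>C\<bar> / \<xi> ^ (N - 1)" using \<xi> mult_left_le[of "\<xi> ^ (N - 1)" "\<bar>C\<bar>"] by (simp add: pos_le_divide_eq)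
    also have "\<dots> = \<bar>y r / r\<bar>" using \<xi> \<xi>l r y0 by (simp add: abs_mult abs_divide)
    finally show ?thesis .
  qed
  note le = this
  have C0: "C = 0"
  proof (rule ccontr)
    assume "C \<noteq> 0"
    then have "\<forall>\<^sub>F r in at 0 within {0..}. dist (y r / r) 0 < \<bar>C\<bar>"
      by (intro tendstoD[OF lim]) simp
    then obtain d where d: "d > 0" "\<And>r. r \<in> {0..} \<Longrightarrow> r \<noteq> 0 \<Longrightarrow> dist r 0 < d \<Longrightarrow> dist (y r / r) 0 < \<bar>C\<bar>"
      unfolding eventually_at by blast
    define r where "r = min (d / 2) 1"
    have r: "0 < r" "r \<le> 1" "r < d" using d(1) by (auto simp: r_def min_def)
    then have "dist (y r / r) 0 < \<bar>C\<bar>" by (intro d) auto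
    then show False using le[of r] r by simp
  qed
  have "y r = 0" if r: "0 \<le> r" for r
  proof (cases "r = 0")
    case False
    have "y r = y 0"
      by (rule DERIV_isconst_end) (use False r y' C0 in \<open>auto intro: continuous_on_subset[OF y_cont]\<close>)
    then show ?thesis by (simp add: y0)
  qed (simp add: y0)
  then show ?thesis using u_cont by (simp add: radial_sol_def y_def h_def)
qed

section \<open>Comparison of two solutions at equal heights\<close>

lemma last_nonpos:
  fixes f :: "real \<Rightarrow> real"
  assumes f: "continuous_on {l..m} f" and l: "f l \<le> 0" and m: "0 < f m" and lm: "l \<le> m"
  obtains c where "l \<le> c" "c < m" "f c = 0" "\<And>x. c < x \<Longrightarrow> x \<le> m \<Longrightarrow> 0 < f x"
proof -
  obtain c where c: "- m < c" "c \<le> - l" "f (- c) = 0" "\<And>x. - m \<le> x \<Longrightarrow> x < c \<Longrightarrow> 0 < f (- x)"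
    by (rule first_nonpos[of "- m" "- l" "\<lambda>x. f (- x)"])
       (use assms in \<open>auto intro!: continuous_on_compose2[OF f] continuous_intros\<close>)
  have "0 < f x" if "- c < x" "x \<le> m" for x using c(4)[of "- x"] that by simp
  then show ?thesis using c by (intro that[of "- c"]) auto
qed

text \<open>A decreasing solution described by its radius \<open>\<rho>\<close> and speed \<open>p = -
  u'\<close> at height \<open>s\<close>. Two solutions with different starting heights can
  then be compared at the same value of \<open>g\<close>.\<close>

definition hodograph :: "nat \<Rightarrow> (real \<Rightarrow> real) \<Rightarrow> real \<Rightarrow> (real \<Rightarrow> real) \<Rightarrow> (real \<Rightarrow> real) \<Rightarrow> bool" where
  "hodograph N g a \<rho> p \<longleftrightarrow>
     (\<forall>s. 0 < s \<and> s < a \<longrightarrow> 0 < \<rho> s \<and> 0 < p s \<and>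
        (\<rho> has_real_derivative - (1 / p s)) (at s) \<and>
        (p has_real_derivative (real N - 1) / \<rho> s - g s / p s) (at s)) \<and>
     (\<rho> \<longlongrightarrow> 0) (at_left a) \<and> (p \<longlongrightarrow> 0) (at_left a)"

lemma hodographD:
  assumes "hodograph N g a \<rho> p" "0 < s" "s < a"
  shows "0 < \<rho> s" "0 < p s" "(\<rho> has_real_derivative - (1 / p s)) (at s)"
    "(p has_real_derivative (real N - 1) / \<rho> s - g s / p s) (at s)"
  using assms unfolding hodograph_def by blast+

lemma (in transversal_shot) hodograph_exists:
  assumes E: "\<And>r. 0 \<le> r \<Longrightarrow> 0 \<le> E r"
  obtains \<rho> p where "hodograph N g a \<rho> p" "\<And>r. 0 < r \<Longrightarrow> \<rho> (u r) = r"
    "\<And>s. 0 < s \<Longrightarrow> s < a \<Longrightarrow> u (\<rho> s) = s \<and> 0 < (p s)\<^sup>2 + 2 * primitive g s"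
proof -
  have Vp: "0 < V r" if "0 < r" for r using V_pos[of r r] E that by simp
  have dec: "u y < u x" if "0 \<le> x" "x < y" for x y
    by (rule u_strict_antimono) (use that Vp in auto)
  define \<rho> where "\<rho> = (\<lambda>s. SOME r. 0 < r \<and> u r = s)"
  have \<rho>u: "\<rho> (u r) = r" if "0 < r" for r
    unfolding \<rho>_def
  proof (rule some_equality)
    fix x assume "0 < x \<and> u x = u r"
    then show "x = r" using dec[of x r] dec[of r x] that by (cases x r rule: linorder_cases) auto
  qed (use that in auto)
  have \<rho>s: "0 < \<rho> s \<and> u (\<rho> s) = s" if s: "0 < s" "s < a" for s
  proof -
    obtain r where r: "0 \<le> r" "u r = s"
      using attains_all_heights[OF E, of s] s by auto
    moreover have "r \<noteq> 0" using r s u_0 by auto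
    ultimately show ?thesis using \<rho>u[of r] by auto
  qed
  define p where "p = (\<lambda>s. V (\<rho> s))"
  have cont: "isCont \<rho> s" if s: "0 < s" "s < a" for s
  proof -
    have "isCont \<rho> (u (\<rho> s))"
    proof (rule isCont_inverse_function2[of "\<rho> s / 2" "\<rho> s" "\<rho> s + 1" \<rho> u])
      fix z assume "\<rho> s / 2 \<le> z" "z \<le> \<rho> s + 1"
      then have z: "0 < z" using \<rho>s[OF s] by auto
      show "\<rho> (u z) = z" "isCont u z" using \<rho>u[OF z] u_deriv[OF z] DERIV_isCont by auto
    qed (use \<rho>s[OF s] in auto)
    then show ?thesis using \<rho>s[OF s] by simp
  qed
  have d\<rho>: "(\<rho> has_real_derivative - (1 / p s)) (at s)" if s: "0 < s" "s < a" for s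
  proof -
    have "(\<rho> has_real_derivative inverse (- V (\<rho> s))) (at s)"
    proof (rule DERIV_inverse_function[of u])
      show "(u has_real_derivative - V (\<rho> s)) (at (\<rho> s))" using \<rho>s[OF s] by (intro u_deriv) auto
      show "- V (\<rho> s) \<noteq> 0" using Vp[of "\<rho> s"] \<rho>s[OF s] by simp
      show "0 < s" "s < a" "isCont \<rho> s" using s cont by auto
    qed (use \<rho>s in auto)
    then show ?thesis by (simp add: p_def inverse_eq_divide)
  qed
  have dp: "(p has_real_derivative (real N - 1) / \<rho> s - g s / p s) (at s)" if s: "0 < s" "s < a" for s
  proof -
    have "(p has_real_derivative (g (u (\<rho> s)) - (real N - 1) / \<rho> s * V (\<rho> s)) * - (1 / p s)) (at s)"
      unfolding p_def
      by (rule DERIV_chain2[OF V_deriv d\<rho>[unfolded p_def]]) (use \<rho>s[OF s] s in auto)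
    moreover have "(g (u (\<rho> s)) - (real N - 1) / \<rho> s * V (\<rho> s)) * - (1 / p s) = (real N - 1) / \<rho> s - g s / p s"
      using Vp[of "\<rho> s"] \<rho>s[OF s] by (simp add: p_def field_simps)
    ultimately show ?thesis by simp
  qed
  have lim\<rho>: "(\<rho> \<longlongrightarrow> 0) (at_left a)"
  proof (rule tendstoI)
    fix e :: real assume e: "0 < e"
    have "u e < a" using dec[of 0 e] e u_0 by simp
    have "dist (\<rho> s) 0 < e" if s: "max 0 (u e) < s" "s < a" for s
    proof -
      have "\<rho> s < e"
      proof (rule ccontr)
        assume "\<not> \<rho> s < e"
        then have "u (\<rho> s) \<le> u e" using dec[of e "\<rho> s"] e by (cases "e = \<rho> s") auto
        then show False using \<rho>s[of s] s by auto
      qed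
      then show ?thesis using \<rho>s[of s] s by auto
    qed
    moreover have "\<forall>\<^sub>F s in at_left a. s \<in> {max 0 (u e)<..<a}"
      using \<open>u e < a\<close> a by (intro eventually_at_leftI[of "max 0 (u e)"]) auto
    ultimately show "\<forall>\<^sub>F s in at_left a. dist (\<rho> s) 0 < e"
      by (auto elim!: eventually_mono)
  qed
  have "\<forall>\<^sub>F s in at_left a. \<rho> s \<in> {0..}"
    using a \<rho>s by (intro eventually_at_leftI[of 0]) (auto simp: less_imp_le)
  from continuous_on_tendsto_compose[OF V_cont lim\<rho> _ this]
  have limp: "(p \<longlongrightarrow> 0) (at_left a)" by (simp add: p_def)
  have en: "0 < (p s)\<^sup>2 + 2 * primitive g s" if s: "0 < s" "s < a" for s
  proof -
    have "E (\<rho> s + 1) < E (\<rho> s)"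
      using \<rho>s[OF s] Vp by (intro E_strict_antimono) (auto simp: less_le)
    then have "0 < E (\<rho> s)" using E[of "\<rho> s + 1"] \<rho>s[OF s] by simp
    then show ?thesis using \<rho>s[OF s] by (simp add: E_def p_def)
  qed
  have "hodograph N g a \<rho> p"
    unfolding hodograph_def using \<rho>s Vp d\<rho> dp lim\<rho> limp by (auto simp: p_def)
  then show ?thesis using \<rho>u \<rho>s en by (intro that) auto
qed

text \<open>Two solutions starting at \<open>a1 < a2\<close>, with \<open>sI\<close> the height of the
  first intersection of their graphs. Positive energy is assumed at all heights, that is,
  neither solution falls back before reaching 0.\<close>

locale hodograph_pair =
  fixes N :: nat and g F :: "real \<Rightarrow> real" and a1 a2 b \<beta> sI :: real and \<rho>1 p1 \<rho>2 p2 :: "real \<Rightarrow> real"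
  assumes N: "N > 2"
    and h1: "hodograph N g a1 \<rho>1 p1" and h2: "hodograph N g a2 \<rho>2 p2"
    and ord: "0 < b" "b \<le> \<beta>" "\<beta> < a1" "a1 < a2"
    and e1: "\<And>s. 0 < s \<Longrightarrow> s < a1 \<Longrightarrow> 0 < (p1 s)\<^sup>2 + 2 * F s"
    and e2: "\<And>s. 0 < s \<Longrightarrow> s < a2 \<Longrightarrow> 0 < (p2 s)\<^sup>2 + 2 * F s"
    and F_deriv: "\<And>s. (F has_real_derivative g s) (at s)"
    and g_cont: "\<And>s. isCont g s"
    and F_nonpos: "\<And>s. 0 < s \<Longrightarrow> s \<le> \<beta> \<Longrightarrow> F s \<le> 0"
    and F_beta: "F \<beta> = 0"
    and g_pos: "\<And>s. \<beta> \<le> s \<Longrightarrow> s \<le> a2 \<Longrightarrow> 0 < g s"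
    and Q_deriv: "\<And>s. \<beta> < s \<Longrightarrow> s < a2 \<Longrightarrow>
      \<exists>q. ((\<lambda>t. F t / g t) has_real_derivative q) (at s) \<and> (real N - 2) / (2 * real N) < q"
    and sI: "b \<le> sI" "sI < a1" "\<rho>1 sI = \<rho>2 sI" "\<And>s. sI < s \<Longrightarrow> s < a1 \<Longrightarrow> \<rho>1 s < \<rho>2 s"
begin

lemma dom: "0 < s \<Longrightarrow> s < a1 \<Longrightarrow> s < a2" using ord by simp
lemma r1: "0 < s \<Longrightarrow> s < a1 \<Longrightarrow> 0 < \<rho>1 s" using hodographD[OF h1] by blast
lemma p1: "0 < s \<Longrightarrow> s < a1 \<Longrightarrow> 0 < p1 s" using hodographD[OF h1] by blast
lemma r2: "0 < s \<Longrightarrow> s < a2 \<Longrightarrow> 0 < \<rho>2 s" using hodographD[OF h2] by blast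
lemma p2: "0 < s \<Longrightarrow> s < a2 \<Longrightarrow> 0 < p2 s" using hodographD[OF h2] by blast
lemmas dr1 = hodographD(3)[OF h1] and dp1 = hodographD(4)[OF h1]
lemmas dr2 = hodographD(3)[OF h2] and dp2 = hodographD(4)[OF h2]

lemma sI_pos: "0 < sI" using sI ord by simp

text \<open>Squared speeds have the advantage that \<open>g\<close> cancels in the derivative of their
  difference.\<close>

definition D :: "real \<Rightarrow> real" where "D s = (p2 s)\<^sup>2 - (p1 s)\<^sup>2"

lemma D_pos_iff: "0 < s \<Longrightarrow> s < a1 \<Longrightarrow> 0 < D s \<longleftrightarrow> p1 s < p2 s"
  using p1[of s] p2[of s] dom[of s] by (auto simp: D_def intro: power_strict_mono power2_less_imp_less)

lemma D_zero_iff: "0 < s \<Longrightarrow> s < a1 \<Longrightarrow> D s = 0 \<longleftrightarrow> p1 s = p2 s"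
  using p1[of s] p2[of s] dom[of s] by (auto simp: D_def power2_eq_iff)

lemma D_deriv:
  assumes s: "0 < s" "s < a1"
  shows "(D has_real_derivative 2 * (real N - 1) * (p2 s / \<rho>2 s - p1 s / \<rho>1 s)) (at s)"
proof -
  note s2 = dom[OF s]
  have "(D has_real_derivative 2 * p2 s * ((real N - 1) / \<rho>2 s - g s / p2 s)
     - 2 * p1 s * ((real N - 1) / \<rho>1 s - g s / p1 s)) (at s)"
    unfolding D_def[abs_def]
    by (auto intro!: derivative_eq_intros dp1[OF s] dp2[OF s(1) s2] simp: algebra_simps)
  moreover have "2 * p2 s * ((real N - 1) / \<rho>2 s - g s / p2 s) - 2 * p1 s * ((real N - 1) / \<rho>1 s - g s / p1 s)
    = 2 * (real N - 1) * (p2 s / \<rho>2 s - p1 s / \<rho>1 s)"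
    using p1[OF s] p2[OF s(1) s2] r1[OF s] r2[OF s(1) s2] by (simp add: field_simps)
  ultimately show ?thesis by simp
qed

lemma D_cont: "0 < l \<Longrightarrow> m < a1 \<Longrightarrow> continuous_on {l..m} D"
  by (intro continuous_at_imp_continuous_on ballI DERIV_isCont[OF D_deriv]) auto

lemma D_pos_near_top: "\<forall>\<^sub>F s in at_left a1. 0 < D s"
proof -
  have a1: "0 < a1" using ord by simp
  have "isCont p2 a1" using dp2[OF a1 ord(4)] DERIV_isCont by blast
  then have "(p2 \<longlongrightarrow> p2 a1) (at_left a1)" by (simp add: isCont_def filterlim_at_split)
  moreover have "(p1 \<longlongrightarrow> 0) (at_left a1)" using h1 by (simp add: hodograph_def)
  ultimately have "((\<lambda>s. (p2 s)\<^sup>2 - (p1 s)\<^sup>2) \<longlongrightarrow> (p2 a1)\<^sup>2 - 0\<^sup>2) (at_left a1)"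
    by (intro tendsto_intros)
  moreover have "0 < (p2 a1)\<^sup>2 - 0\<^sup>2" using p2[OF a1 ord(4)] by simp
  ultimately show ?thesis unfolding D_def[abs_def] by (rule order_tendstoD)
qed

text \<open>Near the top of the lower solution its speed tends to 0 and that of the upper one does not. At
  a height where the speeds agree while \<open>\<rho>1 < \<rho>2\<close>, the lower solution
  suffers more friction, so \<open>D\<close> would be decreasing with the height there,
  contrary to \<open>D > 0\<close> just above.\<close>

lemma D_pos_above:
  assumes s: "sI < s" "s < a1" shows "0 < D s"
proof (rule ccontr)
  assume neg: "\<not> 0 < D s"
  have s0: "0 < s" using s sI_pos by simp
  have "\<forall>\<^sub>F x in at_left a1. 0 < D x \<and> x \<in> {s<..<a1}"
    using D_pos_near_top s by (intro eventually_conj) (auto intro: eventually_at_leftI)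
  then obtain m where m: "0 < D m" "s < m" "m < a1"
    by (metis (no_types, lifting) eventually_happens greaterThanLessThan_iff trivial_limit_at_left_real)
  obtain c where c: "s \<le> c" "c < m" "D c = 0" "\<And>x. c < x \<Longrightarrow> x \<le> m \<Longrightarrow> 0 < D x"
    using last_nonpos[of s m D] neg m s0 D_cont[of s m] by (metis less_imp_le not_less)
  have c0: "0 < c" "c < a1" "c < a2" using c m s0 ord by auto
  have "p1 c = p2 c" using c D_zero_iff[of c] c0 by simp
  moreover have "\<rho>1 c < \<rho>2 c" using sI(4)[of c] c s m by simp
  ultimately have "p2 c / \<rho>2 c - p1 c / \<rho>1 c < 0"
    using p2[of c] r1[of c] c0 by (simp add: divide_strict_left_mono)
  then have "2 * (real N - 1) * (p2 c / \<rho>2 c - p1 c / \<rho>1 c) < 0"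
    using N by (intro mult_pos_neg) auto
  then obtain d where d: "d > 0" "\<And>h. h > 0 \<Longrightarrow> h < d \<Longrightarrow> D (c + h) < D c"
    using DERIV_neg_dec_right[OF D_deriv[OF c0(1,2)]] by blast
  have "D (c + min (d / 2) (m - c)) < D c" using d(1) c by (intro d(2)) auto
  moreover have "0 < D (c + min (d / 2) (m - c))" using d(1) c by (intro c(4)) auto
  ultimately show False using c by simp
qed

text \<open>At the intersection itself strictness is preserved by a Gronwall estimate: above
  \<open>sI\<close> the derivative of \<open>D\<close> is at most a constant times
  \<open>D\<close>.\<close>

lemma D_pos_at: "0 < D sI"
proof (rule ccontr)
  assume neg: "\<not> 0 < D sI"
  define m where "m = (sI + a1) / 2"
  have m: "sI < m" "m < a1" using sI by (auto simp: m_def)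
  have cont: "continuous_on {sI..m} (\<lambda>s. \<rho>2 s * p2 s)"
    using sI_pos m ord
    by (intro continuous_intros continuous_at_imp_continuous_on ballI DERIV_isCont[OF dr2] DERIV_isCont[OF dp2]) auto
  obtain s0 where s0: "s0 \<in> {sI..m}" "\<And>s. s \<in> {sI..m} \<Longrightarrow> \<rho>2 s0 * p2 s0 \<le> \<rho>2 s * p2 s"
    using continuous_attains_inf[OF compact_Icc _ cont] m by auto
  define \<kappa> where "\<kappa> = \<rho>2 s0 * p2 s0"
  have \<kappa>: "0 < \<kappa>" unfolding \<kappa>_def using s0 sI_pos m ord by (intro mult_pos_pos r2 p2) auto
  define C where "C = 2 * (real N - 1) / \<kappa>"
  have "(\<lambda>s. D s * exp (- C * s)) m \<le> (\<lambda>s. D s * exp (- C * s)) sI"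
  proof (rule decreasing_of_deriv[of sI m "\<lambda>s. D s * exp (- C * s)"])
    show "continuous_on {sI..m} (\<lambda>s. D s * exp (- C * s))"
      using sI_pos m by (intro continuous_intros D_cont) auto
    fix s assume s: "sI < s" "s < m"
    have s': "0 < s" "s < a1" "s < a2" using s m sI_pos ord by auto
    note pos = p1[OF s'(1,2)] p2[OF s'(1,3)] r1[OF s'(1,2)] r2[OF s'(1,3)]
    have Dp: "0 < D s" using D_pos_above s m by simp
    then have pp: "p1 s < p2 s" using D_pos_iff s' by simp
    have "p2 s / \<rho>2 s - p1 s / \<rho>1 s \<le> p2 s / \<rho>2 s - p1 s / \<rho>2 s"
      using sI(4)[of s] s m pos by (simp add: divide_left_mono)
    also have "\<dots> = D s / (\<rho>2 s * (p1 s + p2 s))"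
    proof -
      have "D s = (p2 s - p1 s) * (p1 s + p2 s)" by (simp add: D_def power2_eq_square algebra_simps)
      moreover have "p1 s + p2 s \<noteq> 0" using pos by simp
      ultimately show ?thesis by (simp add: diff_divide_distrib)
    qed
    also have "\<dots> \<le> D s / \<kappa>"
    proof (rule divide_left_mono)
      have "\<kappa> \<le> \<rho>2 s * p2 s" using s0(2)[of s] s by (simp add: \<kappa>_def)
      also have "\<dots> \<le> \<rho>2 s * (p1 s + p2 s)" using pos by simp
      finally show "\<kappa> \<le> \<rho>2 s * (p1 s + p2 s)" .
    qed (use Dp \<kappa> pos in auto)
    finally have "2 * (real N - 1) * (p2 s / \<rho>2 s - p1 s / \<rho>1 s) \<le> 2 * (real N - 1) * (D s / \<kappa>)"
      using N by (intro mult_left_mono) auto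
    then have le: "2 * (real N - 1) * (p2 s / \<rho>2 s - p1 s / \<rho>1 s) - C * D s \<le> 0" by (simp add: C_def)
    let ?d = "(2 * (real N - 1) * (p2 s / \<rho>2 s - p1 s / \<rho>1 s) - C * D s) * exp (- C * s)"
    have "((\<lambda>s. D s * exp (- C * s)) has_real_derivative ?d) (at s)"
      by (rule derivative_eq_intros D_deriv[OF s'(1,2)] refl | simp add: algebra_simps)+
    then show "\<exists>d. ((\<lambda>s. D s * exp (- C * s)) has_real_derivative d) (at s) \<and> d \<le> 0"
      using le by (intro exI[of _ ?d] conjI mult_nonpos_nonneg) auto
  qed (use m in auto)
  moreover have "D sI * exp (- C * sI) \<le> 0" using neg by (intro mult_nonpos_nonneg) auto
  moreover have "0 < D m * exp (- C * m)" using D_pos_above[of m] m by simp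
  ultimately show False by simp
qed

lemma \<rho>_diff_deriv:
  assumes s: "0 < s" "s < a1"
  shows "((\<lambda>s. \<rho>1 s - \<rho>2 s) has_real_derivative 1 / p2 s - 1 / p1 s) (at s)"
  by (rule derivative_eq_intros dr1[OF s] dr2[OF s(1) dom[OF s]] refl | simp)+

lemma \<rho>_diff_cont: "0 < l \<Longrightarrow> m < a1 \<Longrightarrow> continuous_on {l..m} (\<lambda>s. \<rho>1 s - \<rho>2 s)"
  by (intro continuous_at_imp_continuous_on ballI DERIV_isCont[OF \<rho>_diff_deriv]) auto

text \<open>The quantity whose lead at height \<open>\<beta>\<close> or at the intersection, whichever is
  lower, is preserved down to height 0.\<close>

definition W1 where "W1 s = \<rho>1 s * sqrt ((p1 s)\<^sup>2 + 2 * F s)"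
definition W2 where "W2 s = \<rho>2 s * sqrt ((p2 s)\<^sup>2 + 2 * F s)"

lemma W_deriv_aux:
  assumes h: "hodograph N g a \<rho> p" and s: "0 < s" "s < a" and e: "0 < (p s)\<^sup>2 + 2 * F s"
  shows "((\<lambda>s. \<rho> s * sqrt ((p s)\<^sup>2 + 2 * F s)) has_real_derivative
     (real N - 1) / (sqrt ((p s)\<^sup>2 + 2 * F s) / p s) - sqrt ((p s)\<^sup>2 + 2 * F s) / p s) (at s)"
proof -
  note pos = hodographD(1,2)[OF h s] note d = hodographD(3,4)[OF h s]
  define q where "q = sqrt ((p s)\<^sup>2 + 2 * F s)"
  have q: "0 < q" using e by (simp add: q_def)
  have "((\<lambda>s. (p s)\<^sup>2 + 2 * F s) has_real_derivative 2 * p s * ((real N - 1) / \<rho> s - g s / p s) + 2 * g s) (at s)"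
    by (auto intro!: derivative_eq_intros d F_deriv simp: algebra_simps)
  moreover have "2 * p s * ((real N - 1) / \<rho> s - g s / p s) + 2 * g s = 2 * (real N - 1) * p s / \<rho> s"
    using pos by (simp add: field_simps)
  ultimately have "((\<lambda>s. (p s)\<^sup>2 + 2 * F s) has_real_derivative 2 * (real N - 1) * p s / \<rho> s) (at s)" by simp
  then have "((\<lambda>s. sqrt ((p s)\<^sup>2 + 2 * F s)) has_real_derivative
      inverse (sqrt ((p s)\<^sup>2 + 2 * F s)) / 2 * (2 * (real N - 1) * p s / \<rho> s)) (at s)"
    by (rule DERIV_chain2[where f = sqrt and g = "\<lambda>s. (p s)\<^sup>2 + 2 * F s", OF DERIV_real_sqrt[OF e]])
  from DERIV_mult[OF d(1) this]
  have "((\<lambda>s. \<rho> s * sqrt ((p s)\<^sup>2 + 2 * F s)) has_real_derivative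
     - (1 / p s) * q + inverse q / 2 * (2 * (real N - 1) * p s / \<rho> s) * \<rho> s) (at s)"
    unfolding q_def .
  moreover have "- (1 / p s) * q + inverse q / 2 * (2 * (real N - 1) * p s / \<rho> s) * \<rho> s = (real N - 1) / (q / p s) - q / p s"
    using pos q by (simp add: field_simps)
  ultimately show ?thesis unfolding q_def by (rule DERIV_cong)
qed

lemma W_diff_deriv:
  assumes s: "0 < s" "s < a1"
  shows "((\<lambda>s. W2 s - W1 s) has_real_derivative
     ((real N - 1) / (sqrt ((p2 s)\<^sup>2 + 2 * F s) / p2 s) - sqrt ((p2 s)\<^sup>2 + 2 * F s) / p2 s)
     - ((real N - 1) / (sqrt ((p1 s)\<^sup>2 + 2 * F s) / p1 s) - sqrt ((p1 s)\<^sup>2 + 2 * F s) / p1 s)) (at s)"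
  unfolding W1_def[abs_def] W2_def[abs_def]
  by (rule DERIV_diff[OF W_deriv_aux[OF h2 s(1) dom[OF s] e2[OF s(1) dom[OF s]]] W_deriv_aux[OF h1 s e1[OF s]]])

lemma W_diff_cont: "0 < l \<Longrightarrow> m < a1 \<Longrightarrow> continuous_on {l..m} (\<lambda>s. W2 s - W1 s)"
  by (intro continuous_at_imp_continuous_on ballI DERIV_isCont[OF W_diff_deriv]) auto

lemma p_less_if_W_less:
  assumes s: "0 < s" "s < a1" and "\<rho>2 s \<le> \<rho>1 s" "W1 s < W2 s" shows "p1 s < p2 s"
proof (rule ccontr)
  assume "\<not> p1 s < p2 s"
  then have "(p2 s)\<^sup>2 \<le> (p1 s)\<^sup>2" using p2[OF s(1) dom[OF s]] by (intro power_mono) auto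
  then have "W2 s \<le> W1 s"
    unfolding W1_def W2_def using assms(3) r2[OF s(1) dom[OF s]] e2[OF s(1) dom[OF s]]
    by (intro mult_mono real_sqrt_le_mono) auto
  then show False using assms by simp
qed

text \<open>With \<open>x = sqrt (p\<^sup>2 + 2 * F) / p\<close> the derivative of \<open>\<rho> * sqrt
  (p\<^sup>2 + 2 * F)\<close> with respect to the height is \<open>(N - 1) / x - x\<close>,
  which decreases in \<open>x\<close>, and \<open>x\<close> increases with \<open>p\<close>
  because \<open>F \<le> 0\<close>. So the slower solution loses more. As long as \<open>W1 <
  W2\<close>, the order \<open>\<rho>2 \<le> \<rho>1\<close> persists: where the radii agree,
  the lower solution is slower and its radius grows faster.\<close>

lemma W_gap_widens:
  assumes s0: "s0 \<le> \<beta>" "\<rho>2 s0 \<le> \<rho>1 s0" and c: "0 < c" "c \<le> s0"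
    and W: "\<And>s. c < s \<Longrightarrow> s \<le> s0 \<Longrightarrow> W1 s < W2 s"
  shows "W2 s0 - W1 s0 \<le> W2 c - W1 c"
proof (rule decreasing_of_deriv[of c s0 "\<lambda>s. W2 s - W1 s"])
  have lt: "s < a1" if "s \<le> s0" for s using that s0 ord by simp
  show "continuous_on {c..s0} (\<lambda>s. W2 s - W1 s)" using c lt by (intro W_diff_cont) auto
  fix s assume s: "c < s" "s < s0"
  have s': "0 < s" "s < a1" "s < a2" using s c lt[of s] ord by auto
  have \<rho>: "\<rho>2 s \<le> \<rho>1 s"
  proof (rule ccontr)
    assume neg: "\<not> \<rho>2 s \<le> \<rho>1 s"
    have "continuous_on {s..s0} (\<lambda>s. - (\<rho>1 s - \<rho>2 s))"
      using s' lt[of s0] by (intro continuous_intros \<rho>_diff_cont) auto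
    then obtain d where d: "s < d" "d \<le> s0" "- (\<rho>1 d - \<rho>2 d) = 0"
      "\<And>x. s \<le> x \<Longrightarrow> x < d \<Longrightarrow> 0 < - (\<rho>1 x - \<rho>2 x)"
      using first_nonpos[of s s0 "\<lambda>s. - (\<rho>1 s - \<rho>2 s)"] neg s0 s
      by (smt (verit))
    have d': "0 < d" "d < a1" using d s' lt[of d] by auto
    have "p1 d < p2 d" using d d' W[of d] s by (intro p_less_if_W_less) auto
    then have "1 / p2 d - 1 / p1 d < 0" using p1[OF d'] by (simp add: divide_strict_left_mono)
    then obtain e where e: "e > 0" "\<And>h. h > 0 \<Longrightarrow> h < e \<Longrightarrow> \<rho>1 d - \<rho>2 d < \<rho>1 (d - h) - \<rho>2 (d - h)"
      using DERIV_neg_dec_left[OF \<rho>_diff_deriv[OF d']] by blast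
    have "\<rho>1 d - \<rho>2 d < \<rho>1 (d - min (e / 2) (d - s)) - \<rho>2 (d - min (e / 2) (d - s))"
      using e(1) d by (intro e(2)) auto
    moreover have "0 < - (\<rho>1 (d - min (e / 2) (d - s)) - \<rho>2 (d - min (e / 2) (d - s)))"
      using e(1) d by (intro d(4)) auto
    ultimately show False using d by simp
  qed
  then have pp: "p1 s < p2 s" using s' W s by (intro p_less_if_W_less) auto
  note pos = p1[OF s'(1,2)] p2[OF s'(1,3)]
  have Fs: "F s \<le> 0" using F_nonpos s' s s0 by simp
  define x1 where "x1 = sqrt ((p1 s)\<^sup>2 + 2 * F s) / p1 s"
  define x2 where "x2 = sqrt ((p2 s)\<^sup>2 + 2 * F s) / p2 s"
  have x1: "x1 = sqrt (1 + 2 * F s / (p1 s)\<^sup>2)"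
  proof -
    have "x1 = sqrt ((p1 s)\<^sup>2 + 2 * F s) / sqrt ((p1 s)\<^sup>2)" using pos by (simp add: x1_def)
    also have "\<dots> = sqrt (((p1 s)\<^sup>2 + 2 * F s) / (p1 s)\<^sup>2)" by (simp only: real_sqrt_divide)
    finally show ?thesis using pos by (simp add: add_divide_distrib)
  qed
  have x2: "x2 = sqrt (1 + 2 * F s / (p2 s)\<^sup>2)"
  proof -
    have "x2 = sqrt ((p2 s)\<^sup>2 + 2 * F s) / sqrt ((p2 s)\<^sup>2)" using pos by (simp add: x2_def)
    also have "\<dots> = sqrt (((p2 s)\<^sup>2 + 2 * F s) / (p2 s)\<^sup>2)" by (simp only: real_sqrt_divide)
    finally show ?thesis using pos by (simp add: add_divide_distrib)
  qed
  have "2 * F s / (p1 s)\<^sup>2 \<le> 2 * F s / (p2 s)\<^sup>2"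
    using Fs pos pp by (intro divide_left_mono_neg power_mono) auto
  then have "x1 \<le> x2" by (simp add: x1 x2)
  moreover have "0 < x1" using e1[OF s'(1,2)] pos by (simp add: x1_def)
  ultimately have "((real N - 1) / x2 - x2) - ((real N - 1) / x1 - x1) \<le> 0"
    using N divide_left_mono[of x1 x2 "real N - 1"] by simp
  then show "\<exists>d. ((\<lambda>s. W2 s - W1 s) has_real_derivative d) (at s) \<and> d \<le> 0"
    using W_diff_deriv[OF s'(1,2)] unfolding x1_def x2_def by blast
qed (use c in auto)

lemma below:
  assumes s0: "0 < s0" "s0 \<le> \<beta>" "\<rho>2 s0 \<le> \<rho>1 s0" "W1 s0 < W2 s0"
  shows "\<exists>\<delta>>0. \<forall>s. 0 < s \<and> s < s0 \<longrightarrow> \<delta> \<le> \<rho>2 s * p2 s"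
proof -
  have lt: "s < a1" if "s \<le> s0" for s using that s0 ord by simp
  have W: "W1 s < W2 s" if s: "0 < s" "s \<le> s0" for s
  proof (rule ccontr)
    assume neg: "\<not> W1 s < W2 s"
    obtain c where c: "s \<le> c" "c < s0" "W2 c - W1 c = 0" "\<And>x. c < x \<Longrightarrow> x \<le> s0 \<Longrightarrow> 0 < W2 x - W1 x"
      using last_nonpos[OF W_diff_cont[of s s0]] neg s s0 lt[of s0] by (smt (verit))
    have "W2 s0 - W1 s0 \<le> W2 c - W1 c"
      using c s s0 by (intro W_gap_widens) auto
    then show False using c s0 by simp
  qed
  have "W2 s0 - W1 s0 \<le> \<rho>2 s * p2 s" if s: "0 < s" "s < s0" for s
  proof -
    have s': "s < a1" "s < a2" using lt[of s] s ord by auto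
    have "W2 s0 - W1 s0 \<le> W2 s - W1 s" using W s s0 by (intro W_gap_widens) auto
    also have "\<dots> \<le> W2 s" using r1[OF s(1) s'(1)] e1[OF s(1) s'(1)] by (simp add: W1_def)
    also have "\<dots> \<le> \<rho>2 s * sqrt ((p2 s)\<^sup>2)"
      unfolding W2_def using r2[OF s(1) s'(2)] F_nonpos[of s] s s0 by (intro mult_left_mono real_sqrt_le_mono) auto
    also have "\<dots> = \<rho>2 s * p2 s" using p2[OF s(1) s'(2)] by simp
    finally show ?thesis .
  qed
  then show ?thesis using s0 by (intro exI[of _ "W2 s0 - W1 s0"]) auto
qed

lemma F_pos: "\<beta> < s \<Longrightarrow> s \<le> a2 \<Longrightarrow> 0 < F s"
proof -
  assume s: "\<beta> < s" "s \<le> a2"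
  have "- F s < - F \<beta>"
  proof (rule strict_decreasing_of_deriv[of \<beta> s "\<lambda>s. - F s"])
    show "continuous_on {\<beta>..s} (\<lambda>s. - F s)"
      by (intro continuous_intros continuous_at_imp_continuous_on ballI DERIV_isCont[OF F_deriv])
    fix t assume "\<beta> < t" "t < s"
    then show "\<exists>d. ((\<lambda>s. - F s) has_real_derivative d) (at t) \<and> d < 0"
      using F_deriv[of t] g_pos[of t] s by (intro exI[of _ "- g t"]) (auto intro!: derivative_eq_intros)
  qed (use s in auto)
  then show ?thesis by (simp add: F_beta)
qed

definition w1 where "w1 s = \<rho>1 s ^ (N - 1) * p1 s"
definition w2 where "w2 s = \<rho>2 s ^ (N - 1) * p2 s"

lemma w_deriv_aux:
  assumes h: "hodograph N g a \<rho> p" and s: "0 < s" "s < a"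
  shows "((\<lambda>s. \<rho> s ^ (N - 1) * p s) has_real_derivative - (\<rho> s ^ (N - 1) * p s) * g s / (p s)\<^sup>2) (at s)"
proof -
  note pos = hodographD(1,2)[OF h s] note d = hodographD(3,4)[OF h s]
  obtain m where m: "N = Suc (Suc m)" using N by (metis Suc_lessD less_natE add_2_eq_Suc add.commute plus_1_eq_Suc add_Suc)
  have "((\<lambda>s. \<rho> s ^ (N - 1) * p s) has_real_derivative
     real (N - 1) * \<rho> s ^ (N - 1 - 1) * - (1 / p s) * p s + \<rho> s ^ (N - 1) * ((real N - 1) / \<rho> s - g s / p s)) (at s)"
    by (auto intro!: derivative_eq_intros d)
  moreover have "real (N - 1) * \<rho> s ^ (N - 1 - 1) * - (1 / p s) * p s + \<rho> s ^ (N - 1) * ((real N - 1) / \<rho> s - g s / p s)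
    = - (\<rho> s ^ (N - 1) * p s) * g s / (p s)\<^sup>2"
    using pos unfolding m by (simp add: field_simps power2_eq_square)
  ultimately show ?thesis by simp
qed

abbreviation "Q \<equiv> \<lambda>t. F t / g t"

text \<open>With \<open>w = \<rho> ^ (N - 1) * p\<close> and \<open>Q = F / g\<close>, the product of
  \<open>w\<close> and the function below is the functional of Erbe and Tang, \<open>\<rho> ^
  N * (p\<^sup>2 + 2 * F) - 2 * N * w * Q\<close>, a variant of the Pohozaev identity whose
  derivative \<open>w * (N - 2 - 2 * N * Q')\<close> has a sign. Dividing by \<open>w\<close>
  makes \<open>Q\<close> cancel when two solutions are compared.\<close>

lemma T_deriv_aux:
  assumes h: "hodograph N g a \<rho> p" and s: "0 < s" "s < a" and g: "g s \<noteq> 0"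
    and q: "(Q has_real_derivative q) (at s)"
  shows "((\<lambda>s. \<rho> s * p s + 2 * \<rho> s * F s / p s - 2 * real N * Q s) has_real_derivative
     (real N - 2) - 2 * real N * q + g s / (p s)\<^sup>2 * (\<rho> s * p s + 2 * \<rho> s * F s / p s - 2 * real N * Q s)) (at s)"
proof -
  note pos = hodographD(1,2)[OF h s] note d = hodographD(3,4)[OF h s]
  define dp where "dp = (real N - 1) / \<rho> s - g s / p s"
  have dp: "(p has_real_derivative dp) (at s)" using d by (simp add: dp_def)
  have "((\<lambda>s. \<rho> s * p s + 2 * \<rho> s * F s / p s - 2 * real N * Q s) has_real_derivative
     (- (1 / p s) * p s + dp * \<rho> s) + ((2 * (- (1 / p s)) * F s + g s * (2 * \<rho> s)) * p s - 2 * \<rho> s * F s * dp) / (p s * p s) - 2 * real N * q) (at s)"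
    by (intro DERIV_diff DERIV_add DERIV_mult DERIV_divide DERIV_cmult d(1) dp F_deriv q) (use pos in auto)
  moreover have "(- (1 / p s) * p s + dp * \<rho> s) + ((2 * (- (1 / p s)) * F s + g s * (2 * \<rho> s)) * p s - 2 * \<rho> s * F s * dp) / (p s * p s) - 2 * real N * q
    = (real N - 2) - 2 * real N * q + g s / (p s)\<^sup>2 * (\<rho> s * p s + 2 * \<rho> s * F s / p s - 2 * real N * Q s)"
    using pos g by (simp add: dp_def divide_simps power2_eq_square) (simp add: algebra_simps)
  ultimately show ?thesis by (rule DERIV_cong)
qed

definition T1 where "T1 s = \<rho>1 s * p1 s + 2 * \<rho>1 s * F s / p1 s - 2 * real N * Q s"
definition T2 where "T2 s = \<rho>2 s * p2 s + 2 * \<rho>2 s * F s / p2 s - 2 * real N * Q s"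

text \<open>Both quantities vanish at the starting height. The division by \<open>p\<close> in the first
  one is harmless since \<open>w\<close> contains the factor \<open>p\<close>.\<close>

lemma wT_tendsto_aux:
  assumes h: "hodograph N g a \<rho> p" and a: "\<beta> < a" "a \<le> a2"
  shows "((\<lambda>s. (\<rho> s ^ (N - 1) * p s) * (\<rho> s * p s + 2 * \<rho> s * F s / p s - 2 * real N * Q s)) \<longlongrightarrow> 0) (at_left a)"
    "((\<lambda>s. \<rho> s ^ (N - 1) * p s) \<longlongrightarrow> 0) (at_left a)"
proof -
  have lim: "(\<rho> \<longlongrightarrow> 0) (at_left a)" "(p \<longlongrightarrow> 0) (at_left a)" using h by (auto simp: hodograph_def)
  have F: "(F \<longlongrightarrow> F a) (at_left a)"
    using DERIV_isCont[OF F_deriv[of a]] by (simp add: isCont_def filterlim_at_split)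
  have G: "(g \<longlongrightarrow> g a) (at_left a)"
    using g_cont[of a] by (simp add: isCont_def filterlim_at_split)
  have ga: "g a \<noteq> 0" using g_pos[of a] a by simp
  have n: "N - 1 \<noteq> 0" using N by simp
  have "((\<lambda>s. \<rho> s ^ (N - 1) * p s) \<longlongrightarrow> 0 ^ (N - 1) * 0) (at_left a)"
    by (intro tendsto_intros lim)
  then show w: "((\<lambda>s. \<rho> s ^ (N - 1) * p s) \<longlongrightarrow> 0) (at_left a)" by simp
  have "((\<lambda>s. (\<rho> s ^ (N - 1) * p s) * (\<rho> s * p s) + 2 * (\<rho> s ^ (N - 1) * \<rho> s) * F s - 2 * real N * (\<rho> s ^ (N - 1) * p s) * Q s)
     \<longlongrightarrow> 0 * (0 * 0) + 2 * (0 ^ (N - 1) * 0) * F a - 2 * real N * 0 * (F a / g a)) (at_left a)"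
    by (intro tendsto_intros lim w F G ga)
  then have 1: "((\<lambda>s. (\<rho> s ^ (N - 1) * p s) * (\<rho> s * p s) + 2 * (\<rho> s ^ (N - 1) * \<rho> s) * F s - 2 * real N * (\<rho> s ^ (N - 1) * p s) * Q s)
     \<longlongrightarrow> 0) (at_left a)" by simp
  have ev: "\<forall>\<^sub>F s in at_left a. s \<in> {0<..<a}" using a ord by (intro eventually_at_leftI[of 0]) auto
  show "((\<lambda>s. (\<rho> s ^ (N - 1) * p s) * (\<rho> s * p s + 2 * \<rho> s * F s / p s - 2 * real N * Q s)) \<longlongrightarrow> 0) (at_left a)"
  proof (rule Lim_transform_eventually[OF 1])
    show "\<forall>\<^sub>F s in at_left a. (\<rho> s ^ (N - 1) * p s) * (\<rho> s * p s) + 2 * (\<rho> s ^ (N - 1) * \<rho> s) * F s - 2 * real N * (\<rho> s ^ (N - 1) * p s) * Q s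
      = (\<rho> s ^ (N - 1) * p s) * (\<rho> s * p s + 2 * \<rho> s * F s / p s - 2 * real N * Q s)"
      using ev
    proof (rule eventually_mono)
      fix s assume "s \<in> {0<..<a}"
      then have "0 < p s" using hodographD(2)[OF h] by simp
      then show "(\<rho> s ^ (N - 1) * p s) * (\<rho> s * p s) + 2 * (\<rho> s ^ (N - 1) * \<rho> s) * F s - 2 * real N * (\<rho> s ^ (N - 1) * p s) * Q s
      = (\<rho> s ^ (N - 1) * p s) * (\<rho> s * p s + 2 * \<rho> s * F s / p s - 2 * real N * Q s)"
        by (simp add: distrib_left right_diff_distrib)
    qed
  qed
qed

lemma strictly_monotone_limit:
  fixes f :: "real \<Rightarrow> real"
  assumes "c < a" "(f \<longlongrightarrow> 0) (at_left a)"
    and "\<And>x y. c \<le> x \<Longrightarrow> x < y \<Longrightarrow> y < a \<Longrightarrow> f y < f x"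
  shows "0 < f c"
proof -
  have "f ((c + a) / 2) < f c" using assms(1) by (intro assms(3)) auto
  moreover have "0 \<le> f ((c + a) / 2)"
  proof (rule tendsto_upperbound[OF assms(2)])
    have "\<forall>\<^sub>F x in at_left a. x \<in> {(c + a) / 2<..<a}"
      using assms(1) by (intro eventually_at_leftI[of "(c + a) / 2"]) auto
    then show "\<forall>\<^sub>F x in at_left a. f x \<le> f ((c + a) / 2)"
      by (rule eventually_mono) (use assms(1) assms(3)[of "(c + a) / 2"] in \<open>force intro: less_imp_le\<close>)
  qed (use trivial_limit_at_left_real in auto)
  ultimately show ?thesis by simp
qed

lemma T2_pos:
  assumes s: "\<beta> < s" "s < a2" shows "0 < T2 s"
proof -
  have dom: "0 < x" if "\<beta> < x" for x using that ord by simp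
  have "0 < w2 s * T2 s"
  proof (rule strictly_monotone_limit[OF s(2)])
    show "((\<lambda>s. w2 s * T2 s) \<longlongrightarrow> 0) (at_left a2)"
      unfolding w2_def T2_def using ord by (intro wT_tendsto_aux[OF h2]) auto
    fix x y assume xy: "s \<le> x" "x < y" "y < a2"
    have der: "\<exists>d. ((\<lambda>s. w2 s * T2 s) has_real_derivative d) (at t) \<and> d < 0" if t: "x \<le> t" "t \<le> y" for t
    proof -
      have t': "\<beta> < t" "0 < t" "t < a2" "0 < g t" using t xy s dom[of t] g_pos[of t] by auto
      obtain q where q: "(Q has_real_derivative q) (at t)" "(real N - 2) / (2 * real N) < q"
        using Q_deriv[OF t'(1,3)] by blast
      note pos = p2[OF t'(2,3)] r2[OF t'(2,3)]
      have w: "0 < w2 t" using pos by (simp add: w2_def)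
      have "((\<lambda>s. w2 s * T2 s) has_real_derivative
        (- w2 t * g t / (p2 t)\<^sup>2) * T2 t + ((real N - 2) - 2 * real N * q + g t / (p2 t)\<^sup>2 * T2 t) * w2 t) (at t)"
        unfolding w2_def[abs_def] T2_def[abs_def]
        by (rule DERIV_mult[OF w_deriv_aux[OF h2 t'(2,3)] T_deriv_aux[OF h2 t'(2,3) _ q(1)]]) (use t' in auto)
      moreover have "(- w2 t * g t / (p2 t)\<^sup>2) * T2 t + ((real N - 2) - 2 * real N * q + g t / (p2 t)\<^sup>2 * T2 t) * w2 t
         = w2 t * ((real N - 2) - 2 * real N * q)" by (simp add: algebra_simps)
      moreover have "(real N - 2) - 2 * real N * q < 0" using q(2) N by (simp add: field_simps)
      then have "w2 t * ((real N - 2) - 2 * real N * q) < 0" using w by (simp add: mult_pos_neg)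
      ultimately show ?thesis by metis
    qed
    show "w2 y * T2 y < w2 x * T2 x"
    proof (rule strict_decreasing_of_deriv[of x y "\<lambda>s. w2 s * T2 s"])
      show "continuous_on {x..y} (\<lambda>s. w2 s * T2 s)"
        using der by (intro continuous_at_imp_continuous_on ballI) (meson DERIV_isCont atLeastAtMost_iff)
    qed (use xy der in auto)
  qed
  moreover have "0 < w2 s" using p2[of s] r2[of s] s dom[of s] by (simp add: w2_def)
  ultimately show ?thesis by (simp add: zero_less_mult_iff)
qed

lemma T_diff: "T1 s - T2 s = (\<rho>1 s * p1 s - \<rho>2 s * p2 s) + 2 * F s * (\<rho>1 s / p1 s - \<rho>2 s / p2 s)"
  by (simp add: T1_def T2_def algebra_simps)

text \<open>The derivative of \<open>w1 * (T1 - T2)\<close> with respect to the height is \<open>w1 * g *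
  T2 * (1 / p1\<^sup>2 - 1 / p2\<^sup>2)\<close>, because the two terms with \<open>Q'\<close>
  cancel. It is positive where the lower solution is slower, and the function tends to 0 at
  the top.\<close>

lemma T_less:
  assumes c: "\<beta> \<le> c" "c < a1" and D: "\<And>s. c < s \<Longrightarrow> s < a1 \<Longrightarrow> 0 < D s"
  shows "T1 c < T2 c"
proof -
  let ?Z = "\<lambda>s. - (w1 s * (T1 s - T2 s))"
  have dom: "0 < x" if "\<beta> \<le> x" for x using that ord by simp
  have a1: "0 < a1" "\<beta> < a1" using ord by auto
  have "0 < ?Z c"
  proof (rule strictly_monotone_limit[OF c(2)])
    have P1: "((\<lambda>s. w1 s * T1 s) \<longlongrightarrow> 0) (at_left a1)" and w: "(w1 \<longlongrightarrow> 0) (at_left a1)"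
      unfolding w1_def[abs_def] T1_def using wT_tendsto_aux[OF h1] ord by auto
    obtain q where q: "(Q has_real_derivative q) (at a1)" using Q_deriv[of a1] ord by blast
    have "isCont T2 a1"
      unfolding T2_def[abs_def] using g_pos[of a1] ord
      by (intro DERIV_isCont[OF T_deriv_aux[OF h2 a1(1) ord(4) _ q]]) auto
    then have "(T2 \<longlongrightarrow> T2 a1) (at_left a1)" by (simp add: isCont_def filterlim_at_split)
    then have "((\<lambda>s. - (w1 s * T1 s - w1 s * T2 s)) \<longlongrightarrow> - (0 - 0 * T2 a1)) (at_left a1)"
      by (intro tendsto_intros P1 w)
    then show "(?Z \<longlongrightarrow> 0) (at_left a1)" by (simp add: right_diff_distrib)
    fix x y assume xy: "c \<le> x" "x < y" "y < a1"
    show "?Z y < ?Z x"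
    proof (rule strict_decreasing_of_deriv[of x y ?Z])
      have "continuous_on {x..y} (\<lambda>s. - (w1 s * ((\<rho>1 s * p1 s - \<rho>2 s * p2 s) + 2 * F s * (\<rho>1 s / p1 s - \<rho>2 s / p2 s))))"
        unfolding w1_def
        using xy c ord dom p1 p2
        by (intro continuous_intros continuous_at_imp_continuous_on ballI DERIV_isCont[OF dr1] DERIV_isCont[OF dp1]
            DERIV_isCont[OF dr2] DERIV_isCont[OF dp2] DERIV_isCont[OF F_deriv]) (auto simp: less_imp_neq[symmetric])
      then show "continuous_on {x..y} ?Z" by (simp add: T_diff)
      fix t assume t: "x < t" "t < y"
      have t': "\<beta> < t" "0 < t" "t < a1" "t < a2" "0 < g t" "c < t"
        using t xy c dom[of t] g_pos[of t] ord by auto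
      obtain q where q: "(Q has_real_derivative q) (at t)" using Q_deriv[OF t'(1,4)] by blast
      note pos = p1[OF t'(2,3)] r1[OF t'(2,3)] p2[OF t'(2,4)] r2[OF t'(2,4)]
      have w: "0 < w1 t" using pos by (simp add: w1_def)
      have pp: "p1 t < p2 t" using D[of t] t' D_pos_iff[of t] by auto
      let ?A1 = "(real N - 2) - 2 * real N * q + g t / (p1 t)\<^sup>2 * T1 t"
      let ?A2 = "(real N - 2) - 2 * real N * q + g t / (p2 t)\<^sup>2 * T2 t"
      have "((\<lambda>s. w1 s * (T1 s - T2 s)) has_real_derivative
        (- w1 t * g t / (p1 t)\<^sup>2) * (T1 t - T2 t) + (?A1 - ?A2) * w1 t) (at t)"
        unfolding w1_def[abs_def] T1_def[abs_def] T2_def[abs_def]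
        by (rule DERIV_mult[OF w_deriv_aux[OF h1 t'(2,3)] DERIV_diff[OF T_deriv_aux[OF h1 t'(2,3) _ q] T_deriv_aux[OF h2 t'(2,4) _ q]]])
           (use t' in auto)
      moreover have "(- w1 t * g t / (p1 t)\<^sup>2) * (T1 t - T2 t) + (?A1 - ?A2) * w1 t
         = w1 t * g t * T2 t * (1 / (p1 t)\<^sup>2 - 1 / (p2 t)\<^sup>2)"
        by (simp add: algebra_simps diff_divide_distrib add_divide_distrib)
      moreover have "0 < w1 t * g t * T2 t * (1 / (p1 t)\<^sup>2 - 1 / (p2 t)\<^sup>2)"
      proof (intro mult_pos_pos w t' T2_pos)
        have "(p1 t)\<^sup>2 < (p2 t)\<^sup>2" using pp pos by (intro power_strict_mono) auto
        then show "0 < 1 / (p1 t)\<^sup>2 - 1 / (p2 t)\<^sup>2" using pos by (simp add: divide_strict_left_mono)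
      qed
      ultimately have "((\<lambda>s. w1 s * (T1 s - T2 s)) has_real_derivative
          w1 t * g t * T2 t * (1 / (p1 t)\<^sup>2 - 1 / (p2 t)\<^sup>2)) (at t)"
        and pos: "0 < w1 t * g t * T2 t * (1 / (p1 t)\<^sup>2 - 1 / (p2 t)\<^sup>2)" by simp_all
      from DERIV_minus[OF this(1)] pos show "\<exists>d. (?Z has_real_derivative d) (at t) \<and> d < 0"
        using neg_less_0_iff_less by blast
    qed (use xy in auto)
  qed
  moreover have "0 < w1 c" using p1[of c] r1[of c] c dom[of c] by (simp add: w1_def)
  ultimately show ?thesis by (simp add: mult_less_0_iff)
qed

text \<open>If the speeds agreed at some height \<open>c\<close> between \<open>\<beta>\<close> and
  \<open>sI\<close>, then \<open>T1 - T2 = (\<rho>1 - \<rho>2) * (p + 2 * F / p)\<close>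
  there. This is positive, since the radii have separated below the intersection, and
  contradicts \<open>T_less\<close>. At \<open>\<beta>\<close> the primitive vanishes, and
  \<open>T1 < T2\<close> becomes \<open>W1 < W2\<close>.\<close>

lemma case_above:
  assumes "\<beta> \<le> sI"
  shows "\<rho>2 \<beta> \<le> \<rho>1 \<beta>" "W1 \<beta> < W2 \<beta>"
proof -
  have \<rho>: "\<rho>2 c \<le> \<rho>1 c \<and> (c < sI \<longrightarrow> \<rho>2 c < \<rho>1 c)"
    if c: "0 < c" "c \<le> sI" and D: "\<And>s. c < s \<Longrightarrow> s \<le> sI \<Longrightarrow> 0 < D s" for c
  proof (cases "c = sI")
    case False
    have "\<rho>1 sI - \<rho>2 sI < \<rho>1 c - \<rho>2 c"
    proof (rule strict_decreasing_of_deriv[of c sI "\<lambda>s. \<rho>1 s - \<rho>2 s"])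
      show "continuous_on {c..sI} (\<lambda>s. \<rho>1 s - \<rho>2 s)" using c sI by (intro \<rho>_diff_cont) auto
      fix t assume t: "c < t" "t < sI"
      then have t': "0 < t" "t < a1" using c sI by auto
      have "p1 t < p2 t" using D[of t] t D_pos_iff[OF t'] by simp
      then have "1 / p2 t - 1 / p1 t < 0" using p1[OF t'] by (simp add: divide_strict_left_mono)
      then show "\<exists>d. ((\<lambda>s. \<rho>1 s - \<rho>2 s) has_real_derivative d) (at t) \<and> d < 0"
        using \<rho>_diff_deriv[OF t'] by blast
    qed (use False c in auto)
    then show ?thesis using sI by simp
  qed (use sI in auto)
  have b0: "0 < \<beta>" using ord by simp
  have Dp: "0 < D s" if s: "\<beta> \<le> s" "s < a1" for s
  proof (cases "s < sI")
    case True
    show ?thesis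
    proof (rule ccontr)
      assume neg: "\<not> 0 < D s"
      obtain c where c: "s \<le> c" "c < sI" "D c = 0" "\<And>x. c < x \<Longrightarrow> x \<le> sI \<Longrightarrow> 0 < D x"
        using last_nonpos[OF D_cont[of s sI]] neg True s b0 sI D_pos_at by (smt (verit))
      have c': "0 < c" "c < a1" "c < a2" "\<beta> \<le> c" using c s b0 sI ord by auto
      have "T1 c < T2 c"
      proof (rule T_less)
        fix x assume "c < x" "x < a1"
        then show "0 < D x" using c(4)[of x] D_pos_above[of x] by (cases "x \<le> sI") auto
      qed (use c' in auto)
      moreover have "p1 c = p2 c" using c D_zero_iff[of c] c' by simp
      moreover have "T1 c - T2 c = (\<rho>1 c - \<rho>2 c) * (p1 c + 2 * F c / p1 c)"
        unfolding T_diff using \<open>p1 c = p2 c\<close> p1[of c] c' by (simp add: field_simps)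
      moreover have "0 < (\<rho>1 c - \<rho>2 c) * (p1 c + 2 * F c / p1 c)"
      proof (rule mult_pos_pos)
        show "0 < \<rho>1 c - \<rho>2 c" using \<rho>[of c] c c' by auto
        have "0 \<le> F c" using F_pos[of c] F_beta c' by (cases "c = \<beta>") auto
        then show "0 < p1 c + 2 * F c / p1 c" using p1[of c] c' by (simp add: add_pos_nonneg)
      qed
      ultimately show False by simp
    qed
  next
    case False
    then show ?thesis using D_pos_at D_pos_above[of s] s by (cases "s = sI") auto
  qed
  show "\<rho>2 \<beta> \<le> \<rho>1 \<beta>" using \<rho>[of \<beta>] assms b0 Dp sI by auto
  have "T1 \<beta> < T2 \<beta>" using Dp ord by (intro T_less) auto
  moreover have "T1 \<beta> - T2 \<beta> = \<rho>1 \<beta> * p1 \<beta> - \<rho>2 \<beta> * p2 \<beta>" by (simp add: T_diff F_beta)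
  moreover have "W1 \<beta> = \<rho>1 \<beta> * p1 \<beta>" "W2 \<beta> = \<rho>2 \<beta> * p2 \<beta>"
    using p1[of \<beta>] p2[of \<beta>] b0 ord by (simp_all add: W1_def W2_def F_beta)
  ultimately show "W1 \<beta> < W2 \<beta>" by simp
qed

text \<open>In \<open>below\<close> the gap \<open>W2 - W1\<close> gives a lower bound for \<open>\<rho>2
  * p2\<close>. The descent starts at \<open>\<beta>\<close> if the intersection lies above
  \<open>\<beta>\<close>, and at the intersection itself otherwise.\<close>

lemma flux_lower_bound: "\<exists>\<delta>>0. \<exists>s0>0. s0 \<le> a1 \<and> (\<forall>s. 0 < s \<and> s < s0 \<longrightarrow> \<delta> \<le> \<rho>2 s * p2 s)"
proof (cases "\<beta> \<le> sI")
  case True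
  from below[OF _ _ case_above[OF True]] show ?thesis using ord by force
next
  case False
  have s: "sI < a2" using sI ord by simp
  have "(p1 sI)\<^sup>2 + 2 * F sI < (p2 sI)\<^sup>2 + 2 * F sI" using D_pos_at by (simp add: D_def)
  then have "W1 sI < W2 sI"
    unfolding W1_def W2_def using r2[OF sI_pos s] sI by simp
  then show ?thesis using below[of sI] sI_pos sI False by force
qed

end

section \<open>Solutions starting below a ground state\<close>

text \<open>The Sturm argument: as long as \<open>b < z < U\<close>, superlinearity makes the quantity
  \<open>r ^ (N - 1) * ((z - b) * U' - (U - b) * z')\<close> nonincreasing. It is 0 at the
  centre and would be positive at the radius where \<open>z\<close> reaches \<open>b\<close>,
  if \<open>U\<close> were still above \<open>z\<close> there.\<close>

lemma first_intersection:
  assumes Z: "transversal_shot N g b h z" and U: "transversal_shot N g b a U" and ha: "h < a"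
    and EZ: "\<And>r. 0 \<le> r \<Longrightarrow> 0 \<le> shot.E N g z r"
    and EU: "\<And>r. 0 \<le> r \<Longrightarrow> 0 \<le> shot.E N g U r"
    and superlin: "\<And>s t. b < s \<Longrightarrow> s \<le> t \<Longrightarrow> t \<le> a \<Longrightarrow> g s / (s - b) \<le> g t / (t - b)"
  obtains r where "0 < r" "z r = U r" "b \<le> z r" "\<And>x. 0 \<le> x \<Longrightarrow> x < r \<Longrightarrow> z x < U x"
proof -
  interpret Z: transversal_shot N g b h z by fact
  interpret U: transversal_shot N g b a U by fact
  have VZ: "0 < Z.V r" if "0 < r" for r using Z.V_pos[of r r] EZ that by simp
  have VU: "0 < U.V r" if "0 < r" for r using U.V_pos[of r r] EU that by simp
  have decZ: "z y < z x" if "0 \<le> x" "x < y" for x y by (rule Z.u_strict_antimono) (use that VZ in auto)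
  have leU: "U x \<le> a" if "0 \<le> x" for x
    using U.u_antimono[of 0 x] that VU U.u_0 by (simp add: less_imp_le)
  have bh: "b < h" using Z.a_gt_b EZ by simp
  obtain R where R: "0 \<le> R" "z R = b" using Z.attains_all_heights[OF EZ, of b] bh Z.b by auto
  have R0: "0 < R" using R bh Z.u_0 by (cases "R = 0") auto
  have "\<exists>r. 0 \<le> r \<and> r \<le> R \<and> U r \<le> z r"
  proof (rule ccontr)
    assume "\<not> ?thesis"
    then have less: "z r < U r" if "0 \<le> r" "r \<le> R" for r using that by (meson not_less)
    \<comment> \<open>the Sturm-Picone quantity of \<open>z - b\<close> and \<open>U - b\<close>\<close>
    let ?wz = "\<lambda>r. r ^ (N - 1) * Z.V r" and ?wu = "\<lambda>r. r ^ (N - 1) * U.V r"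
    let ?X = "\<lambda>r. (U r - b) * ?wz r - (z r - b) * ?wu r"
    have "?X R \<le> ?X 0"
    proof (rule decreasing_of_deriv[of 0 R ?X])
      show "continuous_on {0..R} ?X"
        by (intro continuous_intros continuous_on_subset[OF Z.u_cont] continuous_on_subset[OF U.u_cont]
            continuous_on_subset[OF Z.V_cont] continuous_on_subset[OF U.V_cont]) auto
      fix r assume r: "0 < r" "r < R"
      have zb: "b < z r" using decZ[of r R] r R by simp
      have zU: "z r < U r" using less[of r] r by simp
      let ?d = "(- U.V r * ?wz r + r ^ (N - 1) * g (z r) * (U r - b)) - (- Z.V r * ?wu r + r ^ (N - 1) * g (U r) * (z r - b))"
      have "((\<lambda>r. U r - b) has_real_derivative - U.V r) (at r)" "((\<lambda>r. z r - b) has_real_derivative - Z.V r) (at r)"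
        using DERIV_diff[OF U.u_deriv[OF r(1)] DERIV_const[of b]] DERIV_diff[OF Z.u_deriv[OF r(1)] DERIV_const[of b]] by simp_all
      then have X: "(?X has_real_derivative ?d) (at r)"
        by (intro DERIV_diff DERIV_mult Z.W_deriv U.W_deriv r)
      have d: "?d = r ^ (N - 1) * (g (z r) * (U r - b) - g (U r) * (z r - b))"
        by (simp add: algebra_simps)
      have "g (z r) * (U r - b) \<le> g (U r) * (z r - b)"
        using superlin[of "z r" "U r"] zb zU leU[of r] r by (simp add: field_simps)
      then have "r ^ (N - 1) * (g (z r) * (U r - b) - g (U r) * (z r - b)) \<le> 0"
        using r by (intro mult_nonneg_nonpos) auto
      then have "?d \<le> 0" unfolding d .
      with X show "\<exists>d. (?X has_real_derivative d) (at r) \<and> d \<le> 0" by (intro exI[of _ ?d] conjI)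
    qed (use R in auto)
    then have "(U R - b) * ?wz R \<le> 0" using R by simp
    moreover have "0 < (U R - b) * ?wz R"
      using less[of R] R R0 VZ[OF R0] by (intro mult_pos_pos) auto
    ultimately show False by simp
  qed
  then obtain r where r: "0 \<le> r" "r \<le> R" "U r \<le> z r" by blast
  obtain c where c: "0 < c" "c \<le> r" "U c - z c = 0" "\<And>x. 0 \<le> x \<Longrightarrow> x < c \<Longrightarrow> 0 < U x - z x"
    by (rule first_nonpos[of 0 r "\<lambda>x. U x - z x"])
       (use r ha Z.u_0 U.u_0 in \<open>auto intro!: continuous_intros continuous_on_subset[OF Z.u_cont] continuous_on_subset[OF U.u_cont]\<close>)
  have "b \<le> z c" using decZ[of c R] c r R by (cases "c = R") auto
  then show ?thesis using c by (intro that[of c]) simp_all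
qed

text \<open>Otherwise \<open>z\<close> runs through all heights down to 0 and the comparison applies. It
  yields \<open>\<rho>2 * p2 \<ge> \<delta>\<close> near height 0, that is, \<open>ln
  \<rho>2\<close> changes at rate at most \<open>1 / \<delta>\<close>; so the radius of
  \<open>U\<close> stays bounded as its height tends to 0.\<close>

theorem lower_start_negative_energy:
  assumes Z: "transversal_shot N g b h z" and U: "transversal_shot N g b a U" and ha: "h < a"
    and U0: "(U \<longlongrightarrow> 0) at_top"
    and Upos: "\<And>r. 0 \<le> r \<Longrightarrow> 0 < U r"
    and superlin: "\<And>s t. b < s \<Longrightarrow> s \<le> t \<Longrightarrow> t \<le> a \<Longrightarrow> g s / (s - b) \<le> g t / (t - b)"
    and \<beta>: "b \<le> \<beta>" "primitive g \<beta> = 0" "\<beta> < a"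
    and Q: "\<And>s. \<beta> < s \<Longrightarrow> s < a \<Longrightarrow>
      \<exists>q. ((\<lambda>t. primitive g t / g t) has_real_derivative q) (at s) \<and> (real N - 2) / (2 * real N) < q"
  shows "\<exists>r\<ge>0. shot.E N g z r < 0"
proof (rule ccontr)
  interpret Z: transversal_shot N g b h z by fact
  interpret U: transversal_shot N g b a U by fact
  assume "\<not> ?thesis"
  then have EZ: "0 \<le> Z.E r" if "0 \<le> r" for r using that by (auto simp: not_less)
  have EU: "0 \<le> U.E r" if "0 \<le> r" for r using U.tends_to_zero_imp_energy_nonneg[OF U0 that] .
  have VZ: "0 < Z.V r" if "0 < r" for r using Z.V_pos[of r r] EZ that by simp
  have VU: "0 < U.V r" if "0 < r" for r using U.V_pos[of r r] EU that by simp
  have decZ: "z y < z x" if "0 \<le> x" "x < y" for x y by (rule Z.u_strict_antimono) (use that VZ in auto)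
  have decU: "U y < U x" if "0 \<le> x" "x < y" for x y by (rule U.u_strict_antimono) (use that VU in auto)
  have b\<beta>: "b < \<beta>" using \<beta> Z.primitive_neg[of b] Z.b by (cases "b = \<beta>") auto
  have F_nonpos: "primitive g s \<le> 0" if s: "0 < s" "s \<le> \<beta>" for s
  proof (cases "s \<le> b")
    case True
    then show ?thesis using Z.primitive_neg[of s] s by simp
  next
    case False
    have "- primitive g \<beta> \<le> - primitive g s"
    proof (rule decreasing_of_deriv[of s \<beta> "\<lambda>s. - primitive g s"])
      show "continuous_on {s..\<beta>} (\<lambda>s. - primitive g s)" by (intro continuous_intros U.primitive_cont)
      fix t assume "s < t" "t < \<beta>"
      then show "\<exists>d. ((\<lambda>s. - primitive g s) has_real_derivative d) (at t) \<and> d \<le> 0"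
        using U.g_pos[of t] False \<beta> by (intro exI[of _ "- g t"] conjI DERIV_minus U.primitive_deriv) auto
    qed (use s in auto)
    then show ?thesis using \<beta> by simp
  qed
  have "Z.E 1 < Z.E 0" using VZ by (intro Z.E_strict_antimono) (auto simp: less_le)
  then have "0 < primitive g h" using EZ[of 1] Z.E_0 by simp
  then have \<beta>h: "\<beta> < h" using F_nonpos[of h] Z.a by force
  obtain rI where rI: "0 < rI" "z rI = U rI" "b \<le> z rI" "\<And>x. 0 \<le> x \<Longrightarrow> x < rI \<Longrightarrow> z x < U x"
    using first_intersection[OF Z U ha EZ EU superlin] by blast
  obtain \<rho>1 p1 where h1: "hodograph N g h \<rho>1 p1" "\<And>r. 0 < r \<Longrightarrow> \<rho>1 (z r) = r"
    "\<And>s. 0 < s \<Longrightarrow> s < h \<Longrightarrow> z (\<rho>1 s) = s \<and> 0 < (p1 s)\<^sup>2 + 2 * primitive g s"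
    using Z.hodograph_exists[OF EZ] by blast
  obtain \<rho>2 p2 where h2: "hodograph N g a \<rho>2 p2" "\<And>r. 0 < r \<Longrightarrow> \<rho>2 (U r) = r"
    "\<And>s. 0 < s \<Longrightarrow> s < a \<Longrightarrow> U (\<rho>2 s) = s \<and> 0 < (p2 s)\<^sup>2 + 2 * primitive g s"
    using U.hodograph_exists[OF EU] by blast
  interpret H: hodograph_pair N g "primitive g" h a b \<beta> "z rI" \<rho>1 p1 \<rho>2 p2
  proof
    show "N > 2" by (rule Z.N)
    show "hodograph N g h \<rho>1 p1" "hodograph N g a \<rho>2 p2" by fact+
    show "0 < b" "b \<le> \<beta>" "\<beta> < h" "h < a" using Z.b \<beta> \<beta>h ha by auto
    show "isCont g s" for s using Z.g_cont by (simp add: continuous_on_eq_continuous_at)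
    show "(primitive g has_real_derivative g s) (at s)" for s by (rule Z.primitive_deriv)
    show "z rI < h" using decZ[of 0 rI] rI Z.u_0 by simp
    show "\<rho>1 (z rI) = \<rho>2 (z rI)" using h1(2)[OF rI(1)] h2(2)[OF rI(1)] rI by simp
    show "\<rho>1 s < \<rho>2 s" if s: "z rI < s" "s < h" for s
    proof -
      have s': "0 < s" "s < a" using s rI Z.b ha by auto
      have pos: "0 < \<rho>1 s" "0 < \<rho>2 s" using hodographD(1)[OF h1(1)] hodographD(1)[OF h2(1)] s' s by auto
      have "\<rho>1 s < rI"
      proof (rule ccontr)
        assume "\<not> \<rho>1 s < rI"
        then have "z (\<rho>1 s) \<le> z rI" using decZ[of rI "\<rho>1 s"] rI by (cases "rI = \<rho>1 s") auto
        then show False using h1(3)[of s] s s' by simp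
      qed
      then have "z (\<rho>1 s) < U (\<rho>1 s)" using rI(4) pos by simp
      then have "U (\<rho>2 s) < U (\<rho>1 s)" using h1(3)[of s] h2(3)[of s] s s' by simp
      then show ?thesis using decU[of "\<rho>2 s" "\<rho>1 s"] pos by (cases "\<rho>1 s" "\<rho>2 s" rule: linorder_cases) auto
    qed
  qed (use h1 h2 F_nonpos \<beta> Q rI b\<beta> U.g_pos in auto)
  obtain \<delta> s0 where \<delta>: "0 < \<delta>" and s0: "0 < s0" "s0 \<le> h" and low: "\<And>s. 0 < s \<Longrightarrow> s < s0 \<Longrightarrow> \<delta> \<le> \<rho>2 s * p2 s"
    using H.flux_lower_bound by blast
  define m where "m = s0 / 2"
  have m: "0 < m" "m < s0" using s0 by (auto simp: m_def)
  have upper: "ln (\<rho>2 s) \<le> ln (\<rho>2 m) + m / \<delta>" if s: "0 < s" "s \<le> m" for s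
  proof -
    let ?f = "\<lambda>s. - (ln (\<rho>2 s) + s / \<delta>)"
    have der: "(?f has_real_derivative - (1 / \<rho>2 t * - (1 / p2 t) + 1 / \<delta>)) (at t)" if t: "s \<le> t" "t \<le> m" for t
    proof -
      have t': "0 < t" "t < a" using t s m s0 ha by auto
      have "((\<lambda>s. ln (\<rho>2 s)) has_real_derivative 1 / \<rho>2 t * - (1 / p2 t)) (at t)"
        by (rule DERIV_chain2[OF DERIV_ln_divide hodographD(3)[OF h2(1) t']]) (rule hodographD(1)[OF h2(1) t'])
      then show ?thesis by (intro DERIV_minus DERIV_add DERIV_cdivide DERIV_ident)
    qed
    have "?f m \<le> ?f s"
    proof (rule decreasing_of_deriv[of s m ?f])
      show "continuous_on {s..m} ?f" using der by (intro continuous_at_imp_continuous_on ballI) (meson DERIV_isCont atLeastAtMost_iff)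
      fix t assume t: "s < t" "t < m"
      have "\<delta> \<le> \<rho>2 t * p2 t" using low[of t] t s m by simp
      then have "1 / (\<rho>2 t * p2 t) \<le> 1 / \<delta>" using \<delta> by (intro divide_left_mono) (auto intro: mult_pos_pos less_le_trans)
      then show "\<exists>d. (?f has_real_derivative d) (at t) \<and> d \<le> 0"
        using der[of t] t by (intro exI[of _ "- (1 / \<rho>2 t * - (1 / p2 t) + 1 / \<delta>)"]) auto
    qed (use s in auto)
    moreover have "0 \<le> s / \<delta>" using s \<delta> by simp
    ultimately show ?thesis by simp
  qed
  have "\<forall>\<^sub>F r in at_top. U r < m" using order_tendstoD(2)[OF U0 m(1)] .
  then obtain R where R: "\<And>r. R \<le> r \<Longrightarrow> U r < m" by (auto simp: eventually_at_top_linorder)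
  define r where "r = max R (max 1 (exp (ln (\<rho>2 m) + m / \<delta> + 1)))"
  have r: "0 < r" "U r < m" using R[of r] by (auto simp: r_def)
  have "ln (\<rho>2 (U r)) \<le> ln (\<rho>2 m) + m / \<delta>" using upper[of "U r"] r Upos[of r] by simp
  then have "ln r \<le> ln (\<rho>2 m) + m / \<delta>" using h2(2)[OF r(1)] by simp
  moreover have "ln (\<rho>2 m) + m / \<delta> + 1 \<le> ln r"
    using r(1) by (subst ln_ge_iff) (auto simp: r_def)
  ultimately show False by simp
qed

section \<open>Compactness and delayed solutions\<close>

lemma uniform_limit_Pair_real:
  fixes f g :: "nat \<Rightarrow> 'a \<Rightarrow> real"
  assumes "uniform_limit X f f0 F" "uniform_limit X g g0 F"
  shows "uniform_limit X (\<lambda>n x. (f n x, g n x)) (\<lambda>x. (f0 x, g0 x)) F"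
proof (rule uniform_limitI)
  fix e :: real assume e: "0 < e"
  from e have "0 < e / 2" by simp
  from uniform_limitD[OF assms(1) this] uniform_limitD[OF assms(2) this]
  show "\<forall>\<^sub>F n in F. \<forall>x\<in>X. dist (f n x, g n x) (f0 x, g0 x) < e"
  proof (rule eventually_elim2, intro ballI)
    fix n x assume "\<forall>x\<in>X. dist (f n x) (f0 x) < e / 2" "\<forall>x\<in>X. dist (g n x) (g0 x) < e / 2" "x \<in> X"
    then have "dist (f n x) (f0 x) + dist (g n x) (g0 x) < e" by force
    moreover have "dist (f n x, g n x) (f0 x, g0 x) \<le> dist (f n x) (f0 x) + dist (g n x) (g0 x)"
      using sqrt_sum_squares_le_sum_abs[of "dist (f n x) (f0 x)" "dist (g n x) (g0 x)"] by (simp add: dist_Pair_Pair)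
    ultimately show "dist (f n x, g n x) (f0 x, g0 x) < e" by simp
  qed
qed

lemma continuous_on_Ici:
  fixes f :: "real \<Rightarrow> 'a::metric_space"
  assumes "\<And>R. 0 < R \<Longrightarrow> continuous_on {0..R} f"
  shows "continuous_on {0..} f"
  unfolding continuous_on_eq_continuous_within
proof
  fix x :: real assume x: "x \<in> {0..}"
  have "continuous (at x within {0..x + 1}) f"
    using assms[of "x + 1"] x by (simp add: continuous_on_eq_continuous_within)
  moreover have "at x within {0..x + 1} = at x within {0..}"
    by (rule at_within_nhd[of _ "{..<x + 1}"]) auto
  ultimately show "continuous (at x within {0..}) f" by (simp add: continuous_within)
qed

text \<open>A version of the Arzela-Ascoli theorem on the half line. The values at rational points are
  divided by a common bound, so that one diagonal sequence serves all of them at once; the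
  Lipschitz bounds then upgrade the convergence.\<close>

lemma locally_lipschitz_subsequence:
  fixes Z :: "nat \<Rightarrow> real \<Rightarrow> real"
  assumes B: "\<And>n. \<bar>Z n 0\<bar> \<le> B" and C: "0 \<le> C"
    and L: "\<And>n R x y. 0 \<le> x \<Longrightarrow> x \<le> y \<Longrightarrow> y \<le> R \<Longrightarrow> \<bar>Z n y - Z n x\<bar> \<le> C * R * (y - x)"
  obtains k z where "strict_mono (k :: nat \<Rightarrow> nat)" "continuous_on {0..} z"
    "\<And>R. uniform_limit {0..R} (\<lambda>n. Z (k n)) z sequentially"
proof -
  define S where "S = {x \<in> \<rat>. (0::real) \<le> x}"
  have "countable S" unfolding S_def using countable_rat by (rule countable_subset[rotated]) auto
  \<comment> \<open>a bound for all \<open>Z n x\<close>, from the Lipschitz constant on \<open>{0..x}\<close>\<close>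
  define c where "c = (\<lambda>x. 1 + B + C * x * x)"
  have B0: "0 \<le> B" using B[of 0] by linarith
  have c: "0 < c x" for x using B0 C by (simp add: c_def add_pos_nonneg mult.assoc)
  have "norm (Z n x / c x) \<le> 1" if "x \<in> S" for n x
  proof -
    have x: "0 \<le> x" using that by (simp add: S_def)
    have "\<bar>Z n x\<bar> \<le> c x" using L[of 0 x x n] B[of n] x by (simp add: c_def abs_le_iff)
    then show ?thesis using c[of x] by simp
  qed
  then obtain k where k: "strict_mono (k :: nat \<Rightarrow> nat)" "\<And>x. x \<in> S \<Longrightarrow> \<exists>l. (\<lambda>n. Z (k n) x / c x) \<longlonglongrightarrow> l"
    using function_convergent_subsequence[OF \<open>countable S\<close>, of "\<lambda>n x. Z n x / c x" 1] by blast
  have Cau: "Cauchy (\<lambda>n. Z (k n) x)" if x: "x \<in> S" for x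
  proof -
    obtain l where "(\<lambda>n. Z (k n) x / c x) \<longlonglongrightarrow> l" using k(2)[OF x] by blast
    then have "(\<lambda>n. c x * (Z (k n) x / c x)) \<longlonglongrightarrow> c x * l" by (intro tendsto_intros)
    then have "(\<lambda>n. Z (k n) x) \<longlonglongrightarrow> c x * l" using c[of x] by simp
    then show ?thesis by (rule LIMSEQ_imp_Cauchy)
  qed
  have conv: "uniformly_convergent_on {0..R} (\<lambda>n. Z (k n))" for R
  proof (rule Cauchy_uniformly_convergent, unfold uniformly_Cauchy_on_def, intro allI impI)
    fix e :: real assume e: "0 < e"
    obtain m :: nat where m: "(C * \<bar>R\<bar> + 1) / (e / 3) < real m" using reals_Archimedean2 by blast
    have "0 < (C * \<bar>R\<bar> + 1) / (e / 3)" using C e by (intro divide_pos_pos add_nonneg_pos) auto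
    then have m0: "0 < real m" using m by linarith
    have Cm: "(C * \<bar>R\<bar> + 1) / real m < e / 3" using m m0 e by (simp add: field_simps)
    define T where "T = (\<lambda>i. real i / real m) ` {..nat \<lfloor>R * m\<rfloor>}"
    have TS: "T \<subseteq> S" using m0 by (auto simp: T_def S_def)
    have "finite T" by (simp add: T_def)
    have "\<forall>t\<in>T. \<exists>M. \<forall>i\<ge>M. \<forall>j\<ge>M. dist (Z (k i) t) (Z (k j) t) < e / 3"
      using Cau TS e unfolding Cauchy_def by (metis divide_pos_pos subsetD zero_less_numeral)
    then obtain Mf where Mf: "\<And>t i j. t \<in> T \<Longrightarrow> i \<ge> Mf t \<Longrightarrow> j \<ge> Mf t \<Longrightarrow> dist (Z (k i) t) (Z (k j) t) < e / 3"
      by metis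
    define M where "M = Max (insert 0 (Mf ` T))"
    have M: "Mf t \<le> M" if "t \<in> T" for t using \<open>finite T\<close> that by (simp add: M_def)
    have "dist (Z (k i) x) (Z (k j) x) < e" if x: "x \<in> {0..R}" and ij: "i \<ge> M" "j \<ge> M" for x i j
    proof -
      define q where "q = nat \<lfloor>x * m\<rfloor>"
      define t where "t = real q / real m"
      have q: "real q \<le> x * m" "x * m < real q + 1" unfolding q_def using x m0 by auto
      have "(x - t) * m \<le> 1" using q m0 by (simp add: t_def left_diff_distrib)
      then have t: "0 \<le> t" "t \<le> x" "x - t \<le> 1 / m" using q m0 by (auto simp: t_def pos_le_divide_eq divide_le_eq)
      have "q \<le> nat \<lfloor>R * m\<rfloor>" unfolding q_def using x m0 by (intro nat_mono floor_mono mult_right_mono) auto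
      then have tT: "t \<in> T" by (auto simp: T_def t_def)
      have near: "\<bar>Z n x - Z n t\<bar> < e / 3" for n
      proof -
        have "\<bar>Z n x - Z n t\<bar> \<le> C * R * (x - t)" using t x by (intro L) auto
        also have "\<dots> \<le> C * R * (1 / m)" using t x C by (intro mult_left_mono) auto
        also have "\<dots> \<le> (C * \<bar>R\<bar> + 1) / real m" using m0 x by (simp add: field_simps)
        finally show ?thesis using Cm by linarith
      qed
      have "dist (Z (k i) t) (Z (k j) t) < e / 3" using M[OF tT] ij by (intro Mf[OF tT]) auto
      then show ?thesis using near[of "k i"] near[of "k j"] unfolding dist_real_def by linarith
    qed
    then show "\<exists>M. \<forall>x\<in>{0..R}. \<forall>i\<ge>M. \<forall>j\<ge>M. dist (Z (k i) x) (Z (k j) x) < e" by blast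
  qed
  define z where "z = (\<lambda>x. lim (\<lambda>n. Z (k n) x))"
  have lim: "uniform_limit {0..R} (\<lambda>n. Z (k n)) z sequentially" for R
    using conv[of R] unfolding uniformly_convergent_uniform_limit_iff z_def .
  have Zc: "continuous_on {0..R} (Z n)" for n R
  proof (rule continuous_onI)
    fix x e :: real assume x: "x \<in> {0..R}" and e: "0 < e"
    have CR: "0 \<le> C * R" using C x by simp
    define d where "d = e / (C * R + 1)"
    have d: "0 < d" using e CR by (simp add: d_def)
    have "dist (Z n x') (Z n x) \<le> e" if x': "x' \<in> {0..R}" "dist x' x < d" for x'
    proof -
      have "\<bar>Z n x' - Z n x\<bar> \<le> C * R * \<bar>x' - x\<bar>"
        using L[of x x' R n] L[of x' x R n] x x' by (cases "x \<le> x'") (auto simp: abs_minus_commute)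
      also have "\<dots> \<le> (C * R + 1) * d" using x' CR by (intro mult_mono) (auto simp: dist_real_def)
      also have "\<dots> = e" using CR by (simp add: d_def)
      finally show ?thesis by (simp add: dist_real_def)
    qed
    then show "\<exists>d>0. \<forall>x'\<in>{0..R}. dist x' x < d \<longrightarrow> dist (Z n x') (Z n x) \<le> e" using d by blast
  qed
  have "continuous_on {0..} z"
    by (rule continuous_on_Ici, rule uniform_limit_theorem[OF _ lim]) (auto simp: Zc)
  then show ?thesis using that[OF k(1) _ lim] by blast
qed

lemma flux_uniform_limit:
  assumes N: "0 < N" and h: "\<And>n. continuous_on {0..} (h n)" and h0: "continuous_on {0..} h0"
    and lim: "uniform_limit {0..R} h h0 sequentially"
  shows "uniform_limit {0..R} (\<lambda>n. flux N (h n)) (flux N h0) sequentially"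
proof (rule uniform_limitI)
  fix e :: real assume e: "0 < e"
  define d where "d = e / (\<bar>R\<bar> + 1) / 2"
  have d: "0 < d" using e by (simp add: d_def)
  show "\<forall>\<^sub>F n in sequentially. \<forall>x\<in>{0..R}. dist (flux N (h n) x) (flux N h0 x) < e"
    using uniform_limitD[OF lim d]
  proof (rule eventually_mono, intro ballI)
    fix n x assume n: "\<forall>x\<in>{0..R}. dist (h n x) (h0 x) < d" and x: "x \<in> {0..R}"
    have c: "continuous_on {0..x} (h n)" "continuous_on {0..x} h0"
      using continuous_on_subset[OF h[of n]] continuous_on_subset[OF h0] by auto
    have "\<bar>flux N (\<lambda>t. h n t - h0 t) x\<bar> \<le> d * x / N"
      using N x n c by (intro flux_abs_le continuous_intros) (auto simp: dist_real_def less_imp_le)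
    also have "\<dots> \<le> d * x / 1" using N d x by (intro divide_left_mono) auto
    also have "\<dots> = d * x" by simp
    also have "\<dots> \<le> d * (\<bar>R\<bar> + 1)" using d x by (intro mult_left_mono) auto
    also have "\<dots> = e / 2" using abs_ge_zero[of R] unfolding d_def by (smt (verit) nonzero_eq_divide_eq times_divide_eq_left)
    finally show "dist (flux N (h n) x) (flux N h0 x) < e"
      using e x c by (simp add: dist_real_def flux_diff)
  qed
qed

lemma potential_limit:
  assumes h: "\<And>n. continuous_on {0..} (h n)" and N: "0 < N" and h0: "continuous_on {0..} h0"
    and lim: "uniform_limit {0..r} h h0 sequentially"
  shows "(\<lambda>n. potential N a (h n) r) \<longlonglongrightarrow> potential N a h0 r"
proof -
  have fl: "uniform_limit {0..r} (\<lambda>n. flux N (h n)) (flux N h0) sequentially"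
    by (rule flux_uniform_limit[OF N h h0 lim])
  have fc: "continuous_on {0..r} (flux N (h n))" for n
    by (rule continuous_on_subset[OF continuous_on_flux[OF h]]) auto
  obtain I J where IJ: "\<And>n. (flux N (h n) has_integral I n) {0..r}"
    "(flux N h0 has_integral J) {0..r}" "(I \<longlongrightarrow> J) sequentially"
    by (rule uniform_limit_integral[OF fl fc]) auto
  then have "(\<lambda>n. integral {0..r} (flux N (h n))) \<longlonglongrightarrow> integral {0..r} (flux N h0)"
    by (simp add: integral_unique[OF IJ(1)] integral_unique[OF IJ(2)])
  then show ?thesis unfolding potential_def by (intro tendsto_intros)
qed

lemma potential_cong:
  assumes "\<And>t. 0 \<le> t \<Longrightarrow> t \<le> r \<Longrightarrow> h t = k t"
  shows "potential N a h r = potential N a k r"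
  unfolding potential_def using assms by (intro arg_cong2[where f="(-)"] integral_cong flux_cong) auto

text \<open>Picard iterates of the equation with retarded argument. The iterates agree up to radius
  \<open>m * \<delta>\<close> from the \<open>m\<close>-th one on, so a sufficiently late
  iterate solves the retarded equation on a given interval.\<close>

primrec delayed :: "nat \<Rightarrow> (real \<Rightarrow> real) \<Rightarrow> real \<Rightarrow> real \<Rightarrow> nat \<Rightarrow> real \<Rightarrow> real" where
  "delayed N g a \<delta> 0 = (\<lambda>r. a)"
| "delayed N g a \<delta> (Suc m) = potential N a (\<lambda>t. g (delayed N g a \<delta> m (max (t - \<delta>) 0)))"

lemma delayed_stable:
  assumes "0 \<le> \<delta>" "0 \<le> r" "r \<le> real m * \<delta>"
  shows "delayed N g a \<delta> (Suc m) r = delayed N g a \<delta> m r"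
  using assms(2,3)
proof (induction m arbitrary: r)
  case (Suc m)
  have "delayed N g a \<delta> (Suc m) (max (t - \<delta>) 0) = delayed N g a \<delta> m (max (t - \<delta>) 0)" if "t \<le> r" for t
    using Suc.prems that assms(1) by (intro Suc.IH) (auto simp: algebra_simps)
  then show ?case
    unfolding delayed.simps(2)[of N g a \<delta> "Suc m"] delayed.simps(2)[of N g a \<delta> m]
    by (intro potential_cong) simp
qed simp

locale continuous_family =
  fixes N :: nat and g :: "real \<Rightarrow> real \<Rightarrow> real" and a A0 A1 M :: real
  assumes N: "N > 2" and A: "A0 \<le> A1"
    and joint: "continuous_on ({A0..A1} \<times> UNIV) (\<lambda>(c, s). g c s)"
    and bounded: "\<And>c s. c \<in> {A0..A1} \<Longrightarrow> \<bar>g c s\<bar> \<le> M"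
    and g_0: "\<And>c s. c \<in> {A0..A1} \<Longrightarrow> s \<le> 0 \<Longrightarrow> g c s = 0"
begin

lemma M: "0 \<le> M"
  using bounded[of A0 0] A by auto

lemma delayed_source_cont:
  fixes D :: "real \<Rightarrow> real \<Rightarrow> real" and \<delta> :: real
  assumes "continuous_on ({A0..A1} \<times> {0..}) (\<lambda>(c, r). D c r)"
  shows "continuous_on ({A0..A1} \<times> {0..}) (\<lambda>(c, t). g c (D c (max (t - \<delta>) 0)))"
  unfolding case_prod_beta
  by (intro continuous_on_compose2[OF joint, of _ "\<lambda>p. (fst p, D (fst p) (max (snd p - \<delta>) 0))", simplified]
      continuous_intros continuous_on_compose2[OF assms, of _ "\<lambda>p. (fst p, max (snd p - \<delta>) 0)", simplified]) auto

lemma delayed_cont: "continuous_on ({A0..A1} \<times> {0..}) (\<lambda>(c, r). delayed N (g c) a \<delta> m r)"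
proof (induction m)
  case (Suc m)
  show ?case unfolding delayed.simps by (rule continuous_on_potential_param[OF delayed_source_cont[OF Suc]])
qed (auto simp: case_prod_beta)

text \<open>The \<open>n\<close>-th approximation uses the delay \<open>1 / (n + 1)\<close> and the
  iterate with number \<open>(n + 1)\<^sup>2\<close>, so that it solves the retarded equation
  up to radius \<open>n + 1\<close>.\<close>

definition del :: "nat \<Rightarrow> real" where "del n = 1 / real (Suc n)"

definition src :: "nat \<Rightarrow> real \<Rightarrow> real \<Rightarrow> real" where
  "src n c t = g c (delayed N (g c) a (del n) (Suc n * Suc n) (max (t - del n) 0))"

definition y :: "nat \<Rightarrow> real \<Rightarrow> real \<Rightarrow> real" where
  "y n c = potential N a (src n c)"

abbreviation v :: "nat \<Rightarrow> real \<Rightarrow> real \<Rightarrow> real" where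
  "v n c \<equiv> flux N (src n c)"

lemma del: "0 < del n" "del n \<le> 1"
  by (auto simp: del_def)

lemma del_lim: "del \<longlonglongrightarrow> 0"
  unfolding del_def[abs_def] using LIMSEQ_inverse_real_of_nat by (simp add: inverse_eq_divide)

lemma src_joint: "continuous_on ({A0..A1} \<times> {0..}) (\<lambda>(c, t). src n c t)"
  unfolding src_def by (rule delayed_source_cont[OF delayed_cont])

lemma src_cont: "c \<in> {A0..A1} \<Longrightarrow> continuous_on {0..} (src n c)"
  using continuous_on_compose2[OF src_joint, of "{0..}" "Pair c" n] by (force simp: continuous_on_Pair)

lemma y_joint: "continuous_on ({A0..A1} \<times> {0..}) (\<lambda>(c, t). y n c t)"
  unfolding y_def by (rule continuous_on_potential_param[OF src_joint])

lemma v_joint: "continuous_on ({A0..A1} \<times> {0..}) (\<lambda>(c, t). v n c t)"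
  by (rule continuous_on_flux_param[OF src_joint])

lemma y_0: "y n c 0 = a"
  by (simp add: y_def)

lemma src_bounded: "c \<in> {A0..A1} \<Longrightarrow> \<bar>src n c t\<bar> \<le> M"
  unfolding src_def by (rule bounded)

lemma src_eq:
  assumes "t \<le> real (Suc n)" shows "src n c t = g c (y n c (max (t - del n) 0))"
proof -
  have "max (t - del n) 0 \<le> real (Suc n * Suc n) * del n"
  proof -
    have "real (Suc n * Suc n) * del n = real (Suc n)" by (simp only: del_def of_nat_mult) simp
    then show ?thesis using assms del(1)[of n] by simp
  qed
  then have "delayed N (g c) a (del n) (Suc (Suc n * Suc n)) (max (t - del n) 0)
      = delayed N (g c) a (del n) (Suc n * Suc n) (max (t - del n) 0)"
    using del[of n] by (intro delayed_stable) auto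
  then show ?thesis by (simp add: src_def[abs_def] y_def del: mult_Suc)
qed

lemma y_lipschitz:
  assumes c: "c \<in> {A0..A1}" and "0 \<le> s" "s \<le> t" "t \<le> R"
  shows "\<bar>y n c t - y n c s\<bar> \<le> M * R * (t - s)"
proof -
  have "\<bar>y n c t - y n c s\<bar> \<le> M * R / N * \<bar>t - s\<bar>"
    unfolding y_def using N assms by (intro potential_lipschitz src_cont src_bounded) auto
  also have "\<dots> \<le> M * R * \<bar>t - s\<bar>"
  proof (rule mult_right_mono)
    have "0 \<le> M * R" using M assms by simp
    then have "M * R / N \<le> M * R / 1" using N by (intro divide_left_mono) auto
    then show "M * R / N \<le> M * R" by simp
  qed simp
  finally show ?thesis using assms by simp
qed

lemma joint_compact: "compact K \<Longrightarrow> K \<subseteq> {A0..A1} \<times> UNIV \<Longrightarrow> uniformly_continuous_on K (\<lambda>(c, s). g c s)"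
  by (intro compact_uniformly_continuous continuous_on_subset[OF joint])

text \<open>Bounded sources make the delayed solutions locally Lipschitz, uniformly in \<open>n\<close>;
  in the limit the delay disappears. The indices \<open>j\<close> allow the lemma to be
  applied to subsequences.\<close>

lemma delay_limit:
  assumes j: "strict_mono (j :: nat \<Rightarrow> nat)" and c: "\<And>n. c n \<in> {A0..A1}"
  obtains k c0 u where "strict_mono (k :: nat \<Rightarrow> nat)" "c0 \<in> {A0..A1}" "(\<lambda>n. c (k n)) \<longlonglongrightarrow> c0"
    "radial_sol N (g c0) a u"
    "\<forall>R. uniform_limit {0..R} (\<lambda>n. y (j (k n)) (c (k n))) u sequentially"
    "\<forall>R. uniform_limit {0..R} (\<lambda>n. v (j (k n)) (c (k n))) (flux N (\<lambda>t. g c0 (u t))) sequentially"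
proof -
  obtain c0 k1 where k1: "c0 \<in> {A0..A1}" "strict_mono (k1 :: nat \<Rightarrow> nat)" "(c \<circ> k1) \<longlonglongrightarrow> c0"
    using c compact_Icc[of A0 A1] unfolding compact_def by (metis (no_types, lifting))
  obtain k2 u where k2: "strict_mono (k2 :: nat \<Rightarrow> nat)" and u: "continuous_on {0..} u"
    and ulim: "\<And>R. uniform_limit {0..R} (\<lambda>n. (\<lambda>n. y (j (k1 n)) (c (k1 n))) (k2 n)) u sequentially"
  proof (rule locally_lipschitz_subsequence[of "\<lambda>n. y (j (k1 n)) (c (k1 n))" "\<bar>a\<bar>" M])
    show "\<bar>y (j (k1 n)) (c (k1 n)) t - y (j (k1 n)) (c (k1 n)) s\<bar> \<le> M * R * (t - s)"
      if "0 \<le> s" "s \<le> t" "t \<le> R" for n R s t using y_lipschitz[OF c that] .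
  qed (auto simp: y_0 M)
  define k where "k = k1 \<circ> k2"
  have k: "strict_mono k" unfolding k_def using k1 k2 by (simp add: strict_mono_o)
  have ulim: "uniform_limit {0..R} (\<lambda>n. y (j (k n)) (c (k n))) u sequentially" for R
    using ulim[of R] by (simp add: k_def)
  have clim: "(\<lambda>n. c (k n)) \<longlonglongrightarrow> c0"
    using LIMSEQ_subseq_LIMSEQ[OF k1(3) k2] by (simp add: k_def o_def)
  have jk: "strict_mono (\<lambda>n. j (k n))" using j k by (simp add: strict_mono_def)
  have dlim: "(\<lambda>n. del (j (k n))) \<longlonglongrightarrow> 0"
    using LIMSEQ_subseq_LIMSEQ[OF del_lim jk] by (simp add: o_def)
  have hc: "continuous_on {0..} (\<lambda>t. g c0 (u t))"
    by (intro continuous_on_compose2[OF joint, of _ "\<lambda>t. (c0, u t)", simplified] continuous_intros u) (use k1 in auto)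
  have src_lim: "uniform_limit {0..R} (\<lambda>n. src (j (k n)) (c (k n))) (\<lambda>t. g c0 (u t)) sequentially" for R
  proof -
    define B where "B = \<bar>a\<bar> + M * \<bar>R\<bar> * \<bar>R\<bar>"
    let ?Y = "\<lambda>n t. y (j (k n)) (c (k n)) (max (t - del (j (k n))) 0)"
    have Ylim: "uniform_limit {0..R} ?Y u sequentially"
    proof (rule uniform_limitI)
      fix e :: real assume e: "0 < e"
      have "(\<lambda>n. M * R * del (j (k n))) \<longlonglongrightarrow> M * R * 0" by (intro tendsto_intros dlim)
      then have "\<forall>\<^sub>F n in sequentially. M * R * del (j (k n)) < e / 2"
        using e by (intro order_tendstoD(2)) auto
      moreover have "\<forall>\<^sub>F n in sequentially. \<forall>t\<in>{0..R}. dist (y (j (k n)) (c (k n)) t) (u t) < e / 2"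
        using uniform_limitD[OF ulim, of "e / 2"] e by simp
      ultimately show "\<forall>\<^sub>F n in sequentially. \<forall>t\<in>{0..R}. dist (?Y n t) (u t) < e"
      proof (rule eventually_elim2, intro ballI)
        fix n t assume n: "M * R * del (j (k n)) < e / 2"
          "\<forall>t\<in>{0..R}. dist (y (j (k n)) (c (k n)) t) (u t) < e / 2" and t: "t \<in> {0..R}"
        let ?t = "max (t - del (j (k n))) 0"
        have "\<bar>y (j (k n)) (c (k n)) t - y (j (k n)) (c (k n)) ?t\<bar> \<le> M * R * (t - ?t)"
          using t del(1)[of "j (k n)"] by (intro y_lipschitz c) auto
        also have "\<dots> \<le> M * R * del (j (k n))" using M t by (intro mult_left_mono) auto
        finally show "dist (?Y n t) (u t) < e"
          using n(1) bspec[OF n(2) t] unfolding dist_real_def by linarith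
      qed
    qed
    have clim': "uniform_limit {0..R} (\<lambda>n t. c (k n)) (\<lambda>t. c0) sequentially"
      using clim by (auto simp: uniform_limit_iff tendsto_iff elim: eventually_mono)
    have K: "uniformly_continuous_on ({A0..A1} \<times> {-B..B}) (\<lambda>(c, s). g c s)"
      by (intro joint_compact compact_Times) auto
    have "?Y n t \<in> {-B..B}" if t: "t \<in> {0..R}" for n t
    proof -
      let ?t = "max (t - del (j (k n))) 0"
      have "\<bar>y (j (k n)) (c (k n)) ?t - y (j (k n)) (c (k n)) 0\<bar> \<le> M * R * (?t - 0)"
        using t del(1)[of "j (k n)"] by (intro y_lipschitz c) auto
      also have "\<dots> \<le> M * \<bar>R\<bar> * \<bar>R\<bar>"
        using t M del(1)[of "j (k n)"] by (intro mult_mono) auto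
      finally show ?thesis unfolding y_0 B_def by auto
    qed
    then have "uniform_limit {0..R} (\<lambda>n t. (\<lambda>(c, s). g c s) (c (k n), ?Y n t)) (\<lambda>t. (\<lambda>(c, s). g c s) (c0, u t)) sequentially"
      using c by (intro uniform_limit_compose_uniformly_continuous_on[OF uniform_limit_Pair_real[OF clim' Ylim] K] closed_Times) auto
    then have lim: "uniform_limit {0..R} (\<lambda>n t. g (c (k n)) (?Y n t)) (\<lambda>t. g c0 (u t)) sequentially" by simp
    have ev: "\<forall>\<^sub>F n in sequentially. \<forall>t\<in>{0..R}. g (c (k n)) (?Y n t) = src (j (k n)) (c (k n)) t"
    proof -
      obtain n0 :: nat where n0: "R \<le> real n0" using real_arch_simple by blast
      show ?thesis unfolding eventually_sequentially
      proof (intro exI[of _ n0] allI impI ballI)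
        fix n t assume "n0 \<le> n" "t \<in> {0..R}"
        moreover have "n \<le> j (k n)" using jk by (rule strict_mono_imp_increasing)
        ultimately show "g (c (k n)) (?Y n t) = src (j (k n)) (c (k n)) t"
          using n0 by (intro src_eq[symmetric]) auto
      qed
    qed
    show ?thesis by (rule uniform_limit_cong[THEN iffD1, OF ev _ lim]) simp
  qed
  have vlim: "uniform_limit {0..R} (\<lambda>n. v (j (k n)) (c (k n))) (flux N (\<lambda>t. g c0 (u t))) sequentially" for R
    using N by (intro flux_uniform_limit src_cont c hc src_lim) auto
  have "u r = potential N a (\<lambda>t. g c0 (u t)) r" if r: "0 \<le> r" for r
  proof (rule LIMSEQ_unique)
    show "(\<lambda>n. y (j (k n)) (c (k n)) r) \<longlonglongrightarrow> u r"
      using tendsto_uniform_limitI[OF ulim[of r]] r by simp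
    show "(\<lambda>n. y (j (k n)) (c (k n)) r) \<longlonglongrightarrow> potential N a (\<lambda>t. g c0 (u t)) r"
      unfolding y_def using N by (intro potential_limit src_cont c hc src_lim) auto
  qed
  then have "radial_sol N (g c0) a u" using u by (simp add: radial_sol_def)
  from that[OF k k1(1) clim this] show ?thesis using ulim vlim by blast
qed

end

section \<open>Shooting without uniqueness\<close>

locale shooting_family = continuous_family +
  fixes b :: real
  assumes transversal: "\<And>c u. c \<in> {A0..A1} \<Longrightarrow> radial_sol N (g c) a u \<Longrightarrow> transversal_shot N (g c) b a u"
begin

lemma primitive_joint: "continuous_on ({A0..A1} \<times> UNIV) (\<lambda>(c, s). primitive (g c) s)"
proof -
  have "continuous_on (({A0..A1} \<times> UNIV) \<times> cbox 0 (1::real)) (\<lambda>(q, x). g (fst q) (max (snd q) 0 * x))"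
    unfolding case_prod_beta
    by (intro continuous_on_compose2[OF joint, of _ "\<lambda>p. (fst (fst p), max (snd (fst p)) 0 * snd p)", simplified]
        continuous_intros) auto
  then have "continuous_on ({A0..A1} \<times> UNIV) (\<lambda>q. integral (cbox 0 1) (\<lambda>x. g (fst q) (max (snd q) 0 * x)))"
    by (rule integral_continuous_on_param)
  then have 1: "continuous_on ({A0..A1} \<times> UNIV) (\<lambda>q. max (snd q) 0 * integral {0..1} (\<lambda>x. g (fst q) (max (snd q) 0 * x)))"
    by (intro continuous_intros) simp
  have 2: "primitive (g c) s = max s 0 * integral {0..1} (\<lambda>x. g c (max s 0 * x))" if c: "c \<in> {A0..A1}" for c s
  proof (cases "0 \<le> s")
    case True
    have "continuous_on UNIV (\<lambda>s. g c s)"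
      by (intro continuous_on_compose2[OF joint, of _ "\<lambda>s. (c, s)", simplified] continuous_intros) (use c in auto)
    then have "continuous_on {0..s} (g c)" by (rule continuous_on_subset) simp
    then show ?thesis unfolding primitive_def using integral_rescale[OF True] True by simp
  qed (auto simp: primitive_def max_def)
  show ?thesis by (rule continuous_on_eq[OF 1]) (auto simp: 2)
qed

definition energy :: "nat \<Rightarrow> real \<Rightarrow> real \<Rightarrow> real" where
  "energy n c r = (v n c r)\<^sup>2 / 2 + primitive (g c) (y n c r)"

lemma energy_joint: "continuous_on ({A0..A1} \<times> {0..}) (\<lambda>(c, r). energy n c r)"
proof -
  have "continuous_on ({A0..A1} \<times> {0..}) (\<lambda>p. (case p of (c, r) \<Rightarrow> v n c r)\<^sup>2 / 2
      + (case (fst p, case p of (c, r) \<Rightarrow> y n c r) of (c, s) \<Rightarrow> primitive (g c) s))"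
    by (intro continuous_intros v_joint y_joint continuous_on_compose2[OF primitive_joint]) auto
  then show ?thesis unfolding energy_def case_prod_beta by simp
qed

lemma energy_limit:
  assumes c: "\<And>n. c n \<in> {A0..A1}" "c0 \<in> {A0..A1}" "c \<longlonglongrightarrow> c0" and u: "radial_sol N (g c0) a u"
    and ylim: "uniform_limit {0..R} (\<lambda>n. y (j n) (c n)) u sequentially"
    and vlim: "uniform_limit {0..R} (\<lambda>n. v (j n) (c n)) (flux N (\<lambda>t. g c0 (u t))) sequentially"
  shows "uniform_limit {0..R} (\<lambda>n. energy (j n) (c n)) (shot.E N (g c0) u) sequentially"
proof -
  interpret T: transversal_shot N "g c0" b a u using transversal[OF c(2) u] .
  define B where "B = \<bar>a\<bar> + M * \<bar>R\<bar> * \<bar>R\<bar>"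
  have clim: "uniform_limit {0..R} (\<lambda>n t. c n) (\<lambda>t. c0) sequentially"
    using c(3) by (auto simp: uniform_limit_iff tendsto_iff elim: eventually_mono)
  have K: "uniformly_continuous_on ({A0..A1} \<times> {-B..B}) (\<lambda>(c, s). primitive (g c) s)"
    by (intro compact_uniformly_continuous continuous_on_subset[OF primitive_joint] compact_Times) auto
  have "y (j n) (c n) t \<in> {-B..B}" if t: "t \<in> {0..R}" for n t
  proof -
    have "\<bar>y (j n) (c n) t - y (j n) (c n) 0\<bar> \<le> M * R * (t - 0)"
      using t by (intro y_lipschitz c) auto
    also have "\<dots> \<le> M * \<bar>R\<bar> * \<bar>R\<bar>" using t M by (intro mult_mono) auto
    finally show ?thesis unfolding y_0 B_def by auto
  qed
  then have "uniform_limit {0..R} (\<lambda>n t. (\<lambda>(c, s). primitive (g c) s) (c n, y (j n) (c n) t))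
      (\<lambda>t. (\<lambda>(c, s). primitive (g c) s) (c0, u t)) sequentially"
    using c by (intro uniform_limit_compose_uniformly_continuous_on[OF uniform_limit_Pair_real[OF clim ylim] K] closed_Times) auto
  then have 1: "uniform_limit {0..R} (\<lambda>n t. primitive (g (c n)) (y (j n) (c n) t)) (\<lambda>t. primitive (g c0) (u t)) sequentially"
    by simp
  have bnd: "\<bar>v (j n) (c n) t\<bar> \<le> M * \<bar>R\<bar>" if t: "t \<in> {0..R}" for n t
  proof -
    have "\<bar>v (j n) (c n) t\<bar> \<le> M * t / N"
      using t N by (intro flux_abs_le continuous_on_subset[OF src_cont[OF c(1)]] src_bounded c) auto
    also have "\<dots> \<le> M * t / 1" using N t M by (intro divide_left_mono) auto
    also have "\<dots> \<le> M * \<bar>R\<bar>" using t M by (simp add: mult_left_mono)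
    finally show ?thesis .
  qed
  have "uniformly_continuous_on {- (M * \<bar>R\<bar>)..M * \<bar>R\<bar>} (\<lambda>x. x\<^sup>2 / 2)"
    by (intro compact_uniformly_continuous continuous_intros) auto
  then have 2: "uniform_limit {0..R} (\<lambda>n t. (v (j n) (c n) t)\<^sup>2 / 2) (\<lambda>t. (T.V t)\<^sup>2 / 2) sequentially"
    using bnd by (intro uniform_limit_compose_uniformly_continuous_on[OF vlim, of _ "\<lambda>x. x\<^sup>2 / 2"])
       (auto simp: abs_le_iff minus_le_iff)
  show ?thesis
    using uniform_limit_add[OF 2 1] unfolding energy_def T.E_def[abs_def] .
qed

text \<open>The two approximate outcomes. A delayed solution need not obey the energy law, so the outcomes
  are made exclusive by asking which of the two thresholds \<open>- del n\<close> is passed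
  first; strict inequalities on compact intervals make both sets open.\<close>

definition energy_first :: "nat \<Rightarrow> real set" where
  "energy_first n = {c \<in> {A0..A1}. \<exists>r\<in>{0..real (Suc n)}. energy n c r < - del n \<and> (\<forall>t\<in>{0..r}. - del n < y n c t)}"

definition zero_first :: "nat \<Rightarrow> real set" where
  "zero_first n = {c \<in> {A0..A1}. \<exists>r\<in>{0..real (Suc n)}. y n c r < - del n \<and> (\<forall>t\<in>{0..r}. - del n < energy n c t)}"

lemma disjoint: "energy_first n \<inter> zero_first n = {}"
proof (intro equals0I, elim IntE)
  fix c assume "c \<in> energy_first n" "c \<in> zero_first n"
  then obtain r r' where r: "0 \<le> r" "energy n c r < - del n" "\<And>t. 0 \<le> t \<Longrightarrow> t \<le> r \<Longrightarrow> - del n < y n c t"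
    and r': "0 \<le> r'" "y n c r' < - del n" "\<And>t. 0 \<le> t \<Longrightarrow> t \<le> r' \<Longrightarrow> - del n < energy n c t"
    unfolding energy_first_def zero_first_def by auto
  have "\<not> r \<le> r'" using r'(3)[OF r(1)] r(2) by linarith
  moreover have "\<not> r' \<le> r" using r(3)[OF r'(1)] r'(2) by linarith
  ultimately show False by linarith
qed

lemma hit_first_open:
  fixes f1 f2 :: "real \<Rightarrow> real \<Rightarrow> real"
  assumes f1: "continuous_on ({A0..A1} \<times> {0..}) (\<lambda>(c, r). f1 c r)"
    and f2: "continuous_on ({A0..A1} \<times> {0..}) (\<lambda>(c, r). f2 c r)"
  shows "openin (top_of_set {A0..A1}) {c \<in> {A0..A1}. \<exists>r\<in>{0..T}. f1 c r < q \<and> (\<forall>t\<in>{0..r}. q < f2 c t)}"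
  unfolding openin_euclidean_subtopology_iff
proof (intro conjI ballI)
  fix c assume "c \<in> {c \<in> {A0..A1}. \<exists>r\<in>{0..T}. f1 c r < q \<and> (\<forall>t\<in>{0..r}. q < f2 c t)}"
  then obtain r where c: "c \<in> {A0..A1}" and r: "0 \<le> r" "r \<le> T" "f1 c r < q" "\<And>t. t \<in> {0..r} \<Longrightarrow> q < f2 c t"
    by auto
  have "continuous_on {0..r} (f2 c)"
    using continuous_on_compose2[OF f2, of "{0..r}" "Pair c"] c by (force simp: continuous_on_Pair)
  then obtain t0 where t0: "t0 \<in> {0..r}" "\<And>t. t \<in> {0..r} \<Longrightarrow> f2 c t0 \<le> f2 c t"
    using continuous_attains_inf[OF compact_Icc, of 0 r "f2 c"] r by auto
  define e where "e = min (q - f1 c r) (f2 c t0 - q)"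
  have e: "0 < e" using r t0 by (simp add: e_def)
  have u1: "uniformly_continuous_on ({A0..A1} \<times> {0..r}) (\<lambda>(c, r). f1 c r)"
    and u2: "uniformly_continuous_on ({A0..A1} \<times> {0..r}) (\<lambda>(c, r). f2 c r)"
    by (intro compact_uniformly_continuous continuous_on_subset[OF f1] continuous_on_subset[OF f2] compact_Times; auto)+
  obtain d1 where d1: "d1 > 0" "\<And>p p'. p \<in> {A0..A1} \<times> {0..r} \<Longrightarrow> p' \<in> {A0..A1} \<times> {0..r} \<Longrightarrow> dist p' p < d1 \<Longrightarrow>
     dist (case p' of (c, r) \<Rightarrow> f1 c r) (case p of (c, r) \<Rightarrow> f1 c r) < e"
    using u1 e unfolding uniformly_continuous_on_def by metis
  obtain d2 where d2: "d2 > 0" "\<And>p p'. p \<in> {A0..A1} \<times> {0..r} \<Longrightarrow> p' \<in> {A0..A1} \<times> {0..r} \<Longrightarrow> dist p' p < d2 \<Longrightarrow>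
     dist (case p' of (c, r) \<Rightarrow> f2 c r) (case p of (c, r) \<Rightarrow> f2 c r) < e"
    using u2 e unfolding uniformly_continuous_on_def by metis
  have "c' \<in> {c \<in> {A0..A1}. \<exists>r\<in>{0..T}. f1 c r < q \<and> (\<forall>t\<in>{0..r}. q < f2 c t)}"
    if c': "c' \<in> {A0..A1}" "dist c' c < min d1 d2" for c'
  proof -
    have dd: "dist (c', t) (c, t) = dist c' c" for t :: real by (simp add: dist_Pair_Pair)
    have "dist (f1 c' r) (f1 c r) < e" using d1(2)[of "(c, r)" "(c', r)"] c c' r dd by simp
    then have 1: "f1 c' r < q" unfolding dist_real_def e_def by linarith
    have 2: "q < f2 c' t" if t: "t \<in> {0..r}" for t
    proof -
      have "dist (f2 c' t) (f2 c t) < e" using d2(2)[of "(c, t)" "(c', t)"] c c' t dd by simp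
      then show ?thesis using t0(2)[OF t] unfolding dist_real_def e_def by linarith
    qed
    show ?thesis using c'(1) r 1 2 by auto
  qed
  then show "\<exists>e>0. \<forall>x'\<in>{A0..A1}. dist x' c < e \<longrightarrow>
      x' \<in> {c \<in> {A0..A1}. \<exists>r\<in>{0..T}. f1 c r < q \<and> (\<forall>t\<in>{0..r}. q < f2 c t)}"
    using d1 d2 by (intro exI[of _ "min d1 d2"]) auto
qed auto

text \<open>A true solution with negative energy is bounded away from 0 up to that radius, so its
  approximations pass the energy threshold before the other one.\<close>

lemma energy_first_eventually:
  assumes c: "\<And>n. c n \<in> {A0..A1}" "c0 \<in> {A0..A1}" "c \<longlonglongrightarrow> c0" and u: "radial_sol N (g c0) a u"
    and j: "strict_mono (j :: nat \<Rightarrow> nat)"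
    and ylim: "\<And>R. uniform_limit {0..R} (\<lambda>n. y (j n) (c n)) u sequentially"
    and vlim: "\<And>R. uniform_limit {0..R} (\<lambda>n. v (j n) (c n)) (flux N (\<lambda>t. g c0 (u t))) sequentially"
    and r: "0 \<le> r" "shot.E N (g c0) u r < 0"
  shows "\<forall>\<^sub>F n in sequentially. c n \<in> energy_first (j n)"
proof -
  interpret T: transversal_shot N "g c0" b a u using transversal[OF c(2) u] .
  have elim: "uniform_limit {0..r} (\<lambda>n. energy (j n) (c n)) T.E sequentially"
    by (rule energy_limit[OF c u ylim vlim])
  have pos: "0 < u t" if "0 \<le> t" "t \<le> r" for t
    by (rule T.positive_before_negative_energy[OF r(2) that])
  have "continuous_on {0..r} u" by (rule continuous_on_subset[OF T.u_cont]) auto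
  then obtain t0 where t0: "t0 \<in> {0..r}" "\<And>t. t \<in> {0..r} \<Longrightarrow> u t0 \<le> u t"
    using continuous_attains_inf[OF compact_Icc, of 0 r u] r by auto
  have "0 < u t0" using pos t0 by auto
  then have 1: "\<forall>\<^sub>F n in sequentially. \<forall>t\<in>{0..r}. dist (y (j n) (c n) t) (u t) < u t0"
    by (rule uniform_limitD[OF ylim])
  have 2: "\<forall>\<^sub>F n in sequentially. \<forall>t\<in>{0..r}. dist (energy (j n) (c n) t) (T.E t) < - T.E r / 2"
    using r by (intro uniform_limitD[OF elim]) auto
  have "(\<lambda>n. del (j n)) \<longlonglongrightarrow> 0" using LIMSEQ_subseq_LIMSEQ[OF del_lim j] by (simp add: o_def)
  then have 3: "\<forall>\<^sub>F n in sequentially. del (j n) < - T.E r / 2"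
    using r by (intro order_tendstoD(2)) auto
  obtain n0 :: nat where n0: "r \<le> real n0" using real_arch_simple by blast
  have 4: "\<forall>\<^sub>F n in sequentially. r \<le> real (Suc (j n))"
    unfolding eventually_sequentially
  proof (intro exI[of _ n0] allI impI)
    fix n assume "n0 \<le> n"
    then have "n0 \<le> j n" using strict_mono_imp_increasing[OF j, of n] by simp
    then show "r \<le> real (Suc (j n))" using n0 by simp
  qed
  show ?thesis using eventually_conj[OF eventually_conj[OF 1 2] eventually_conj[OF 3 4]]
  proof (rule eventually_mono)
    fix n assume n: "((\<forall>t\<in>{0..r}. dist (y (j n) (c n) t) (u t) < u t0) \<and>
      (\<forall>t\<in>{0..r}. dist (energy (j n) (c n) t) (T.E t) < - T.E r / 2)) \<and> del (j n) < - T.E r / 2 \<and> r \<le> real (Suc (j n))"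
    have "dist (energy (j n) (c n) r) (T.E r) < - T.E r / 2" using n r by auto
    then have "energy (j n) (c n) r < - del (j n)" using n unfolding dist_real_def by linarith
    moreover have "- del (j n) < y (j n) (c n) t" if t: "t \<in> {0..r}" for t
    proof -
      have "dist (y (j n) (c n) t) (u t) < u t0" using n t by auto
      then have "0 < y (j n) (c n) t" using t0(2)[OF t] unfolding dist_real_def by linarith
      then show ?thesis using del(1)[of "j n"] by linarith
    qed
    ultimately show "c n \<in> energy_first (j n)" unfolding energy_first_def using c(1) n r by auto
  qed
qed

text \<open>Up to the crossing, and shortly after it, the energy of the true solution is bounded below by
  a positive constant.\<close>

lemma zero_first_eventually:
  assumes c: "\<And>n. c n \<in> {A0..A1}" "c0 \<in> {A0..A1}" "c \<longlonglongrightarrow> c0" and u: "radial_sol N (g c0) a u"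
    and j: "strict_mono (j :: nat \<Rightarrow> nat)"
    and ylim: "\<And>R. uniform_limit {0..R} (\<lambda>n. y (j n) (c n)) u sequentially"
    and vlim: "\<And>R. uniform_limit {0..R} (\<lambda>n. v (j n) (c n)) (flux N (\<lambda>t. g c0 (u t))) sequentially"
    and r0: "0 \<le> r0" "u r0 < 0"
  shows "\<forall>\<^sub>F n in sequentially. c n \<in> zero_first (j n)"
proof -
  interpret T: transversal_shot N "g c0" b a u using transversal[OF c(2) u] .
  obtain r where r: "0 < r" "u r < 0" "0 < T.E r"
    using T.positive_energy_before_crossing[OF r0(2,1)] by blast
  have elim: "uniform_limit {0..r} (\<lambda>n. energy (j n) (c n)) T.E sequentially"
    by (rule energy_limit[OF c u ylim vlim])
  have 1: "\<forall>\<^sub>F n in sequentially. \<forall>t\<in>{0..r}. dist (energy (j n) (c n) t) (T.E t) < T.E r"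
    using r by (intro uniform_limitD[OF elim]) auto
  have 2: "\<forall>\<^sub>F n in sequentially. \<forall>t\<in>{0..r}. dist (y (j n) (c n) t) (u t) < - u r / 2"
    using r by (intro uniform_limitD[OF ylim]) auto
  have "(\<lambda>n. del (j n)) \<longlonglongrightarrow> 0" using LIMSEQ_subseq_LIMSEQ[OF del_lim j] by (simp add: o_def)
  then have 3: "\<forall>\<^sub>F n in sequentially. del (j n) < - u r / 2"
    using r by (intro order_tendstoD(2)) auto
  obtain n0 :: nat where n0: "r \<le> real n0" using real_arch_simple by blast
  have 4: "\<forall>\<^sub>F n in sequentially. r \<le> real (Suc (j n))"
    unfolding eventually_sequentially
  proof (intro exI[of _ n0] allI impI)
    fix n assume "n0 \<le> n"
    then have "n0 \<le> j n" using strict_mono_imp_increasing[OF j, of n] by simp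
    then show "r \<le> real (Suc (j n))" using n0 by simp
  qed
  show ?thesis using eventually_conj[OF eventually_conj[OF 1 2] eventually_conj[OF 3 4]]
  proof (rule eventually_mono)
    fix n assume n: "((\<forall>t\<in>{0..r}. dist (energy (j n) (c n) t) (T.E t) < T.E r) \<and>
      (\<forall>t\<in>{0..r}. dist (y (j n) (c n) t) (u t) < - u r / 2)) \<and> del (j n) < - u r / 2 \<and> r \<le> real (Suc (j n))"
    have "dist (y (j n) (c n) r) (u r) < - u r / 2" using n r by auto
    then have "y (j n) (c n) r < - del (j n)" using n unfolding dist_real_def by linarith
    moreover have "- del (j n) < energy (j n) (c n) t" if t: "t \<in> {0..r}" for t
    proof -
      have "dist (energy (j n) (c n) t) (T.E t) < T.E r" using n t by auto
      moreover have "T.E r \<le> T.E t" using t by (intro T.E_antimono) auto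
      ultimately have "0 < energy (j n) (c n) t" unfolding dist_real_def by linarith
      then show ?thesis using del(1)[of "j n"] by linarith
    qed
    ultimately show "c n \<in> zero_first (j n)" unfolding zero_first_def using c(1) n r by auto
  qed
qed

text \<open>If the conclusion failed for infinitely many \<open>n\<close>, \<open>delay_limit\<close>
  along these \<open>n\<close> would produce a true solution to which the premise applies.\<close>

lemma constant_parameter_eventually:
  assumes c: "c \<in> {A0..A1}"
    and X: "\<And>j u. strict_mono (j :: nat \<Rightarrow> nat) \<Longrightarrow> radial_sol N (g c) a u \<Longrightarrow>
      (\<And>R. uniform_limit {0..R} (\<lambda>n. y (j n) c) u sequentially) \<Longrightarrow>
      (\<And>R. uniform_limit {0..R} (\<lambda>n. v (j n) c) (flux N (\<lambda>t. g c (u t))) sequentially) \<Longrightarrow>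
      \<forall>\<^sub>F n in sequentially. X (j n)"
  shows "\<forall>\<^sub>F n in sequentially. X n"
proof (rule ccontr)
  assume "\<not> ?thesis"
  then have "\<exists>\<^sub>\<infinity>n. \<not> X n" by (simp add: not_eventually frequently_sequentially INFM_nat_le)
  then have inf: "infinite {n. \<not> X n}" by (simp add: INFM_iff_infinite)
  define j where "j = enumerate {n. \<not> X n}"
  have j: "strict_mono j" unfolding j_def by (rule strict_mono_enumerate[OF inf])
  have jX: "\<not> X (j n)" for n using enumerate_in_set[OF inf, of n] by (simp add: j_def)
  obtain k c0 u where k: "strict_mono (k :: nat \<Rightarrow> nat)" and "c0 \<in> {A0..A1}" and c0: "(\<lambda>n. c) \<longlonglongrightarrow> c0"
    and u: "radial_sol N (g c0) a u"
    and lims: "\<forall>R. uniform_limit {0..R} (\<lambda>n. y (j (k n)) c) u sequentially"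
    "\<forall>R. uniform_limit {0..R} (\<lambda>n. v (j (k n)) c) (flux N (\<lambda>t. g c0 (u t))) sequentially"
    by (rule delay_limit[OF j c])
  have "c0 = c" using LIMSEQ_unique[OF c0 tendsto_const] by simp
  have jk: "strict_mono (\<lambda>n. j (k n))" using j k by (simp add: strict_mono_def)
  have "\<forall>\<^sub>F n in sequentially. X (j (k n))"
    using u lims[rule_format] unfolding \<open>c0 = c\<close> by (rule X[OF jk])
  then show False using jX by (simp add: eventually_sequentially)
qed

text \<open>For large \<open>n\<close> the sets \<open>zero_first n\<close> and \<open>energy_first
  n\<close> are disjoint, relatively open in \<open>{A0..A1}\<close> and nonempty, so some
  parameter lies in neither. A limit of the corresponding delayed solutions neither crosses
  nor has negative energy.\<close>

theorem shooting:
  assumes zero: "\<And>u. radial_sol N (g A0) a u \<Longrightarrow> \<exists>r\<ge>0. u r < 0"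
    and negative: "\<And>u. radial_sol N (g A1) a u \<Longrightarrow> \<exists>r\<ge>0. shot.E N (g A1) u r < 0"
  obtains c u where "c \<in> {A0..A1}" "radial_sol N (g c) a u" "\<And>r. 0 \<le> r \<Longrightarrow> 0 < u r" "(u \<longlongrightarrow> 0) at_top"
proof -
  have A0: "A0 \<in> {A0..A1}" and A1: "A1 \<in> {A0..A1}" using A by auto
  have "\<forall>\<^sub>F n in sequentially. A0 \<in> zero_first n"
  proof (rule constant_parameter_eventually[OF A0])
    fix j :: "nat \<Rightarrow> nat" and u assume *: "strict_mono j" "radial_sol N (g A0) a u"
      "\<And>R. uniform_limit {0..R} (\<lambda>n. y (j n) A0) u sequentially"
      "\<And>R. uniform_limit {0..R} (\<lambda>n. v (j n) A0) (flux N (\<lambda>t. g A0 (u t))) sequentially"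
    obtain r where r: "0 \<le> r" "u r < 0" using zero[OF *(2)] by blast
    show "\<forall>\<^sub>F n in sequentially. A0 \<in> zero_first (j n)"
      by (rule zero_first_eventually[OF A0 A0 tendsto_const *(2,1,3,4) r])
  qed
  moreover have "\<forall>\<^sub>F n in sequentially. A1 \<in> energy_first n"
  proof (rule constant_parameter_eventually[OF A1])
    fix j :: "nat \<Rightarrow> nat" and u assume *: "strict_mono j" "radial_sol N (g A1) a u"
      "\<And>R. uniform_limit {0..R} (\<lambda>n. y (j n) A1) u sequentially"
      "\<And>R. uniform_limit {0..R} (\<lambda>n. v (j n) A1) (flux N (\<lambda>t. g A1 (u t))) sequentially"
    obtain r where r: "0 \<le> r" "shot.E N (g A1) u r < 0" using negative[OF *(2)] by blast
    show "\<forall>\<^sub>F n in sequentially. A1 \<in> energy_first (j n)"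
      by (rule energy_first_eventually[OF A1 A1 tendsto_const *(2,1,3,4) r])
  qed
  ultimately have "\<forall>\<^sub>F n in sequentially. A0 \<in> zero_first n \<and> A1 \<in> energy_first n"
    by (rule eventually_conj)
  then obtain n0 where n0: "\<And>n. n \<ge> n0 \<Longrightarrow> A0 \<in> zero_first n \<and> A1 \<in> energy_first n"
    by (auto simp: eventually_sequentially)
  have "\<exists>c\<in>{A0..A1}. c \<notin> energy_first n \<and> c \<notin> zero_first n" if n: "n \<ge> n0" for n
  proof (rule ccontr)
    assume "\<not> ?thesis"
    then have "{A0..A1} \<subseteq> energy_first n \<union> zero_first n" by blast
    moreover have "openin (top_of_set {A0..A1}) (energy_first n)"
      unfolding energy_first_def by (rule hit_first_open[OF energy_joint y_joint])
    moreover have "openin (top_of_set {A0..A1}) (zero_first n)"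
      unfolding zero_first_def by (rule hit_first_open[OF y_joint energy_joint])
    moreover have "energy_first n \<noteq> {}" "zero_first n \<noteq> {}" using n0[OF n] by auto
    moreover have "connected {A0..A1}" by simp
    ultimately show False using disjoint[of n] unfolding connected_openin by blast
  qed
  then obtain c where c: "\<And>n. n \<ge> n0 \<Longrightarrow> c n \<in> {A0..A1} \<and> c n \<notin> energy_first n \<and> c n \<notin> zero_first n"
    by metis
  define j where "j = (\<lambda>n. n + n0)"
  have j: "strict_mono j" by (simp add: j_def strict_mono_def)
  have cj: "c (j n) \<in> {A0..A1}" "c (j n) \<notin> energy_first (j n)" "c (j n) \<notin> zero_first (j n)" for n
    using c[of "j n"] by (auto simp: j_def)
  obtain k c0 u where k: "strict_mono (k :: nat \<Rightarrow> nat)" and c0: "c0 \<in> {A0..A1}" "(\<lambda>n. c (j (k n))) \<longlonglongrightarrow> c0"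
    and u: "radial_sol N (g c0) a u"
    and lims: "\<forall>R. uniform_limit {0..R} (\<lambda>n. y (j (k n)) (c (j (k n)))) u sequentially"
    "\<forall>R. uniform_limit {0..R} (\<lambda>n. v (j (k n)) (c (j (k n)))) (flux N (\<lambda>t. g c0 (u t))) sequentially"
    by (rule delay_limit[where c = "\<lambda>n. c (j n)", OF j cj(1)])
  have jk: "strict_mono (\<lambda>n. j (k n))" using j k by (simp add: strict_mono_def)
  interpret T: transversal_shot N "g c0" b a u using transversal[OF c0(1) u] .
  have E: "0 \<le> T.E r" if r: "0 \<le> r" for r
  proof (rule ccontr)
    assume "\<not> 0 \<le> T.E r"
    then have "T.E r < 0" by simp
    from energy_first_eventually[OF cj(1) c0 u jk lims[rule_format] r this]
    show False using cj by (simp add: eventually_sequentially)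
  qed
  have u0: "0 \<le> u r" if r: "0 \<le> r" for r
  proof (rule ccontr)
    assume "\<not> 0 \<le> u r"
    then have "u r < 0" by simp
    from zero_first_eventually[OF cj(1) c0 u jk lims[rule_format] r this]
    show False using cj by (simp add: eventually_sequentially)
  qed
  show ?thesis by (rule that[OF c0(1) u T.ground_profile[OF E u0]])
qed

end

section \<open>Extending a nonlinearity upwards\<close>

definition ramp :: "real \<Rightarrow> real \<Rightarrow> real \<Rightarrow> real" where
  "ramp s1 s2 s = max 0 (min 1 ((s - s1) / (s2 - s1)))"

text \<open>The value \<open>g0 s\<close> up to \<open>s1\<close>, affine between \<open>s1\<close> and
  \<open>s2\<close>, and \<open>A\<^sup>2 * \<phi> s\<close> from \<open>s2\<close> to
  \<open>a\<close>. Writing it with clamped arguments makes it jointly continuous in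
  \<open>A\<close> and \<open>s\<close>, and bounded above \<open>a\<close>.\<close>

definition extension :: "(real \<Rightarrow> real) \<Rightarrow> (real \<Rightarrow> real) \<Rightarrow> real \<Rightarrow> real \<Rightarrow> real \<Rightarrow> real \<Rightarrow> real \<Rightarrow> real" where
  "extension g0 \<phi> s1 s2 a A s =
     g0 (min s s1) + ramp s1 s2 s * (A\<^sup>2 * \<phi> (max s2 (min s a)) - g0 s1)"

lemma extension_low:
  assumes "s1 < s2" "s \<le> s1" shows "extension g0 \<phi> s1 s2 a A s = g0 s"
proof -
  have "(s - s1) / (s2 - s1) \<le> 0" using assms by (intro divide_nonpos_pos) auto
  then have "ramp s1 s2 s = 0" by (simp add: ramp_def)
  then show ?thesis using assms by (simp add: extension_def)
qed

lemma extension_mid: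
  assumes "s1 < s2" "s2 \<le> a" "s1 \<le> s" "s \<le> s2"
  shows "extension g0 \<phi> s1 s2 a A s = (1 - (s - s1) / (s2 - s1)) * g0 s1 + (s - s1) / (s2 - s1) * (A\<^sup>2 * \<phi> s2)"
proof -
  have "ramp s1 s2 s = (s - s1) / (s2 - s1)" using assms by (simp add: ramp_def)
  moreover have "max s2 (min s a) = s2" "min s s1 = s1" using assms by auto
  ultimately show ?thesis unfolding extension_def by (simp only:) (simp add: algebra_simps)
qed

lemma extension_high:
  assumes "s1 < s2" "s2 \<le> s"
  shows "extension g0 \<phi> s1 s2 a A s = A\<^sup>2 * \<phi> (max s2 (min s a))"
proof -
  have "1 \<le> (s - s1) / (s2 - s1)" using assms by (simp add: le_divide_eq)
  then show ?thesis using assms by (simp add: extension_def ramp_def)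
qed

lemma extension_joint_continuous:
  assumes g0: "continuous_on UNIV g0" and \<phi>: "continuous_on {s2..a} \<phi>" and s: "s1 < s2" "s2 \<le> a"
  shows "continuous_on UNIV (\<lambda>(A, s). extension g0 \<phi> s1 s2 a A s)"
proof -
  have "continuous_on UNIV (\<lambda>p::real \<times> real. ramp s1 s2 (snd p))"
    unfolding ramp_def using s by (intro continuous_intros) auto
  moreover have "continuous_on UNIV (\<lambda>p::real \<times> real. \<phi> (max s2 (min (snd p) a)))"
    using s by (intro continuous_on_compose2[OF \<phi>] continuous_intros) auto
  moreover have "continuous_on UNIV (\<lambda>p::real \<times> real. g0 (min (snd p) s1))"
    by (intro continuous_on_compose2[OF g0] continuous_intros) auto
  ultimately show ?thesis
    unfolding extension_def case_prod_beta by (intro continuous_intros)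
qed

lemma (in shot) u_ge_of_V_le:
  assumes "0 \<le> R" "\<And>r. 0 < r \<Longrightarrow> r < R \<Longrightarrow> V r \<le> k * r"
  shows "a - k * R\<^sup>2 / 2 \<le> u R"
proof -
  have "(\<lambda>r. - (u r + k * r\<^sup>2 / 2)) R \<le> (\<lambda>r. - (u r + k * r\<^sup>2 / 2)) 0"
  proof (rule decreasing_of_deriv[of 0 R "\<lambda>r. - (u r + k * r\<^sup>2 / 2)"])
    show "continuous_on {0..R} (\<lambda>r. - (u r + k * r\<^sup>2 / 2))"
      by (intro continuous_intros continuous_on_subset[OF u_cont]) auto
    fix r assume r: "0 < r" "r < R"
    have "((\<lambda>r. - (u r + k * r\<^sup>2 / 2)) has_real_derivative - (- V r + k * r)) (at r)"
      by (intro DERIV_minus DERIV_add u_deriv r) (auto intro!: derivative_eq_intros)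
    then show "\<exists>d. ((\<lambda>r. - (u r + k * r\<^sup>2 / 2)) has_real_derivative d) (at r) \<and> d \<le> 0"
      using assms(2)[OF r] by (intro exI[of _ "- (- V r + k * r)"]) auto
  qed (use assms in auto)
  then show ?thesis by (simp add: u_0)
qed

lemma (in shot) u_le_of_V_ge:
  assumes "0 \<le> R" "\<And>r. 0 < r \<Longrightarrow> r < R \<Longrightarrow> k * r \<le> V r"
  shows "u R \<le> a - k * R\<^sup>2 / 2"
proof -
  have "(\<lambda>r. u r + k * r\<^sup>2 / 2) R \<le> (\<lambda>r. u r + k * r\<^sup>2 / 2) 0"
  proof (rule decreasing_of_deriv[of 0 R "\<lambda>r. u r + k * r\<^sup>2 / 2"])
    show "continuous_on {0..R} (\<lambda>r. u r + k * r\<^sup>2 / 2)"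
      by (intro continuous_intros continuous_on_subset[OF u_cont]) auto
    fix r assume r: "0 < r" "r < R"
    have "((\<lambda>r. u r + k * r\<^sup>2 / 2) has_real_derivative (- V r + k * r)) (at r)"
      by (intro DERIV_add u_deriv r) (auto intro!: derivative_eq_intros)
    then show "\<exists>d. ((\<lambda>r. u r + k * r\<^sup>2 / 2) has_real_derivative d) (at r) \<and> d \<le> 0"
      using assms(2)[OF r] by (intro exI[of _ "- V r + k * r"]) auto
  qed (use assms in auto)
  then show ?thesis by (simp add: u_0)
qed

text \<open>The function \<open>u + r * u' / (N - 2)\<close> is the effective starting height at radius
  \<open>r\<close>: it is constant on harmonic functions \<open>c + d * r powr (2 -
  N)\<close>, where it equals \<open>c\<close>.\<close>

lemma potential_minus_flux_deriv:
  assumes r: "0 < r" and N: "N > 2" and h: "continuous_on {0..} h"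
  shows "((\<lambda>r. potential N a h r - r * flux N h r / (real N - 2)) has_real_derivative - (r * h r) / (real N - 2)) (at r)"
proof -
  have N0: "0 < N" using N by simp
  have "((\<lambda>r. r * flux N h r) has_real_derivative 1 * flux N h r + (h r - (real N - 1) / r * flux N h r) * r) (at r)"
    by (rule DERIV_mult[OF DERIV_ident flux_deriv[OF r N0 h]])
  then have "((\<lambda>r. potential N a h r - r * flux N h r / (real N - 2)) has_real_derivative
     - flux N h r - (1 * flux N h r + (h r - (real N - 1) / r * flux N h r) * r) / (real N - 2)) (at r)"
    by (intro DERIV_diff potential_deriv_at r h DERIV_cdivide)
  moreover have "- flux N h r - (1 * flux N h r + (h r - (real N - 1) / r * flux N h r) * r) / (real N - 2) = - (r * h r) / (real N - 2)"
    using N r by (simp add: field_simps)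
  ultimately show ?thesis by (rule DERIV_cong)
qed

text \<open>Two solutions whose sources agree beyond \<open>r1\<close> differ there by a harmonic
  function, and the two identities record its two coefficients.\<close>

lemma sources_agree_beyond:
  assumes N: "N > 2" and h: "continuous_on {0..} h" and k: "continuous_on {0..} k"
    and agree: "\<And>t. r1 \<le> t \<Longrightarrow> h t = k t" and r: "0 < r1" "r1 \<le> r"
  shows "r ^ (N - 1) * (flux N h r - flux N k r) = r1 ^ (N - 1) * (flux N h r1 - flux N k r1)"
    and "(potential N a h r - r * flux N h r / (real N - 2)) - (potential N c k r - r * flux N k r / (real N - 2))
       = (potential N a h r1 - r1 * flux N h r1 / (real N - 2)) - (potential N c k r1 - r1 * flux N k r1 / (real N - 2))"
proof -
  have *: "f r = f r1" if "\<And>t. 0 < t \<Longrightarrow> r1 \<le> t \<Longrightarrow> (f has_real_derivative 0) (at t)" for f :: "real \<Rightarrow> real"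
  proof (cases "r = r1")
    case False
    show ?thesis
    proof (rule DERIV_isconst_end[of r1 r f])
      show "continuous_on {r1..r} f"
        using that r by (intro continuous_at_imp_continuous_on ballI DERIV_isCont[of f 0]) auto
    qed (use that r False in auto)
  qed simp
  show "r ^ (N - 1) * (flux N h r - flux N k r) = r1 ^ (N - 1) * (flux N h r1 - flux N k r1)"
  proof (rule *[of "\<lambda>r. r ^ (N - 1) * (flux N h r - flux N k r)"])
    fix t assume t: "0 < t" "r1 \<le> t"
    have "((\<lambda>r. r ^ (N - 1) * flux N h r - r ^ (N - 1) * flux N k r) has_real_derivative t ^ (N - 1) * h t - t ^ (N - 1) * k t) (at t)"
      by (intro DERIV_diff power_weighted_flux_deriv t h k)
    then show "((\<lambda>r. r ^ (N - 1) * (flux N h r - flux N k r)) has_real_derivative 0) (at t)"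
      using agree[OF t(2)] by (simp add: right_diff_distrib)
  qed
  show "(potential N a h r - r * flux N h r / (real N - 2)) - (potential N c k r - r * flux N k r / (real N - 2))
       = (potential N a h r1 - r1 * flux N h r1 / (real N - 2)) - (potential N c k r1 - r1 * flux N k r1 / (real N - 2))"
  proof (rule *[of "\<lambda>r. (potential N a h r - r * flux N h r / (real N - 2)) - (potential N c k r - r * flux N k r / (real N - 2))"])
    fix t assume t: "0 < t" "r1 \<le> t"
    have "((\<lambda>r. (potential N a h r - r * flux N h r / (real N - 2)) - (potential N c k r - r * flux N k r / (real N - 2)))
      has_real_derivative - (t * h t) / (real N - 2) - - (t * k t) / (real N - 2)) (at t)"
      by (intro DERIV_diff potential_minus_flux_deriv t h k N)
    then show "((\<lambda>r. (potential N a h r - r * flux N h r / (real N - 2)) - (potential N c k r - r * flux N k r / (real N - 2))) has_real_derivative 0) (at t)"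
      using agree[OF t(2)] by simp
  qed
qed

lemma flux_dominated_limit:
  assumes N: "N > 2" and k: "\<And>n. continuous_on {0..} (k n)" and B: "\<And>n t. 0 \<le> t \<Longrightarrow> \<bar>k n t\<bar> \<le> B"
    and lim: "\<And>t. 0 < t \<Longrightarrow> (\<lambda>n. k n t) \<longlonglongrightarrow> k0 t" and r: "0 \<le> r"
  shows "(\<lambda>n. flux N (k n) r) \<longlonglongrightarrow> flux N k0 r"
proof (cases "r = 0")
  case False
  have "(\<lambda>n. integral {0..1} (\<lambda>x. x ^ (N - 1) * k n (r * x))) \<longlonglongrightarrow> integral {0..1} (\<lambda>x. x ^ (N - 1) * k0 (r * x))"
  proof (rule dominated_convergence(2)[of _ _ "\<lambda>_. B"])
    show "(\<lambda>x. x ^ (N - 1) * k n (r * x)) integrable_on {0..1}" for n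
      by (rule integrable_continuous_interval[OF flux_integrand_continuous[OF continuous_on_subset[OF k] r]]) auto
    fix x :: real and n :: nat assume x: "x \<in> {0..1}"
    have "norm (x ^ (N - 1) * k n (r * x)) \<le> 1 * B"
      unfolding real_norm_def abs_mult using x r B[of "r * x" n]
      by (intro mult_mono) (auto simp: power_le_one)
    then show "norm (x ^ (N - 1) * k n (r * x)) \<le> B" by simp
  next
    fix x :: real assume x: "x \<in> {0..1}"
    show "(\<lambda>n. x ^ (N - 1) * k n (r * x)) \<longlonglongrightarrow> x ^ (N - 1) * k0 (r * x)"
    proof (cases "x = 0")
      case True
      then show ?thesis using N by (simp add: power_0_left)
    next
      case nz: False
      then show ?thesis using x r False by (intro tendsto_intros lim) (auto simp: zero_less_mult_iff)
    qed
  qed auto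
  then show ?thesis unfolding flux_def by (intro tendsto_intros)
qed simp

lemma potential_dominated_limit:
  assumes N: "N > 2" and k: "\<And>n. continuous_on {0..} (k n)" and B: "\<And>n t. 0 \<le> t \<Longrightarrow> \<bar>k n t\<bar> \<le> B"
    and lim: "\<And>t. 0 < t \<Longrightarrow> (\<lambda>n. k n t) \<longlonglongrightarrow> k0 t" and r: "0 \<le> r" and c: "c \<longlonglongrightarrow> c0"
  shows "(\<lambda>n. potential N (c n) (k n) r) \<longlonglongrightarrow> potential N c0 k0 r"
proof -
  have B0: "0 \<le> B" using B[of 0 0] by simp
  have "(\<lambda>n. integral {0..r} (flux N (k n))) \<longlonglongrightarrow> integral {0..r} (flux N k0)"
  proof (rule dominated_convergence(2)[of _ _ "\<lambda>_. B * r"])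
    show "flux N (k n) integrable_on {0..r}" for n
      by (intro integrable_continuous_interval continuous_on_subset[OF continuous_on_flux[OF k]]) auto
    fix x :: real and n :: nat assume x: "x \<in> {0..r}"
    have "\<bar>flux N (k n) x\<bar> \<le> B * x / N"
      using N x by (intro flux_abs_le continuous_on_subset[OF k] B) auto
    also have "\<dots> \<le> B * x / 1" using N x B0 by (intro divide_left_mono) auto
    also have "\<dots> \<le> B * r" using x B0 by (simp add: mult_left_mono)
    finally show "norm (flux N (k n) x) \<le> B * r" by simp
  next
    fix x assume "x \<in> {0..r}"
    then show "(\<lambda>n. flux N (k n) x) \<longlonglongrightarrow> flux N k0 x"
      by (intro flux_dominated_limit[OF N k B lim]) auto
  qed auto
  then show ?thesis unfolding potential_def by (intro tendsto_intros c)
qed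

text \<open>The given ground state \<open>U\<close> has height \<open>\<alpha>s\<close>; the base
  nonlinearity \<open>g0\<close> is used up to \<open>\<alpha>s + e\<close> and the new piece
  \<open>\<phi>\<close> from \<open>\<alpha>s + 2 * e\<close> to \<open>a\<close>. The length
  of the new piece is large compared with \<open>e\<close>, by the factors that carry the
  effective height below \<open>\<alpha>s\<close> and the solution across the affine zone, and
  small compared with \<open>\<alpha>s - b\<close>, which keeps the effective height positive.\<close>

locale extension_step =
  fixes N :: nat and g0 \<phi> U :: "real \<Rightarrow> real" and b \<beta> \<alpha>s e a m :: real
  assumes well0: "well N g0 b (\<alpha>s + e)"
    and U_sol: "radial_sol N g0 \<alpha>s U" and U_pos: "\<And>r. 0 \<le> r \<Longrightarrow> 0 < U r" and U_lim: "(U \<longlongrightarrow> 0) at_top"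
    and superlin: "\<And>s t. b < s \<Longrightarrow> s \<le> t \<Longrightarrow> t \<le> \<alpha>s \<Longrightarrow> g0 s / (s - b) \<le> g0 t / (t - b)"
    and \<beta>: "b \<le> \<beta>" "primitive g0 \<beta> = 0" "\<beta> < \<alpha>s"
    and Q: "\<And>s. \<beta> < s \<Longrightarrow> s < \<alpha>s \<Longrightarrow>
      \<exists>q. ((\<lambda>t. primitive g0 t / g0 t) has_real_derivative q) (at s) \<and> (real N - 2) / (2 * real N) < q"
    and e: "0 < e" and a1: "3 * (real N - 2) * e \<le> a - (\<alpha>s + 2 * e)" and a2: "2 ^ (N - 1) * e \<le> a - (\<alpha>s + 2 * e)"
    and a3: "24 * (a - (\<alpha>s + 2 * e)) < \<alpha>s - b"
    and \<phi>_cont: "continuous_on {\<alpha>s + 2 * e..a} \<phi>" and m: "0 < m"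
    and \<phi>_bounds: "\<And>s. \<alpha>s + 2 * e \<le> s \<Longrightarrow> s \<le> a \<Longrightarrow> m \<le> \<phi> s \<and> \<phi> s \<le> 2 * m"
begin

abbreviation "s1 \<equiv> \<alpha>s + e"
abbreviation "s2 \<equiv> \<alpha>s + 2 * e"
definition "d = a - s2"
definition "g A = extension g0 \<phi> s1 s2 a A"

sublocale W: well N g0 b s1 by (rule well0)

lemma N: "N > 2" by (rule W.N)

lemma d: "3 * (real N - 2) * e \<le> d" "2 ^ (N - 1) * e \<le> d" "24 * d < \<alpha>s - b" "0 < d"
proof -
  show "3 * (real N - 2) * e \<le> d" "2 ^ (N - 1) * e \<le> d" "24 * d < \<alpha>s - b"
    using a1 a2 a3 by (simp_all add: d_def)
  have "0 < 2 ^ (N - 1) * e" using e by simp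
  then show "0 < d" using \<open>2 ^ (N - 1) * e \<le> d\<close> by simp
qed

lemma ordering: "0 < b" "b < \<alpha>s" "s2 < a" "b < s1" "0 < \<alpha>s"
  using d W.b e by (auto simp: d_def)

lemma well_low: "h \<le> s1 \<Longrightarrow> well N g0 b h"
  using well0 unfolding well_def by auto

sublocale U: shot N g0 b \<alpha>s U
  using well_low[of \<alpha>s] ordering e U_sol by (simp add: shot_def shot_axioms_def)

sublocale U: transversal_shot N g0 b \<alpha>s U
proof
  show "0 < \<alpha>s" by (rule ordering)
qed (use U_pos in \<open>force dest: less_imp_le\<close>)

lemma g_low: "s \<le> s1 \<Longrightarrow> g A s = g0 s"
  using e by (simp add: g_def extension_low)

lemma g_high: "s2 \<le> s \<Longrightarrow> g A s = A\<^sup>2 * \<phi> (max s2 (min s a))"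
  using e by (simp add: g_def extension_high)

lemma g_high_bounds:
  assumes "s2 \<le> s" shows "A\<^sup>2 * m \<le> g A s" "g A s \<le> 2 * m * A\<^sup>2"
proof -
  have "m \<le> \<phi> (max s2 (min s a))" "\<phi> (max s2 (min s a)) \<le> 2 * m"
    using \<phi>_bounds[of "max s2 (min s a)"] ordering by auto
  then have "A\<^sup>2 * m \<le> A\<^sup>2 * \<phi> (max s2 (min s a))" "A\<^sup>2 * \<phi> (max s2 (min s a)) \<le> A\<^sup>2 * (2 * m)"
    by (auto intro!: mult_left_mono)
  then show "A\<^sup>2 * m \<le> g A s" "g A s \<le> 2 * m * A\<^sup>2"
    unfolding g_high[OF assms] by (simp_all add: mult.commute)
qed

lemma g_mid:
  assumes "s1 \<le> s" "s \<le> s2"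
  obtains \<theta> where "0 \<le> \<theta>" "\<theta> \<le> 1" "g A s = (1 - \<theta>) * g0 s1 + \<theta> * (A\<^sup>2 * \<phi> s2)"
proof -
  have "g A s = (1 - (s - s1) / (s2 - s1)) * g0 s1 + (s - s1) / (s2 - s1) * (A\<^sup>2 * \<phi> s2)"
    unfolding g_def using e ordering assms by (intro extension_mid) auto
  moreover have "0 \<le> (s - s1) / (s2 - s1)" "(s - s1) / (s2 - s1) \<le> 1" using e assms by (auto simp: divide_le_eq)
  ultimately show ?thesis by (intro that[of "(s - s1) / (s2 - s1)"])
qed

lemma \<phi>_s2: "m \<le> \<phi> s2" "\<phi> s2 \<le> 2 * m"
  using \<phi>_bounds[of s2] ordering by auto

lemma g_joint: "continuous_on UNIV (\<lambda>(A, s). g A s)"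
  unfolding g_def using e ordering
  by (intro extension_joint_continuous W.g_cont \<phi>_cont) auto

lemma g_cont: "continuous_on UNIV (g A)"
  using continuous_on_compose2[OF g_joint, of UNIV "Pair A"] by (simp add: continuous_on_Pair)

lemma g0_s1_pos: "0 < g0 s1"
  using W.g_pos[of s1] ordering by simp

lemma g_pos:
  assumes A: "0 < A" and s: "b < s" shows "0 < g A s"
proof -
  consider "s \<le> s1" | "s1 \<le> s" "s \<le> s2" | "s2 \<le> s" by linarith
  then show ?thesis
  proof cases
    case 1
    then show ?thesis using W.g_pos[of s] s by (simp add: g_low)
  next
    case 2
    then obtain \<theta> where t: "0 \<le> \<theta>" "\<theta> \<le> 1" "g A s = (1 - \<theta>) * g0 s1 + \<theta> * (A\<^sup>2 * \<phi> s2)" by (rule g_mid)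
    have p: "0 < A\<^sup>2 * \<phi> s2" using A m \<phi>_s2 by simp
    show ?thesis
    proof (cases "\<theta> = 0")
      case False
      then have "0 < \<theta> * (A\<^sup>2 * \<phi> s2)" "0 \<le> (1 - \<theta>) * g0 s1" using t p g0_s1_pos by auto
      then show ?thesis using t by simp
    qed (use t g0_s1_pos in simp)
  next
    case 3
    have "0 < A\<^sup>2 * m" using A m by simp
    then show ?thesis using g_high_bounds(1)[OF 3, of A] by simp
  qed
qed

lemma g_well: "0 < A \<Longrightarrow> well N (g A) b a"
proof
  assume A: "0 < A"
  obtain \<epsilon> where \<epsilon>: "0 < \<epsilon>" "\<forall>s\<in>{0<..<\<epsilon>}. g0 s < 0" using W.g_neg by blast
  then show "\<exists>e>0. \<forall>s\<in>{0<..<e}. g A s < 0"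
    using ordering e by (intro exI[of _ "min \<epsilon> s1"]) (auto simp: g_low)
  show "g A s = 0" if "s \<le> 0" for s using that ordering e W.g_0[OF that] by (simp add: g_low)
  show "g A s \<le> 0" if "0 \<le> s" "s \<le> b" for s using that ordering W.g_nonpos[OF that] by (simp add: g_low)
  show "0 < g A s" if "b < s" for s using g_pos[OF A that] .
qed (use N g_cont ordering e in auto)

lemma transversal:
  assumes "0 < A" "radial_sol N (g A) a u" shows "transversal_shot N (g A) b a u"
proof -
  interpret S: shot N "g A" b a u
    using g_well[OF assms(1)] assms(2) by (simp add: shot_def shot_axioms_def)
  show ?thesis
  proof
    show "0 < a" using ordering e by simp
    fix r0 :: real assume "0 < r0" "\<And>r. 0 \<le> r \<Longrightarrow> r < r0 \<Longrightarrow> 0 < u r" "u r0 = 0"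
    then show "flux N (\<lambda>t. g A (u t)) r0 \<noteq> 0"
      by (intro no_touch_transfer[OF U.shot_axioms U_pos U_lim S.shot_axioms, of s1]) (use ordering e g_low in auto)
  qed
qed

lemma transversal_low:
  assumes h: "0 < h" "h \<le> s1" and z: "radial_sol N g0 h z" shows "transversal_shot N g0 b h z"
proof -
  interpret S: shot N g0 b h z
    using well_low[OF h(2)] z by (simp add: shot_def shot_axioms_def)
  show ?thesis
  proof
    show "0 < h" by (rule h)
    fix r0 :: real assume "0 < r0" "\<And>r. 0 \<le> r \<Longrightarrow> r < r0 \<Longrightarrow> 0 < z r" "z r0 = 0"
    then show "flux N (\<lambda>t. g0 (z t)) r0 \<noteq> 0"
      by (intro no_touch_transfer[OF U.shot_axioms U_pos U_lim S.shot_axioms, of s1]) (use ordering e in auto)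
  qed
qed

text \<open>Solutions of the base nonlinearity from heights below \<open>\<alpha>s\<close> only see the
  part of \<open>g0\<close> to which the comparison with \<open>U\<close> applies.\<close>

lemma low_start:
  assumes h: "0 < h" "h < \<alpha>s" and z: "radial_sol N g0 h z"
  shows "\<exists>r\<ge>0. shot.E N g0 z r < 0"
  using transversal_low[OF h(1) _ z] h e
  by (intro lower_start_negative_energy[OF _ U.transversal_shot_axioms h(2) U_lim U_pos superlin \<beta> Q]) auto

lemma primitive_low: "s \<le> s1 \<Longrightarrow> primitive (g A) s = primitive g0 s"
  unfolding primitive_def by (intro integral_cong) (auto simp: g_low)

definition "G0 = (SOME M. 0 \<le> M \<and> (\<forall>s\<le>s1. \<bar>g0 s\<bar> \<le> M))"

lemma G0: "0 \<le> G0" "s \<le> s1 \<Longrightarrow> \<bar>g0 s\<bar> \<le> G0"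
proof -
  have "compact (g0 ` {0..s1})"
    by (intro compact_continuous_image continuous_on_subset[OF W.g_cont]) auto
  then obtain M where M: "\<And>s. s \<in> {0..s1} \<Longrightarrow> \<bar>g0 s\<bar> \<le> M"
    using compact_imp_bounded bounded_iff by (metis image_eqI real_norm_def)
  have "\<bar>g0 s\<bar> \<le> \<bar>M\<bar>" if "s \<le> s1" for s
  proof (cases "s \<le> 0")
    case True
    then show ?thesis using W.g_0[OF True] by simp
  next
    case False
    then show ?thesis using M[of s] that by auto
  qed
  then have "0 \<le> \<bar>M\<bar> \<and> (\<forall>s\<le>s1. \<bar>g0 s\<bar> \<le> \<bar>M\<bar>)" by simp
  then have *: "0 \<le> G0 \<and> (\<forall>s\<le>s1. \<bar>g0 s\<bar> \<le> G0)" unfolding G0_def by (rule someI)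
  then show "0 \<le> G0" "s \<le> s1 \<Longrightarrow> \<bar>g0 s\<bar> \<le> G0" by auto
qed

lemma g_bound: "\<bar>g A s\<bar> \<le> max G0 (2 * m * A\<^sup>2)"
proof -
  consider "s \<le> s1" | "s1 \<le> s" "s \<le> s2" | "s2 \<le> s" by linarith
  then show ?thesis
  proof cases
    case 1
    then show ?thesis using G0(2)[OF 1] by (simp add: g_low)
  next
    case 2
    then obtain \<theta> where t: "0 \<le> \<theta>" "\<theta> \<le> 1" "g A s = (1 - \<theta>) * g0 s1 + \<theta> * (A\<^sup>2 * \<phi> s2)" by (rule g_mid)
    have p: "0 \<le> A\<^sup>2 * \<phi> s2" "A\<^sup>2 * \<phi> s2 \<le> A\<^sup>2 * (2 * m)" using m \<phi>_s2 by (auto intro!: mult_left_mono)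
    have "0 \<le> g A s" using t p g0_s1_pos by auto
    moreover have "g A s \<le> max G0 (2 * m * A\<^sup>2)"
      unfolding t(3) using t p G0(2)[of s1] by (intro convex_bound_le) (auto simp: algebra_simps)
    ultimately show ?thesis by simp
  next
    case 3
    have "0 \<le> A\<^sup>2 * m" using m by simp
    then show ?thesis using g_high_bounds[OF 3, of A] by simp
  qed
qed

end

section \<open>The two extremes of the amplification\<close>

context extension_step
begin

lemma primitive_bound:
  assumes "0 \<le> s" "s \<le> a" shows "\<bar>primitive (g A) s\<bar> \<le> max G0 (2 * m * A\<^sup>2) * a"
proof -
  have "norm (integral {0..s} (g A)) \<le> max G0 (2 * m * A\<^sup>2) * (s - 0)"
    using assms g_bound by (intro integral_bound continuous_on_subset[OF g_cont]) auto
  also have "\<dots> \<le> max G0 (2 * m * A\<^sup>2) * a" using assms G0(1) by (intro mult_left_mono) auto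
  finally show ?thesis by (simp add: primitive_def)
qed

lemma primitive_increasing:
  assumes A: "0 < A" and s: "b \<le> s" "s \<le> t" shows "primitive (g A) s \<le> primitive (g A) t"
proof -
  interpret w: well N "g A" b a by (rule g_well[OF A])
  have "- primitive (g A) t \<le> - primitive (g A) s"
  proof (rule decreasing_of_deriv[OF s(2), of "\<lambda>s. - primitive (g A) s"])
    show "continuous_on {s..t} (\<lambda>s. - primitive (g A) s)" by (intro continuous_intros w.primitive_cont)
    fix x assume x: "s < x" "x < t"
    show "\<exists>d. ((\<lambda>s. - primitive (g A) s) has_real_derivative d) (at x) \<and> d \<le> 0"
      using g_pos[OF A, of x] x s by (intro exI[of _ "- g A x"] conjI DERIV_minus w.primitive_deriv) auto
  qed
  then show ?thesis by simp
qed

lemma top_energy_pos: "0 < primitive g0 \<alpha>s"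
proof -
  have V: "0 < U.V r" if "0 < r" for r
    using U.V_pos[of r r] U.tends_to_zero_imp_energy_nonneg[OF U_lim, of r] that by simp
  have "U.E 1 < U.E 0" using V by (intro U.E_strict_antimono) (auto simp: less_le)
  then show ?thesis using U.tends_to_zero_imp_energy_nonneg[OF U_lim, of 1] U.E_0 by simp
qed

lemma primitive_high: "0 < A \<Longrightarrow> s2 \<le> s \<Longrightarrow> primitive g0 \<alpha>s \<le> primitive (g A) s"
  using primitive_increasing[of A \<alpha>s s] primitive_low[of \<alpha>s A] ordering e by simp

text \<open>For \<open>A \<le> 1\<close> the speed is bounded by a constant \<open>B\<close>, and the
  solution stays above \<open>s2\<close> up to a radius \<open>R\<close> that is large if
  \<open>A\<close> is small. From then on the energy lost is at most \<open>(N - 1) / R * B *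
  a\<close>, since the integral of the squared speed is at most \<open>B\<close> times the
  drop in height. With at least half of the energy \<open>\<kappa>\<close> left the solution
  cannot turn around or converge to 0, so it crosses.\<close>

lemma small_parameter:
  obtains A0 where "0 < A0" "A0 \<le> 1" "\<And>u. radial_sol N (g A0) a u \<Longrightarrow> \<exists>r\<ge>0. u r < 0"
proof -
  define \<kappa> where "\<kappa> = primitive g0 \<alpha>s"
  have \<kappa>: "0 < \<kappa>" using top_energy_pos by (simp add: \<kappa>_def)
  have a0: "0 < a" using ordering e by simp
  define Mb where "Mb = max G0 (2 * m)"
  have Mb: "0 < Mb" using m by (simp add: Mb_def less_max_iff_disj)
  \<comment> \<open>the squared speed is twice the energy minus twice the primitive, each at most \<open>Mb * a\<close> in absolute value\<close>
  define B where "B = sqrt (4 * Mb * a)"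
  have B: "0 < B" using Mb a0 by (simp add: B_def)
  have N2: "0 < real N - 1" using N by simp
  \<comment> \<open>beyond this radius the total loss of energy is at most \<open>\<kappa> / 2\<close>\<close>
  define R where "R = 2 * (real N - 1) * B * a / \<kappa>"
  have R: "0 < R" using N2 B a0 \<kappa> by (simp add: R_def)
  \<comment> \<open>by scaling, the solution stays above \<open>s2\<close> up to radius \<open>R\' / A\<close>\<close>
  define R' where "R' = sqrt (N * d / m)"
  have R': "0 < R'" using N d m by (simp add: R'_def)
  define A0 where "A0 = min 1 (R' / R)"
  have A0: "0 < A0" "A0 \<le> 1" using R R' by (auto simp: A0_def)
  have A0R: "A0 * R \<le> R'" using R by (simp add: A0_def min_def field_simps)
  have "A0\<^sup>2 \<le> 1" using A0 by (simp add: power_le_one)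
  then have "2 * m * A0\<^sup>2 \<le> 2 * m" using m by simp
  then have "max G0 (2 * m * A0\<^sup>2) * a \<le> Mb * a" using a0 by (intro mult_right_mono) (auto simp: Mb_def)
  then have pb: "\<bar>primitive (g A0) s\<bar> \<le> Mb * a" if "0 \<le> s" "s \<le> a" for s
    using primitive_bound[OF that, of A0] by linarith
  have "\<exists>r\<ge>0. u r < 0" if sol: "radial_sol N (g A0) a u" for u
  proof (rule ccontr)
    assume "\<not> ?thesis"
    then have upos: "0 \<le> u r" if "0 \<le> r" for r using that by (meson not_less)
    interpret T: transversal_shot N "g A0" b a u by (rule transversal[OF A0(1) sol])
    have hR: "s2 \<le> u R"
    proof (rule ccontr)
      assume neg: "\<not> s2 \<le> u R"
      obtain \<rho> where \<rho>: "0 < \<rho>" "\<rho> \<le> R" "u \<rho> - s2 = 0" "\<And>x. 0 \<le> x \<Longrightarrow> x < \<rho> \<Longrightarrow> 0 < u x - s2"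
        by (rule first_nonpos[of 0 R "\<lambda>x. u x - s2"])
           (use R neg ordering T.u_0 in \<open>auto intro!: continuous_intros continuous_on_subset[OF T.u_cont]\<close>)
      have "\<rho> \<noteq> R" using \<rho> neg by auto
      have "a - (2 * m * A0\<^sup>2 / N) * \<rho>\<^sup>2 / 2 \<le> u \<rho>"
      proof (rule T.u_ge_of_V_le)
        fix r assume r: "0 < r" "r < \<rho>"
        have "T.V r \<le> (2 * m * A0\<^sup>2) * r / N"
        proof (rule flux_le)
          fix t assume t: "0 \<le> t" "t \<le> r"
          then have "s2 \<le> u t" using \<rho>(4)[of t] r by simp
          then show "g A0 (u t) \<le> 2 * m * A0\<^sup>2" by (rule g_high_bounds(2))
        qed (use N r in \<open>auto intro: continuous_on_subset[OF T.source_cont]\<close>)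
        then show "T.V r \<le> 2 * m * A0\<^sup>2 / N * r" by simp
      qed (use \<rho> in auto)
      then have "d \<le> (m / N) * (A0 * \<rho>)\<^sup>2" using \<rho> by (simp add: d_def power_mult_distrib field_simps)
      also have "\<dots> < (m / N) * R'\<^sup>2"
      proof (intro mult_strict_left_mono power_strict_mono)
        show "A0 * \<rho> < R'" using A0R \<rho> \<open>\<rho> \<noteq> R\<close> A0 by (smt (verit) mult_less_cancel_left_pos)
      qed (use A0 \<rho> m N in auto)
      also have "\<dots> = d" using d m N by (simp add: R'_def)
      finally show False by simp
    qed
    have ER: "\<kappa> \<le> T.E R" using primitive_high[OF A0(1) hR] by (simp add: T.E_def \<kappa>_def add_increasing)
    have big: "\<kappa> / 2 \<le> T.E t" if t: "R \<le> t" and Et: "0 \<le> T.E t" for t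
    proof -
      have V: "0 < T.V r" if "0 < r" "r \<le> t" for r using T.V_pos[OF Et that] .
      \<comment> \<open>chosen such that \<open>E - c * u\<close> is nondecreasing beyond \<open>R\<close>\<close>
      define c where "c = (real N - 1) / R * B"
      have c: "0 < c" using N2 R B by (simp add: c_def)
      have "c * a = \<kappa> / 2" using N2 B a0 \<kappa> by (simp add: c_def R_def field_simps)
      have ua: "u r \<le> a" if "0 \<le> r" "r \<le> t" for r
        using T.u_antimono[of 0 r] V that T.u_0 by (simp add: less_imp_le)
      have "(\<lambda>r. - (T.E r - c * u r)) t \<le> (\<lambda>r. - (T.E r - c * u r)) R"
      proof (rule decreasing_of_deriv[OF t, of "\<lambda>r. - (T.E r - c * u r)"])
        show "continuous_on {R..t} (\<lambda>r. - (T.E r - c * u r))"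
          using R by (intro continuous_intros continuous_on_subset[OF T.E_cont] continuous_on_subset[OF T.u_cont]) auto
        fix r assume r: "R < r" "r < t"
        then have r0: "0 < r" using R by simp
        have Er: "T.E r \<le> T.E 0" using r0 by (intro T.E_antimono) auto
        have "T.E 0 \<le> Mb * a" using pb[of a] a0 by (simp add: T.E_0)
        moreover have "- (Mb * a) \<le> primitive (g A0) (u r)"
          using pb[of "u r"] upos[of r] ua[of r] r r0 by simp
        ultimately have "(T.V r)\<^sup>2 \<le> 4 * Mb * a" using Er by (simp add: T.E_def)
        then have "sqrt ((T.V r)\<^sup>2) \<le> B" unfolding B_def by (rule real_sqrt_le_mono)
        then have VB: "T.V r \<le> B" using V[of r] r r0 by simp
        have "(real N - 1) / r * (T.V r)\<^sup>2 \<le> (real N - 1) / R * (T.V r)\<^sup>2"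
          using N2 r R by (intro mult_right_mono divide_left_mono) auto
        also have "\<dots> \<le> (real N - 1) / R * (B * T.V r)"
          unfolding power2_eq_square using N2 R V[of r] r r0 VB by (intro mult_left_mono mult_right_mono) auto
        also have "\<dots> = c * T.V r" by (simp add: c_def)
        finally have "0 \<le> - (real N - 1) / r * (T.V r)\<^sup>2 + c * T.V r"
          unfolding minus_divide_left[symmetric] mult_minus_left by linarith
        moreover have "((\<lambda>r. - (T.E r - c * u r)) has_real_derivative - (- (real N - 1) / r * (T.V r)\<^sup>2 - c * (- T.V r))) (at r)"
          by (intro DERIV_minus DERIV_diff T.E_deriv DERIV_cmult T.u_deriv r0)
        ultimately show "\<exists>d. ((\<lambda>r. - (T.E r - c * u r)) has_real_derivative d) (at r) \<and> d \<le> 0"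
          by (intro exI[of _ "- (- (real N - 1) / r * (T.V r)\<^sup>2 - c * (- T.V r))"]) auto
      qed
      then have "T.E R - c * u R \<le> T.E t - c * u t" by simp
      moreover have "c * u R \<le> c * a" using ua[of R] t R c by (intro mult_left_mono) auto
      moreover have "0 \<le> c * u t" using upos[of t] t R c by simp
      ultimately show ?thesis using ER \<open>c * a = \<kappa> / 2\<close> by linarith
    qed
    have Epos: "0 \<le> T.E t" if t: "0 \<le> t" for t
    proof (rule ccontr)
      assume neg: "\<not> 0 \<le> T.E t"
      have "R < t"
      proof (rule ccontr)
        assume "\<not> R < t"
        then show False using T.E_antimono[of t R] t ER \<kappa> neg by simp
      qed
      moreover have "continuous_on {R..t} T.E" using R by (intro continuous_on_subset[OF T.E_cont]) auto
      ultimately have "\<exists>x\<ge>R. x \<le> t \<and> T.E x = 0" using ER \<kappa> neg by (intro IVT2') auto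
      then obtain x where "R \<le> x" "T.E x = 0" by blast
      then show False using big[of x] \<kappa> by simp
    qed
    have "(u \<longlongrightarrow> 0) at_top" by (rule T.decreasing_to_zero[OF Epos upos])
    moreover have "isCont (primitive (g A0)) 0" using T.primitive_deriv DERIV_isCont by blast
    ultimately have "((\<lambda>r. primitive (g A0) (u r)) \<longlongrightarrow> primitive (g A0) 0) at_top"
      using isCont_tendsto_compose by blast
    then have "\<forall>\<^sub>F r in at_top. primitive (g A0) (u r) < \<kappa> / 4"
      using \<kappa> T.primitive_0[of 0] by (intro order_tendstoD(2)) auto
    then obtain R2 where R2: "\<And>r. R2 \<le> r \<Longrightarrow> primitive (g A0) (u r) < \<kappa> / 4"
      by (auto simp: eventually_at_top_linorder)
    define R3 where "R3 = max R R2"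
    have "sqrt (\<kappa> / 2) \<le> T.V r" if r: "R3 < r" for r
    proof (rule real_le_lsqrt)
      show "\<kappa> / 2 \<le> (T.V r)\<^sup>2" using big[of r] Epos[of r] R2[of r] r R by (simp add: R3_def T.E_def)
      show "0 \<le> T.V r" using T.V_pos[of r r] Epos[of r] r R by (simp add: R3_def)
    qed
    moreover have "0 \<le> R3" "0 < sqrt (\<kappa> / 2)" using R \<kappa> by (auto simp: R3_def)
    ultimately obtain r where "R3 < r" "u r < 0" using T.drift by blast
    then show False using upos[of r] \<open>0 \<le> R3\<close> by simp
  qed
  then show ?thesis using that A0 by blast
qed

text \<open>All constants come from the bounds \<open>A\<^sup>2 * m \<le> g A \<le> 2 * A\<^sup>2 *
  m\<close> on the new piece, that is, from comparison with the parabolas \<open>a - k *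
  r\<^sup>2 / 2\<close> and \<open>a - k * r\<^sup>2\<close>, where \<open>k = A\<^sup>2 * m /
  N\<close>. The solution leaves the new piece at some radius \<open>\<rho>\<close> with
  \<open>\<rho> * V \<rho> \<ge> d\<close>, which puts the effective height below
  \<open>\<alpha>s - e\<close>. Doubling the radius is enough to cross the affine zone,
  because the weighted flux does not decrease. The upper bounds on the fall and on the flux up
  to the radius \<open>2 * \<rho>\<close> give the lower bound on the effective height.\<close>

lemma exit_state:
  assumes A: "0 < A" and AG: "G0 \<le> A\<^sup>2 * m" and sol: "radial_sol N (g A) a u"
    and E: "\<And>r. 0 \<le> r \<Longrightarrow> 0 \<le> shot.E N (g A) u r"
  defines "V \<equiv> flux N (\<lambda>t. g A (u t))"
  shows "\<exists>r1. 0 < r1 \<and> r1 \<le> 2 * sqrt (2 * N * d / m) / A \<and> u r1 \<le> s1 \<and> 0 \<le> r1 * V r1 \<and> r1 * V r1 \<le> 16 * d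
    \<and> \<alpha>s - 24 * d \<le> u r1 - r1 * V r1 / (real N - 2) \<and> u r1 - r1 * V r1 / (real N - 2) \<le> \<alpha>s - e"
proof -
  interpret T: transversal_shot N "g A" b a u by (rule transversal[OF A sol])
  have V: "0 < V r" if "0 < r" for r unfolding V_def using T.V_pos[of r r] E that by simp
  have dec: "u y < u x" if "0 \<le> x" "x < y" for x y
    by (rule T.u_strict_antimono) (use that V V_def in auto)
  define k where "k = A\<^sup>2 * m / N"
  have k: "0 < k" using A m N by (simp add: k_def)
  \<comment> \<open>the radius at which the slower parabola \<open>a - k * r\<^sup>2 / 2\<close> reaches \<open>s2\<close>\<close>
  define r0 where "r0 = sqrt (2 * d / k)"
  have r0: "0 < r0" "k * r0\<^sup>2 = 2 * d" using k d by (simp_all add: r0_def)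
  have r0_eq: "r0 = sqrt (2 * N * d / m) / A"
  proof -
    have "2 * d / k = (2 * N * d / m) / A\<^sup>2" by (simp add: k_def field_simps)
    then have "r0 = sqrt ((2 * N * d / m) / A\<^sup>2)" by (simp only: r0_def)
    also have "\<dots> = sqrt (2 * N * d / m) / sqrt (A\<^sup>2)" by (rule real_sqrt_divide)
    finally show ?thesis using A by simp
  qed
  have lower: "k * r \<le> V r" if "0 \<le> r" "\<And>t. 0 \<le> t \<Longrightarrow> t \<le> r \<Longrightarrow> s2 \<le> u t" for r
  proof -
    have "(A\<^sup>2 * m) * r / N \<le> V r"
      unfolding V_def using N that g_high_bounds(1)
      by (intro flux_ge continuous_on_subset[OF T.source_cont]) auto
    then show ?thesis by (simp add: k_def)
  qed
  have upper: "V r \<le> (2 * k) * r" if "0 \<le> r" for r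
  proof -
    have "V r \<le> (2 * m * A\<^sup>2) * r / N"
      unfolding V_def
    proof (rule flux_le)
      fix t
      have "2 * m * A\<^sup>2 = 2 * (A\<^sup>2 * m)" by simp
      then have "G0 \<le> 2 * m * A\<^sup>2" using AG G0(1) by linarith
      then show "g A (u t) \<le> 2 * m * A\<^sup>2" using g_bound[of A "u t"] by simp
    qed (use N that in \<open>auto intro: continuous_on_subset[OF T.source_cont]\<close>)
    then show ?thesis by (simp add: k_def mult_ac)
  qed
  have fall: "a - k * r\<^sup>2 \<le> u r" if "0 \<le> r" for r
    using T.u_ge_of_V_le[of r "2 * k"] upper that unfolding V_def by simp
  have "u r0 \<le> s2"
  proof (rule ccontr)
    assume neg: "\<not> u r0 \<le> s2"
    have "u r0 \<le> a - k * r0\<^sup>2 / 2"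
    proof (rule T.u_le_of_V_ge)
      fix r assume r: "0 < r" "r < r0"
      have "s2 \<le> u t" if "0 \<le> t" "t \<le> r" for t using dec[of t r0] that r neg by simp
      then show "k * r \<le> T.V r" using lower[of r] r by (simp add: V_def)
    qed (use r0 in auto)
    then show False using neg r0(2) d_def by linarith
  qed
  then have "\<exists>x\<ge>0. x \<le> r0 \<and> u x = s2"
    using T.u_0 ordering r0 by (intro IVT2' continuous_on_subset[OF T.u_cont]) auto
  then obtain \<rho> where \<rho>: "0 \<le> \<rho>" "\<rho> \<le> r0" "u \<rho> = s2" by blast
  then have \<rho>0: "0 < \<rho>" using T.u_0 ordering by (cases "\<rho> = 0") auto
  have high: "s2 \<le> u t" if "0 \<le> t" "t \<le> \<rho>" for t using dec[of t \<rho>] that \<rho> by (cases "t = \<rho>") auto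
  have k\<rho>: "d \<le> k * \<rho>\<^sup>2" using fall[of \<rho>] \<rho> by (simp add: d_def)
  have "k * \<rho> \<le> V \<rho>" using lower[of \<rho>] \<rho> high by simp
  then have "\<rho> * (k * \<rho>) \<le> \<rho> * V \<rho>" using \<rho>0 by simp
  then have \<rho>V: "d \<le> \<rho> * V \<rho>" using k\<rho> by (simp add: power2_eq_square mult_ac)
  define r1 where "r1 = 2 * \<rho>"
  have r1: "0 < r1" "\<rho> < r1" using \<rho>0 by (auto simp: r1_def)
  have kr1: "k * r1\<^sup>2 \<le> 8 * d"
  proof -
    have "k * \<rho>\<^sup>2 \<le> k * r0\<^sup>2" using k \<rho> by (intro mult_left_mono power_mono) auto
    then show ?thesis using r0 by (simp add: r1_def power_mult_distrib)
  qed
  have ur1: "u r1 \<le> s1"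
  proof (rule ccontr)
    assume neg: "\<not> u r1 \<le> s1"
    \<comment> \<open>the weighted flux does not decrease while \<open>r\<close> at most doubles\<close>
    define c where "c = V \<rho> / 2 ^ (N - 1)"
    have Vc: "c \<le> V r" if r: "\<rho> < r" "r < r1" for r
    proof -
      have "- (r ^ (N - 1) * V r) \<le> - (\<rho> ^ (N - 1) * V \<rho>)"
      proof (rule decreasing_of_deriv[of \<rho> r "\<lambda>r. - (r ^ (N - 1) * V r)"])
        show "continuous_on {\<rho>..r} (\<lambda>r. - (r ^ (N - 1) * V r))"
          unfolding V_def using \<rho>0 by (intro continuous_intros continuous_on_subset[OF T.V_cont]) auto
        fix t assume t: "\<rho> < t" "t < r"
        have "b < u t" using dec[of t r1] t r neg ordering \<rho>0 by simp
        then have "0 < g A (u t)" by (rule g_pos[OF A])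
        moreover have "((\<lambda>r. - (r ^ (N - 1) * V r)) has_real_derivative - (t ^ (N - 1) * g A (u t))) (at t)"
          unfolding V_def using t \<rho>0 by (intro DERIV_minus T.W_deriv) auto
        ultimately show "\<exists>d. ((\<lambda>r. - (r ^ (N - 1) * V r)) has_real_derivative d) (at t) \<and> d \<le> 0"
          using t \<rho>0 by (intro exI[of _ "- (t ^ (N - 1) * g A (u t))"]) auto
      qed (use r in auto)
      moreover have "r ^ (N - 1) * V r \<le> (2 * \<rho>) ^ (N - 1) * V r"
        using r V[of r] \<rho>0 by (intro mult_right_mono power_mono) (auto simp: r1_def)
      ultimately have "\<rho> ^ (N - 1) * V \<rho> \<le> \<rho> ^ (N - 1) * (2 ^ (N - 1) * V r)" by (simp add: power_mult_distrib mult_ac)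
      then have "V \<rho> \<le> 2 ^ (N - 1) * V r" using \<rho>0 by simp
      then show ?thesis by (simp add: c_def pos_divide_le_eq mult.commute)
    qed
    have "(\<lambda>r. u r + c * r) r1 \<le> (\<lambda>r. u r + c * r) \<rho>"
    proof (rule decreasing_of_deriv[of \<rho> r1 "\<lambda>r. u r + c * r"])
      show "continuous_on {\<rho>..r1} (\<lambda>r. u r + c * r)"
        using \<rho>0 by (intro continuous_intros continuous_on_subset[OF T.u_cont]) auto
      fix r assume r: "\<rho> < r" "r < r1"
      have "((\<lambda>r. u r + c * r) has_real_derivative - T.V r + c) (at r)"
        using r \<rho>0 by (intro DERIV_add T.u_deriv) (auto intro!: derivative_eq_intros)
      then show "\<exists>d. ((\<lambda>r. u r + c * r) has_real_derivative d) (at r) \<and> d \<le> 0"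
        using Vc[OF r] by (intro exI[of _ "- T.V r + c"]) (auto simp: V_def)
    qed (use r1 in auto)
    then have "u r1 \<le> s2 - c * \<rho>" using \<rho> by (simp add: r1_def algebra_simps)
    moreover have "e \<le> c * \<rho>"
    proof -
      have "2 ^ (N - 1) * e \<le> \<rho> * V \<rho>" using d(2) \<rho>V by linarith
      then show ?thesis by (simp add: c_def pos_le_divide_eq mult_ac)
    qed
    ultimately show False using neg by simp
  qed
  have ur1_low: "a - 8 * d \<le> u r1" using fall[of r1] r1 kr1 by simp
  have b_less: "b < u t" if "0 \<le> t" "t \<le> r1" for t
  proof -
    have "u r1 \<le> u t" using dec[of t r1] that by (cases "t = r1") auto
    moreover have "b < a - 8 * d" using d ordering e by linarith
    ultimately show ?thesis using ur1_low by simp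
  qed
  have N2: "1 \<le> real N - 2" using N by simp
  define H where "H = (\<lambda>r. potential N a (\<lambda>t. g A (u t)) r - r * V r / (real N - 2))"
  have H: "H r = u r - r * V r / (real N - 2)" if "0 \<le> r" for r using T.u_eq[OF that] by (simp add: H_def)
  have "H r1 \<le> H \<rho>"
  proof (rule decreasing_of_deriv[of \<rho> r1 H])
    have der: "(H has_real_derivative - (t * g A (u t)) / (real N - 2)) (at t)" if "0 < t" for t
      unfolding H_def V_def by (rule potential_minus_flux_deriv[OF that N T.source_cont])
    show "continuous_on {\<rho>..r1} H"
      using \<rho>0 by (intro continuous_at_imp_continuous_on ballI DERIV_isCont[OF der]) auto
    fix t assume t: "\<rho> < t" "t < r1"
    have "0 < g A (u t)" using t \<rho>0 by (intro g_pos[OF A] b_less) auto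
    then show "\<exists>d. (H has_real_derivative d) (at t) \<and> d \<le> 0"
      using der[of t] t \<rho>0 N2 by (intro exI[of _ "- (t * g A (u t)) / (real N - 2)"]) (auto simp: divide_nonpos_pos)
  qed (use r1 in auto)
  moreover have "H \<rho> \<le> \<alpha>s - e"
  proof -
    have "3 * e \<le> d / (real N - 2)" using d(1) N2 by (simp add: pos_le_divide_eq mult_ac)
    also have "\<dots> \<le> \<rho> * V \<rho> / (real N - 2)" using \<rho>V N2 by (intro divide_right_mono) auto
    finally show ?thesis using H[of \<rho>] \<rho> by simp
  qed
  ultimately have H1: "H r1 \<le> \<alpha>s - e" by simp
  have rV: "r1 * V r1 \<le> 16 * d"
  proof -
    have "r1 * V r1 \<le> r1 * ((2 * k) * r1)" using upper[of r1] r1 by (intro mult_left_mono) auto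
    also have "\<dots> = 2 * (k * r1\<^sup>2)" by (simp add: power2_eq_square)
    finally show ?thesis using kr1 by simp
  qed
  have rV0: "0 \<le> r1 * V r1" using V[of r1] r1 by simp
  have "r1 * V r1 / (real N - 2) \<le> r1 * V r1 / 1" using N2 rV0 by (intro divide_left_mono) auto
  then have "\<alpha>s - 24 * d \<le> H r1" using H[of r1] r1 ur1_low rV ordering e by simp
  moreover have "r1 \<le> 2 * sqrt (2 * N * d / m) / A" using \<rho> r0_eq by (simp add: r1_def)
  ultimately show ?thesis using r1 ur1 rV rV0 H1 H[of r1] by (intro exI[of _ r1]) auto
qed

end

section \<open>A new ground state above the old ones\<close>

context extension_step
begin

text \<open>Suppose that for each large \<open>A\<close> there is a solution with nonnegative energy, and
  let \<open>A\<close> tend to infinity. By \<open>exit_state\<close> the solutions leave the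
  upper pieces at radii \<open>r1\<close> tending to 0. Beyond \<open>r1\<close> each of them
  differs from a regular potential \<open>z\<close> with bounded source and starting height
  \<open>H\<close> by a harmonic function whose coefficients tend to 0. Along a subsequence
  the functions \<open>z\<close> converge to a solution of the base problem with starting
  height in \<open>{\<alpha>s - 24 * d..\<alpha>s - e}\<close> and nonnegative energy,
  contrary to \<open>low_start\<close>.\<close>

lemma large_parameter:
  "\<exists>A1\<ge>1. \<forall>u. radial_sol N (g A1) a u \<longrightarrow> (\<exists>r\<ge>0. shot.E N (g A1) u r < 0)"
proof (rule ccontr)
  assume "\<not> ?thesis"
  then have bad: "\<exists>u. radial_sol N (g A) a u \<and> (\<forall>r\<ge>0. 0 \<le> shot.E N (g A) u r)" if "1 \<le> A" for A
    using that by (meson not_less)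
  \<comment> \<open>from \<open>A = L\<close> on, the amplified piece dominates the bound \<open>G0\<close> on the base\<close>
  define L where "L = max 1 (sqrt (G0 / m))"
  define A where "A n = L + real n" for n :: nat
  have A1: "1 \<le> A n" for n by (simp add: A_def L_def add_increasing2)
  have A0: "0 < A n" for n using A1[of n] by simp
  have AG: "G0 \<le> (A n)\<^sup>2 * m" for n
  proof -
    have "sqrt (G0 / m) \<le> A n" by (simp add: A_def L_def add_increasing2)
    then have "(sqrt (G0 / m))\<^sup>2 \<le> (A n)\<^sup>2" using G0(1) m by (intro power_mono) auto
    then show ?thesis using G0(1) m by (simp add: pos_divide_le_eq)
  qed
  obtain u where u: "\<And>n. radial_sol N (g (A n)) a (u n)" "\<And>n r. 0 \<le> r \<Longrightarrow> 0 \<le> shot.E N (g (A n)) (u n) r"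
    using bad[OF A1] by metis
  define V where "V n = flux N (\<lambda>t. g (A n) (u n t))" for n
  define \<kappa> where "\<kappa> = 2 * sqrt (2 * N * d / m)"
  obtain r1 where r1: "\<And>n. 0 < r1 n" "\<And>n. r1 n \<le> \<kappa> / A n" "\<And>n. u n (r1 n) \<le> s1"
    "\<And>n. 0 \<le> r1 n * V n (r1 n)" "\<And>n. r1 n * V n (r1 n) \<le> 16 * d"
    "\<And>n. \<alpha>s - 24 * d \<le> u n (r1 n) - r1 n * V n (r1 n) / (real N - 2)"
    "\<And>n. u n (r1 n) - r1 n * V n (r1 n) / (real N - 2) \<le> \<alpha>s - e"
    using exit_state[OF A0 AG u] unfolding V_def \<kappa>_def by metis
  define H where "H n = u n (r1 n) - r1 n * V n (r1 n) / (real N - 2)" for n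
  have N2: "1 \<le> real N - 2" "0 < N" using N by simp_all
  have T: "transversal_shot N (g (A n)) b a (u n)" for n by (rule transversal[OF A0 u(1)])
  then have S: "shot N (g (A n)) b a (u n)" for n by (simp add: transversal_shot_def)
  have dec: "u n y < u n x" if "0 \<le> x" "x < y" for n x y
  proof -
    interpret T: transversal_shot N "g (A n)" b a "u n" by (rule T)
    have "0 < T.V t" if "0 < t" for t using T.V_pos[of t t] u(2)[of t n] that by simp
    then show ?thesis using that by (intro T.u_strict_antimono) auto
  qed
  have r1_lim: "r1 \<longlonglongrightarrow> 0"
  proof (rule tendsto_sandwich[of "\<lambda>_. 0" _ _ "\<lambda>n. \<kappa> * (1 / A n)"])
    have "filterlim A at_top sequentially"
      unfolding A_def by (rule filterlim_tendsto_add_at_top[OF tendsto_const filterlim_real_sequentially])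
    then have "(\<lambda>n. inverse (A n)) \<longlonglongrightarrow> 0" by (rule tendsto_inverse_0_at_top)
    then have "(\<lambda>n. \<kappa> * inverse (A n)) \<longlonglongrightarrow> \<kappa> * 0" by (intro tendsto_intros)
    then show "(\<lambda>n. \<kappa> * (1 / A n)) \<longlonglongrightarrow> 0" by (simp add: inverse_eq_divide)
    show "\<forall>\<^sub>F n in sequentially. 0 \<le> r1 n" using r1(1) by (simp add: less_imp_le)
    show "\<forall>\<^sub>F n in sequentially. r1 n \<le> \<kappa> * (1 / A n)" using r1(2) by simp
  qed simp
  \<comment> \<open>the source of the regular part: inside the exit radius it keeps its value at the exit\<close>
  define k where "k n t = g0 (u n (max t (r1 n)))" for n t
  have low: "u n (max t (r1 n)) \<le> s1" for n t
    using dec[of "r1 n" t n] r1(1)[of n] r1(3)[of n] by (cases "t \<le> r1 n") (auto simp: max_def)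
  have k_bound: "\<bar>k n t\<bar> \<le> G0" for n t unfolding k_def by (rule G0(2)[OF low])
  have u_cont: "continuous_on {0..} (u n)" for n using u(1)[of n] by (simp add: radial_sol_def)
  have k_cont: "continuous_on {0..} (k n)" for n
    unfolding k_def using r1(1)[of n]
    by (intro continuous_on_compose2[OF W.g_cont] continuous_on_compose2[OF u_cont] continuous_intros) auto
  have src_cont: "continuous_on {0..} (\<lambda>t. g (A n) (u n t))" for n
    by (rule shot.source_cont[OF S])
  define z where "z n = potential N (H n) (k n)" for n
  have agree: "g (A n) (u n t) = k n t" if "r1 n \<le> t" for n t
    using low[of n t] that by (simp add: k_def max_absorb1 g_low)
  have flux_k: "\<bar>flux N (k n) r\<bar> \<le> G0 * r" if "0 \<le> r" for n r
  proof -
    have "\<bar>flux N (k n) r\<bar> \<le> G0 * r / N"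
      using that N2 by (intro flux_abs_le continuous_on_subset[OF k_cont] k_bound) auto
    also have "\<dots> \<le> G0 * r / 1" using that N2 G0(1) by (intro divide_left_mono) auto
    finally show ?thesis by simp
  qed
  have z_lip: "\<bar>z n y - z n x\<bar> \<le> G0 * R * (y - x)" if "0 \<le> x" "x \<le> y" "y \<le> R" for n R x y
  proof -
    have "\<bar>z n y - z n x\<bar> \<le> G0 * R / N * \<bar>y - x\<bar>"
      unfolding z_def using that N2 by (intro potential_lipschitz k_cont k_bound) auto
    also have "\<dots> \<le> G0 * R / 1 * \<bar>y - x\<bar>"
      using that N2 G0(1) by (intro mult_right_mono divide_left_mono) auto
    finally show ?thesis using that by simp
  qed
  have flux_close: "r * \<bar>V n r - flux N (k n) r\<bar> \<le> r1 n / r * (16 * d + G0 * (r1 n)\<^sup>2)" if r: "r1 n \<le> r" for n r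
  proof -
    have r0: "0 < r" using r r1(1)[of n] by simp
    have "r ^ (N - 1) * (V n r - flux N (k n) r) = r1 n ^ (N - 1) * (V n (r1 n) - flux N (k n) (r1 n))"
      unfolding V_def using sources_agree_beyond(1)[OF N src_cont k_cont agree r1(1) r] .
    then have "V n r - flux N (k n) r = (r1 n / r) ^ (N - 1) * (V n (r1 n) - flux N (k n) (r1 n))"
      using r0 by (simp add: power_divide field_simps)
    moreover obtain j where j: "N - 1 = Suc (Suc j)" using N by (metis Suc_diff_Suc diff_Suc_1 less_imp_Suc_add add_2_eq_Suc add_Suc numeral_2_eq_2)
    ultimately have "r * (V n r - flux N (k n) r) = (r1 n / r) ^ Suc j * (r1 n * V n (r1 n) - r1 n * flux N (k n) (r1 n))"
      using r0 by (simp add: field_simps)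
    then have "r * \<bar>V n r - flux N (k n) r\<bar> = (r1 n / r) ^ Suc j * \<bar>r1 n * V n (r1 n) - r1 n * flux N (k n) (r1 n)\<bar>"
      using r0 r1(1)[of n] by (metis abs_mult abs_of_pos zero_less_divide_iff zero_less_power)
    also have "\<dots> \<le> (r1 n / r) * (16 * d + G0 * (r1 n)\<^sup>2)"
    proof (rule mult_mono)
      have "(r1 n / r) ^ j \<le> 1" using r0 r r1(1)[of n] by (intro power_le_one) auto
      then show "(r1 n / r) ^ Suc j \<le> r1 n / r" using mult_left_le[of "(r1 n / r) ^ j" "r1 n / r"] r0 r1(1)[of n] by simp
      have "r1 n * \<bar>flux N (k n) (r1 n)\<bar> \<le> r1 n * (G0 * r1 n)"
        using flux_k[of "r1 n" n] r1(1)[of n] by (intro mult_left_mono) auto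
      moreover have "\<bar>r1 n * flux N (k n) (r1 n)\<bar> = r1 n * \<bar>flux N (k n) (r1 n)\<bar>"
        using r1(1)[of n] by (simp add: abs_mult)
      ultimately show "\<bar>r1 n * V n (r1 n) - r1 n * flux N (k n) (r1 n)\<bar> \<le> 16 * d + G0 * (r1 n)\<^sup>2"
        using r1(4)[of n] r1(5)[of n] unfolding power2_eq_square by (simp add: mult_ac)
    qed (use r0 r1(1)[of n] in auto)
    finally show ?thesis .
  qed
  have triangle: "\<bar>x + y + w\<bar> \<le> 2 * p + q" if "\<bar>x\<bar> \<le> p" "\<bar>y\<bar> \<le> p" "\<bar>w\<bar> \<le> q" for x y w p q :: real
    using that by linarith
  have sol_close: "\<bar>u n r - z n r\<bar> \<le> 2 * G0 * (r1 n)\<^sup>2 + r1 n / r * (16 * d + G0 * (r1 n)\<^sup>2)" if r: "r1 n \<le> r" for n r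
  proof -
    have r0: "0 < r" using r r1(1)[of n] by simp
    have u_eq: "u n t = potential N a (\<lambda>t. g (A n) (u n t)) t" if "0 \<le> t" for t
      using u(1)[of n] that by (simp add: radial_sol_def)
    have "(u n r - r * V n r / (real N - 2)) - (z n r - r * flux N (k n) r / (real N - 2))
       = (u n (r1 n) - r1 n * V n (r1 n) / (real N - 2)) - (z n (r1 n) - r1 n * flux N (k n) (r1 n) / (real N - 2))"
      using sources_agree_beyond(2)[OF N src_cont k_cont agree r1(1) r, where a = a and c = "H n"] u_eq[of r] u_eq[of "r1 n"] r0 r1(1)[of n]
      by (simp add: V_def z_def)
    also have "\<dots> = (z n 0 - z n (r1 n)) + r1 n * flux N (k n) (r1 n) / (real N - 2)"
      by (simp add: H_def z_def)
    finally have "u n r - z n r = (z n 0 - z n (r1 n)) + r1 n * flux N (k n) (r1 n) / (real N - 2)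
        + r * (V n r - flux N (k n) r) / (real N - 2)"
      by (simp add: algebra_simps diff_divide_distrib)
    moreover have "\<bar>z n 0 - z n (r1 n)\<bar> \<le> G0 * (r1 n)\<^sup>2"
      using z_lip[of 0 "r1 n" "r1 n" n] r1(1)[of n] by (simp add: power2_eq_square abs_minus_commute mult_ac)
    moreover have "\<bar>r1 n * flux N (k n) (r1 n) / (real N - 2)\<bar> \<le> G0 * (r1 n)\<^sup>2"
    proof -
      have "\<bar>r1 n * flux N (k n) (r1 n) / (real N - 2)\<bar> = r1 n * \<bar>flux N (k n) (r1 n)\<bar> / (real N - 2)"
        using N2 r1(1)[of n] by (simp add: abs_mult)
      also have "\<dots> \<le> r1 n * \<bar>flux N (k n) (r1 n)\<bar> / 1"
        using N2 r1(1)[of n] by (intro divide_left_mono) auto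
      also have "\<dots> \<le> r1 n * (G0 * r1 n)" using flux_k[of "r1 n" n] r1(1)[of n] by simp
      finally show ?thesis by (simp add: power2_eq_square mult_ac)
    qed
    moreover have "\<bar>r * (V n r - flux N (k n) r) / (real N - 2)\<bar> \<le> r1 n / r * (16 * d + G0 * (r1 n)\<^sup>2)"
    proof -
      have "\<bar>r * (V n r - flux N (k n) r) / (real N - 2)\<bar> = r * \<bar>V n r - flux N (k n) r\<bar> / (real N - 2)"
        using N2 r0 by (simp add: abs_mult)
      also have "\<dots> \<le> r * \<bar>V n r - flux N (k n) r\<bar> / 1" using N2 r0 by (intro divide_left_mono) auto
      finally show ?thesis using flux_close[OF r] by simp
    qed
    ultimately show ?thesis using triangle[of _ "G0 * (r1 n)\<^sup>2"] by (simp only: mult.assoc)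
  qed
  have "H n \<in> {\<alpha>s - 24 * d..\<alpha>s - e}" for n using r1(6,7)[of n] by (simp add: H_def)
  then obtain h j1 where j1: "h \<in> {\<alpha>s - 24 * d..\<alpha>s - e}" "strict_mono (j1 :: nat \<Rightarrow> nat)" "(H \<circ> j1) \<longlonglongrightarrow> h"
    using compact_Icc[of "\<alpha>s - 24 * d" "\<alpha>s - e"] unfolding compact_def by metis
  have h: "0 < h" "h < \<alpha>s" using j1(1) d(3) e ordering by auto
  obtain j2 z0 where j2: "strict_mono (j2 :: nat \<Rightarrow> nat)" and z0_cont: "continuous_on {0..} z0"
    and z0_lim: "\<forall>R. uniform_limit {0..R} (\<lambda>n. (\<lambda>n. z (j1 n)) (j2 n)) z0 sequentially"
  proof (rule locally_lipschitz_subsequence[of "\<lambda>n. z (j1 n)" "\<bar>\<alpha>s\<bar> + \<bar>24 * d\<bar> + \<bar>e\<bar>" G0])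
    show "\<bar>z (j1 n) 0\<bar> \<le> \<bar>\<alpha>s\<bar> + \<bar>24 * d\<bar> + \<bar>e\<bar>" for n
      using \<open>\<And>n. H n \<in> {\<alpha>s - 24 * d..\<alpha>s - e}\<close>[of "j1 n"] by (auto simp: z_def)
  qed (use G0(1) z_lip in blast)+
  define j where "j = j1 \<circ> j2"
  have j: "strict_mono j" unfolding j_def using j1 j2 by (simp add: strict_mono_o)
  have Hlim: "(\<lambda>n. H (j n)) \<longlonglongrightarrow> h"
    using LIMSEQ_subseq_LIMSEQ[OF j1(3) j2] by (simp add: j_def o_def)
  have zlim: "(\<lambda>n. z (j n) r) \<longlonglongrightarrow> z0 r" if "0 \<le> r" for r
    using tendsto_uniform_limitI[OF z0_lim[rule_format, of r], of r] that by (simp add: j_def)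
  have rlim: "(\<lambda>n. r1 (j n)) \<longlonglongrightarrow> 0" using LIMSEQ_subseq_LIMSEQ[OF r1_lim j] by (simp add: o_def)
  have after: "\<forall>\<^sub>F n in sequentially. r1 (j n) \<le> r" if "0 < r" for r
    using order_tendstoD(2)[OF rlim that] by (rule eventually_mono) simp
  have err: "(\<lambda>n. r1 (j n) / r * (16 * d + G0 * (r1 (j n))\<^sup>2)) \<longlonglongrightarrow> 0" if "0 < r" for r
  proof -
    have "(\<lambda>n. r1 (j n) / r * (16 * d + G0 * (r1 (j n))\<^sup>2)) \<longlonglongrightarrow> 0 / r * (16 * d + G0 * 0\<^sup>2)"
      using that by (intro tendsto_intros rlim) auto
    then show ?thesis by simp
  qed
  have ulim: "(\<lambda>n. u (j n) r) \<longlonglongrightarrow> z0 r" if r: "0 < r" for r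
  proof -
    have "(\<lambda>n. 2 * G0 * (r1 (j n))\<^sup>2 + r1 (j n) / r * (16 * d + G0 * (r1 (j n))\<^sup>2)) \<longlonglongrightarrow> 2 * G0 * 0\<^sup>2 + 0"
      by (intro tendsto_intros rlim err r)
    then have "(\<lambda>n. 2 * G0 * (r1 (j n))\<^sup>2 + r1 (j n) / r * (16 * d + G0 * (r1 (j n))\<^sup>2)) \<longlonglongrightarrow> 0" by simp
    moreover have "\<forall>\<^sub>F n in sequentially. norm (u (j n) r - z (j n) r) \<le> 2 * G0 * (r1 (j n))\<^sup>2 + r1 (j n) / r * (16 * d + G0 * (r1 (j n))\<^sup>2)"
      using after[OF r] by (rule eventually_mono) (simp only: real_norm_def sol_close)
    ultimately have "(\<lambda>n. u (j n) r - z (j n) r) \<longlonglongrightarrow> 0" by (rule Lim_null_comparison[rotated])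
    from tendsto_add[OF this zlim[of r]] r show ?thesis by simp
  qed
  have klim: "(\<lambda>n. k (j n) t) \<longlonglongrightarrow> g0 (z0 t)" if t: "0 < t" for t
  proof -
    have "(\<lambda>n. g0 (u (j n) t)) \<longlonglongrightarrow> g0 (z0 t)"
      using W.g_cont by (intro isCont_tendsto_compose[OF _ ulim[OF t]]) (simp add: continuous_on_eq_continuous_at)
    moreover have "\<forall>\<^sub>F n in sequentially. g0 (u (j n) t) = k (j n) t"
      using after[OF t] by (rule eventually_mono) (simp add: k_def max_absorb1)
    ultimately show ?thesis by (rule Lim_transform_eventually)
  qed
  have "z0 r = potential N h (\<lambda>t. g0 (z0 t)) r" if r: "0 \<le> r" for r
  proof (rule LIMSEQ_unique[OF zlim[OF r]])
    show "(\<lambda>n. z (j n) r) \<longlonglongrightarrow> potential N h (\<lambda>t. g0 (z0 t)) r"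
      unfolding z_def by (rule potential_dominated_limit[OF N k_cont k_bound klim r Hlim])
  qed
  then have z0_sol: "radial_sol N g0 h z0" using z0_cont by (simp add: radial_sol_def)
  interpret Z: transversal_shot N g0 b h z0 by (rule transversal_low) (use h e z0_sol in auto)
  have Epos: "0 \<le> Z.E r" if r: "0 < r" for r
  proof -
    have "(\<lambda>n. r * \<bar>V (j n) r - flux N (k (j n)) r\<bar>) \<longlonglongrightarrow> 0"
    proof (rule tendsto_sandwich[OF _ _ tendsto_const err[OF r]])
      show "\<forall>\<^sub>F n in sequentially. 0 \<le> r * \<bar>V (j n) r - flux N (k (j n)) r\<bar>" using r by simp
      show "\<forall>\<^sub>F n in sequentially. r * \<bar>V (j n) r - flux N (k (j n)) r\<bar> \<le> r1 (j n) / r * (16 * d + G0 * (r1 (j n))\<^sup>2)"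
        using after[OF r] by (rule eventually_mono) (rule flux_close)
    qed
    from tendsto_mult_left[OF this, of "1 / r"] r
    have "(\<lambda>n. \<bar>V (j n) r - flux N (k (j n)) r\<bar>) \<longlonglongrightarrow> 0" by simp
    then have "(\<lambda>n. V (j n) r - flux N (k (j n)) r) \<longlonglongrightarrow> 0" by (rule tendsto_rabs_zero_cancel)
    moreover have "(\<lambda>n. flux N (k (j n)) r) \<longlonglongrightarrow> Z.V r"
      using r by (intro flux_dominated_limit[OF N k_cont k_bound klim]) auto
    ultimately have "(\<lambda>n. (V (j n) r - flux N (k (j n)) r) + flux N (k (j n)) r) \<longlonglongrightarrow> 0 + Z.V r"
      by (rule tendsto_add)
    then have Vlim: "(\<lambda>n. V (j n) r) \<longlonglongrightarrow> Z.V r" by simp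
    have "isCont (primitive g0) (z0 r)" using Z.primitive_deriv DERIV_isCont by blast
    then have "(\<lambda>n. primitive g0 (u (j n) r)) \<longlonglongrightarrow> primitive g0 (z0 r)"
      by (rule isCont_tendsto_compose[OF _ ulim[OF r]])
    then have "(\<lambda>n. (V (j n) r)\<^sup>2 / 2 + primitive g0 (u (j n) r)) \<longlonglongrightarrow> (Z.V r)\<^sup>2 / 2 + primitive g0 (z0 r)"
      by (intro tendsto_intros Vlim) auto
    moreover have "\<forall>\<^sub>F n in sequentially. 0 \<le> (V (j n) r)\<^sup>2 / 2 + primitive g0 (u (j n) r)"
      using after[OF r]
    proof (rule eventually_mono)
      fix n assume "r1 (j n) \<le> r"
      then have "u (j n) r \<le> s1" using low[of "j n" r] by (simp add: max_absorb1)
      then show "0 \<le> (V (j n) r)\<^sup>2 / 2 + primitive g0 (u (j n) r)"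
        using u(2)[of r "j n"] r by (simp add: shot.E_def[OF S] V_def primitive_low)
    qed
    ultimately show ?thesis unfolding Z.E_def by (intro tendsto_lowerbound[where F = sequentially]) auto
  qed
  obtain r where r: "0 \<le> r" "Z.E r < 0" using low_start[OF h z0_sol] by blast
  have "Z.E (r + 1) \<le> Z.E r" using r by (intro Z.E_antimono) auto
  then show False using Epos[of "r + 1"] r by simp
qed

theorem new_ground_state:
  obtains A u where "0 < A" "radial_sol N (g A) a u" "\<And>r. 0 \<le> r \<Longrightarrow> 0 < u r" "(u \<longlongrightarrow> 0) at_top"
proof -
  obtain A0 where A0: "0 < A0" "A0 \<le> 1" "\<And>u. radial_sol N (g A0) a u \<Longrightarrow> \<exists>r\<ge>0. u r < 0"
    using small_parameter by blast
  obtain A1 where A1: "1 \<le> A1" "\<And>u. radial_sol N (g A1) a u \<Longrightarrow> \<exists>r\<ge>0. shot.E N (g A1) u r < 0"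
    using large_parameter by blast
  interpret F: shooting_family N g a A0 A1 "max G0 (2 * m * A1\<^sup>2)" b
  proof (intro shooting_family.intro continuous_family.intro shooting_family_axioms.intro)
    show "N > 2" "A0 \<le> A1" using N A0 A1 by auto
    show "continuous_on ({A0..A1} \<times> UNIV) (\<lambda>(c, s). g c s)"
      by (rule continuous_on_subset[OF g_joint]) auto
    show "\<bar>g c s\<bar> \<le> max G0 (2 * m * A1\<^sup>2)" if "c \<in> {A0..A1}" for c s
    proof -
      have "2 * m * c\<^sup>2 \<le> 2 * m * A1\<^sup>2" using that A0 m by (intro mult_left_mono power_mono) auto
      then show ?thesis using g_bound[of c s] by linarith
    qed
    show "g c s = 0" if "c \<in> {A0..A1}" "s \<le> 0" for c s
      using that W.g_0 ordering e by (simp add: g_low)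
    show "transversal_shot N (g c) b a u" if "c \<in> {A0..A1}" "radial_sol N (g c) a u" for c u
      using that A0 by (intro transversal) auto
  qed
  obtain c u where cu: "c \<in> {A0..A1}" "radial_sol N (g c) a u" "\<And>r. 0 \<le> r \<Longrightarrow> 0 < u r" "(u \<longlongrightarrow> 0) at_top"
    using F.shooting[OF A0(3) A1(2)] by blast
  show ?thesis by (rule that[of c u]) (use cu A0 in auto)
qed

end

section \<open>Radial functions on Euclidean space\<close>

text \<open>The quotient \<open>u' r / r\<close>, continuous up to the centre. The gradient of \<open>u
  (norm x)\<close> is \<open>slope * x\<close>, so that no case distinction at the origin is
  needed in the formulas for the derivatives.\<close>

definition slope :: "nat \<Rightarrow> (real \<Rightarrow> real) \<Rightarrow> real \<Rightarrow> real" where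
  "slope N h r = - integral {0..1} (\<lambda>x. x ^ (N - 1) * h (r * x))"

lemma flux_slope: "flux N h r = - r * slope N h r"
  by (simp add: flux_def slope_def)

lemma slope_0: "0 < N \<Longrightarrow> slope N h 0 = - h 0 / N"
  using flux_const[of N "h 0" 1] by (simp add: slope_def flux_def)

lemma slope_cont:
  assumes h: "continuous_on {0..} h" shows "continuous_on {0..} (slope N h)"
proof -
  have "continuous_on ({0..} \<times> cbox 0 (1::real)) (\<lambda>(r, x). x ^ (N - 1) * h (r * x))"
    unfolding case_prod_beta by (intro continuous_intros continuous_on_compose2[OF h]) auto
  then have "continuous_on {0..} (\<lambda>r. integral (cbox 0 1) (\<lambda>x. x ^ (N - 1) * h (r * x)))"
    by (rule integral_continuous_on_param)
  then show ?thesis unfolding slope_def by (intro continuous_intros) simp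
qed

lemma slope_deriv:
  assumes h: "continuous_on {0..} h" and r: "0 < r" and N: "0 < N"
  shows "(slope N h has_real_derivative - (h r + N * slope N h r) / r) (at r)"
proof -
  have "((\<lambda>r. - flux N h r / r) has_real_derivative
      (- (h r - (real N - 1) / r * flux N h r) * r - - flux N h r * 1) / (r * r)) (at r)"
    by (intro DERIV_divide DERIV_minus flux_deriv h r N DERIV_ident) (use r in auto)
  moreover have "(- (h r - (real N - 1) / r * flux N h r) * r - - flux N h r * 1) / (r * r) = - (h r + N * slope N h r) / r"
    using r by (simp add: flux_slope field_simps)
  ultimately have "((\<lambda>r. - flux N h r / r) has_real_derivative - (h r + N * slope N h r) / r) (at r)"
    by (rule DERIV_cong)
  then show ?thesis
    by (rule has_field_derivative_transform_within_open[of _ _ _ "{0<..}"]) (use r in \<open>auto simp: flux_slope\<close>)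
qed

lemma radial_first_derivative:
  fixes x :: "real ^ 'n::finite"
  assumes h: "continuous_on {0..} h"
  shows "((\<lambda>x. potential N a h (norm x)) has_derivative (\<lambda>v. slope N h (norm x) * (x \<bullet> v))) (at x)"
proof (cases "x = 0")
  case False
  then have nx: "0 < norm x" by simp
  have 1: "(norm has_derivative (\<lambda>v. v \<bullet> sgn x)) (at x)" using False by (rule has_derivative_norm)
  have 2: "(potential N a h has_derivative (\<lambda>t. - flux N h (norm x) * t)) (at (norm x))"
    using potential_deriv_at[OF nx h, of N a] by (simp only: has_field_derivative_def)
  have "((\<lambda>x. potential N a h (norm x)) has_derivative (\<lambda>v. - flux N h (norm x) * (v \<bullet> sgn x))) (at x)"
    using has_derivative_compose[OF 1 2] by simp
  moreover have "(\<lambda>v. - flux N h (norm x) * (v \<bullet> sgn x)) = (\<lambda>v. slope N h (norm x) * (x \<bullet> v))"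
    using nx by (auto simp: flux_slope sgn_div_norm inner_commute)
  ultimately show ?thesis by simp
next
  case True
  have "(potential N a h has_real_derivative 0) (at 0 within {0..})"
    using potential_deriv[OF _ h, of 0 N a] by simp
  then have lim: "((\<lambda>r. (potential N a h r - a) / r) \<longlongrightarrow> 0) (at 0 within {0..})"
    by (simp add: has_field_derivative_iff)
  have "filterlim (norm :: real ^ 'n \<Rightarrow> real) (at 0 within {0..}) (at 0)"
    unfolding filterlim_at
    by (auto simp: eventually_at_filter intro!: tendsto_norm_zero tendsto_ident_at)
  from filterlim_compose[OF lim this]
  have "((\<lambda>x::real ^ 'n. (potential N a h (norm x) - a) / norm x) \<longlongrightarrow> 0) (at 0)" .
  then have "((\<lambda>x::real ^ 'n. norm ((potential N a h (norm x) - a) / norm x)) \<longlongrightarrow> 0) (at 0)"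
    by (rule tendsto_norm_zero)
  then have "((\<lambda>x::real ^ 'n. norm (potential N a h (norm x) - a) / norm x) \<longlongrightarrow> 0) (at 0)"
    by (simp add: norm_divide)
  then show ?thesis using True by (simp add: has_derivative_at)
qed

text \<open>At \<open>x = 0\<close> the first summand is 0 by the convention for division by 0. Its
  coefficient \<open>h + N * slope\<close> vanishes at the centre, which makes the second
  derivatives continuous there.\<close>

lemma radial_second_derivative:
  fixes x :: "real ^ 'n::finite"
  assumes h: "continuous_on {0..} h" and N: "0 < N"
  shows "((\<lambda>x. slope N h (norm x) * x $ i) has_derivative
    (\<lambda>v. - (h (norm x) + N * slope N h (norm x)) * (x \<bullet> v) * x $ i / (norm x)\<^sup>2 + slope N h (norm x) * v $ i)) (at x)"
proof (cases "x = 0")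
  case False
  then have nx: "0 < norm x" by simp
  have 1: "(norm has_derivative (\<lambda>v. v \<bullet> sgn x)) (at x)" using False by (rule has_derivative_norm)
  have 2: "(slope N h has_derivative (\<lambda>t. - (h (norm x) + N * slope N h (norm x)) / norm x * t)) (at (norm x))"
    using slope_deriv[OF h nx N] by (simp only: has_field_derivative_def)
  have 3: "((\<lambda>x. slope N h (norm x)) has_derivative (\<lambda>v. - (h (norm x) + N * slope N h (norm x)) / norm x * (v \<bullet> sgn x))) (at x)"
    using has_derivative_compose[OF 1 2] by simp
  have 4: "((\<lambda>x. x $ i) has_derivative (\<lambda>v. v $ i)) (at x)"
    by (rule bounded_linear_imp_has_derivative[OF bounded_linear_vec_nth])
  have "((\<lambda>x. slope N h (norm x) * x $ i) has_derivative
     (\<lambda>v. slope N h (norm x) * v $ i + - (h (norm x) + N * slope N h (norm x)) / norm x * (v \<bullet> sgn x) * x $ i)) (at x)"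
    by (rule has_derivative_mult[OF 3 4])
  moreover have "(\<lambda>v. slope N h (norm x) * v $ i + - (h (norm x) + N * slope N h (norm x)) / norm x * (v \<bullet> sgn x) * x $ i)
    = (\<lambda>v. - (h (norm x) + N * slope N h (norm x)) * (x \<bullet> v) * x $ i / (norm x)\<^sup>2 + slope N h (norm x) * v $ i)"
    using nx by (auto simp: sgn_div_norm inner_commute power2_eq_square divide_inverse)
  ultimately show ?thesis by simp
next
  case True
  have "(slope N h \<longlongrightarrow> slope N h 0) (at 0 within {0..})"
    using slope_cont[OF h, of N] by (simp add: continuous_on_def)
  then have lim: "((\<lambda>r. slope N h r - slope N h 0) \<longlongrightarrow> 0) (at 0 within {0..})" by (simp add: LIM_zero)
  have "filterlim (norm :: real ^ 'n \<Rightarrow> real) (at 0 within {0..}) (at 0)"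
    unfolding filterlim_at
    by (auto simp: eventually_at_filter intro!: tendsto_norm_zero tendsto_ident_at)
  from filterlim_compose[OF lim this]
  have lim0: "((\<lambda>x::real ^ 'n. slope N h (norm x) - slope N h 0) \<longlongrightarrow> 0) (at 0)" .
  have "((\<lambda>x::real ^ 'n. norm (slope N h (norm x) * x $ i - slope N h 0 * x $ i) / norm x) \<longlongrightarrow> 0) (at 0)"
  proof (rule Lim_null_comparison[OF _ tendsto_norm_zero[OF lim0]])
    have "norm (norm (slope N h (norm x) * x $ i - slope N h 0 * x $ i) / norm x) \<le> norm (slope N h (norm x) - slope N h 0)"
      for x :: "real ^ 'n"
    proof (cases "x = 0")
      case nz: False
      have "norm (slope N h (norm x) * x $ i - slope N h 0 * x $ i) = norm (slope N h (norm x) - slope N h 0) * \<bar>x $ i\<bar>"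
        by (simp add: abs_mult flip: left_diff_distrib)
      also have "\<dots> \<le> norm (slope N h (norm x) - slope N h 0) * norm x"
        by (intro mult_left_mono component_le_norm_cart) auto
      finally show ?thesis using nz by (simp add: pos_divide_le_eq)
    qed simp
    then show "\<forall>\<^sub>F x::real ^ 'n in at 0. norm (norm (slope N h (norm x) * x $ i - slope N h 0 * x $ i) / norm x) \<le> norm (slope N h (norm x) - slope N h 0)"
      by (intro always_eventually) blast
  qed
  then show ?thesis
    using True bounded_linear_mult_right[THEN bounded_linear_compose, OF bounded_linear_vec_nth[of i], of "slope N h 0"]
    by (simp add: has_derivative_at)
qed

lemma radial_lift:
  fixes h :: "real \<Rightarrow> real" and a :: real
  assumes h: "continuous_on {0..} h" and N: "N = CARD('n::finite)"
  defines "u \<equiv> (\<lambda>x::real ^ 'n. potential N a h (norm x))"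
  shows "C2_fun u" "laplacian u x = - h (norm x)"
proof -
  have N0: "0 < N" using N by simp
  have p1: "partial_derivative i u = (\<lambda>x. slope N h (norm x) * x $ i)" for i
    unfolding partial_derivative_def u_def frechet_derivative_at[OF radial_first_derivative[OF h], symmetric]
    by (simp add: inner_axis)
  have p2: "partial_derivative j (\<lambda>x::real ^ 'n. slope N h (norm x) * x $ i) =
     (\<lambda>x. - (h (norm x) + N * slope N h (norm x)) * (x $ j) * x $ i / (norm x)\<^sup>2 + slope N h (norm x) * axis j 1 $ i)" for i j
    unfolding partial_derivative_def frechet_derivative_at[OF radial_second_derivative[OF h N0], symmetric]
    by (simp add: inner_axis)
  have hc: "continuous_on UNIV (\<lambda>x::real ^ 'n. h (norm x))"
    by (intro continuous_on_compose2[OF h] continuous_intros) auto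
  have sc: "continuous_on UNIV (\<lambda>x::real ^ 'n. slope N h (norm x))"
    by (intro continuous_on_compose2[OF slope_cont[OF h]] continuous_intros) auto
  let ?\<xi> = "\<lambda>x::real ^ 'n. - (h (norm x) + N * slope N h (norm x))"
  have \<xi>: "continuous_on UNIV ?\<xi>" by (intro continuous_intros hc sc)
  have \<xi>0: "?\<xi> 0 = 0" using N0 by (simp add: slope_0)
  have q: "continuous_on UNIV (\<lambda>x. ?\<xi> x * (x $ j) * x $ i / (norm x)\<^sup>2)" for i j
    unfolding continuous_on_eq_continuous_at[OF open_UNIV]
  proof
    fix x :: "real ^ 'n"
    have \<xi>x: "isCont ?\<xi> x" for x using \<xi> by (simp add: continuous_on_eq_continuous_at)
    show "isCont (\<lambda>x. ?\<xi> x * (x $ j) * x $ i / (norm x)\<^sup>2) x"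
    proof (cases "x = 0")
      case False
      then show ?thesis by (intro continuous_intros \<xi>x) auto
    next
      case True
      have lim: "(?\<xi> \<longlongrightarrow> 0) (at 0)" using \<xi>x[of 0] \<xi>0 unfolding isCont_def by simp
      have bnd: "norm (?\<xi> y * (y $ j) * y $ i / (norm y)\<^sup>2) \<le> norm (?\<xi> y)" for y :: "real ^ 'n"
      proof (cases "y = 0")
        case nz: False
        have "\<bar>y $ j\<bar> * \<bar>y $ i\<bar> \<le> norm y * norm y" by (intro mult_mono component_le_norm_cart) auto
        then have "\<bar>?\<xi> y\<bar> * (\<bar>y $ j\<bar> * \<bar>y $ i\<bar>) \<le> \<bar>?\<xi> y\<bar> * (norm y)\<^sup>2"
          unfolding power2_eq_square by (rule mult_left_mono) simp
        then have "\<bar>?\<xi> y\<bar> * \<bar>y $ j\<bar> * \<bar>y $ i\<bar> / (norm y)\<^sup>2 \<le> \<bar>?\<xi> y\<bar>" using nz by (simp add: pos_divide_le_eq mult.assoc)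
        then show ?thesis by (simp only: real_norm_def abs_mult abs_divide abs_power2 abs_norm_cancel)
      qed simp
      have "((\<lambda>y. ?\<xi> y * (y $ j) * y $ i / (norm y)\<^sup>2) \<longlongrightarrow> 0) (at 0)"
        by (rule Lim_null_comparison[OF always_eventually[OF allI[OF bnd]] tendsto_norm_zero[OF lim]])
      then show ?thesis using True unfolding isCont_def by simp
    qed
  qed
  have C1p: "C1_fun (\<lambda>x::real ^ 'n. slope N h (norm x) * x $ i)" for i
    unfolding C1_fun_def p2
    by (intro conjI allI differentiableI[OF radial_second_derivative[OF h N0]]
        continuous_on_add q continuous_on_mult sc continuous_on_const)
  have "C1_fun u"
    unfolding C1_fun_def p1 unfolding u_def
    by (intro conjI allI differentiableI[OF radial_first_derivative[OF h]] continuous_intros sc)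
  then show "C2_fun u" unfolding C2_fun_def p1 using C1p by simp
  have "laplacian u x = (\<Sum>i\<in>UNIV. ?\<xi> x / (norm x)\<^sup>2 * (x $ i * x $ i) + slope N h (norm x))"
    unfolding laplacian_def p1 p2 by (intro sum.cong) (auto simp: axis_def)
  also have "\<dots> = ?\<xi> x / (norm x)\<^sup>2 * (\<Sum>i\<in>UNIV. x $ i * x $ i) + N * slope N h (norm x)"
    by (simp add: sum.distrib sum_distrib_left N)
  also have "(\<Sum>i\<in>UNIV. x $ i * x $ i) = (norm x)\<^sup>2"
    by (simp add: power2_norm_eq_inner inner_vec_def)
  also have "?\<xi> x / (norm x)\<^sup>2 * (norm x)\<^sup>2 + N * slope N h (norm x) = - h (norm x)"
    using \<xi>0 by (cases "x = 0") auto
  finally show "laplacian u x = - h (norm x)" .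
qed

theorem ground_profile_lift:
  fixes u :: "real \<Rightarrow> real"
  assumes N: "N = CARD('n::finite)" "N > 2" and g: "continuous_on UNIV g" and sol: "radial_sol N g a u"
    and pos: "\<And>r. 0 \<le> r \<Longrightarrow> 0 < u r" and le: "\<And>r. 0 \<le> r \<Longrightarrow> u r \<le> a" and lim: "(u \<longlongrightarrow> 0) at_top"
    and a: "ereal a < \<gamma>" and eq: "\<And>s. 0 < s \<Longrightarrow> s \<le> a \<Longrightarrow> f s = g s"
  shows "ground_state \<gamma> f (\<lambda>x::real ^ 'n. u (norm x))" "radially_symmetric (\<lambda>x::real ^ 'n. u (norm x))"
proof -
  show "radially_symmetric (\<lambda>x::real ^ 'n. u (norm x))" by (simp add: radially_symmetric_def)
  have uc: "continuous_on {0..} u" and u_eq: "\<And>r. 0 \<le> r \<Longrightarrow> u r = potential N a (\<lambda>t. g (u t)) r"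
    using sol by (auto simp: radial_sol_def)
  have h: "continuous_on {0..} (\<lambda>t. g (u t))" by (rule continuous_on_compose2[OF g uc]) auto
  have U: "(\<lambda>x::real ^ 'n. u (norm x)) = (\<lambda>x. potential N a (\<lambda>t. g (u t)) (norm x))" using u_eq by auto
  have lap: "laplacian (\<lambda>x::real ^ 'n. u (norm x)) x = - g (u (norm x))" for x
    unfolding U by (rule radial_lift(2)[OF h N(1)])
  have limU: "((\<lambda>x::real ^ 'n. u (norm x)) \<longlongrightarrow> 0) at_infinity"
    by (rule filterlim_compose[OF lim filterlim_norm_at_top])
  have "\<not> (\<lambda>x::real ^ 'n. u (norm x)) constant_on UNIV"
  proof
    assume "(\<lambda>x::real ^ 'n. u (norm x)) constant_on UNIV"
    then obtain c where c: "\<And>x::real ^ 'n. u (norm x) = c" unfolding constant_on_def by auto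
    then have "((\<lambda>x::real ^ 'n. c) \<longlongrightarrow> 0) at_infinity" using limU by simp
    then have "c = 0" by (rule tendsto_unique[OF trivial_limit_at_infinity tendsto_const])
    then show False using c[of 0] pos[of 0] by simp
  qed
  moreover have "C2_fun (\<lambda>x::real ^ 'n. u (norm x))" unfolding U by (rule radial_lift(1)[OF h N(1)])
  moreover have "ereal (u (norm x)) < \<gamma>" for x :: "real ^ 'n"
    using le[of "norm x"] a by (meson ereal_less_eq(3) le_less_trans norm_ge_zero)
  ultimately show "ground_state \<gamma> f (\<lambda>x::real ^ 'n. u (norm x))"
    unfolding ground_state_def using pos le lap limU eq by simp
qed

section \<open>Gluing many nonlinearities\<close>

text \<open>The bound by the starting height \<open>a\<close> makes the profile independent of the values
  of the nonlinearity above \<open>a\<close>.\<close>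

definition ground_profile :: "nat \<Rightarrow> (real \<Rightarrow> real) \<Rightarrow> real \<Rightarrow> (real \<Rightarrow> real) \<Rightarrow> bool" where
  "ground_profile N g a u \<longleftrightarrow>
     radial_sol N g a u \<and> (\<forall>r\<ge>0. 0 < u r \<and> u r \<le> a) \<and> (u \<longlongrightarrow> 0) at_top"

lemma radial_sol_0:
  assumes "radial_sol N g a u" shows "u 0 = a"
proof -
  have "u 0 = potential N a (\<lambda>t. g (u t)) 0" using assms unfolding radial_sol_def by blast
  then show ?thesis by (simp only: potential_0)
qed

lemma ground_profile_cong:
  assumes "ground_profile N g a u" "\<And>s. s \<le> a \<Longrightarrow> g' s = g s"
  shows "ground_profile N g' a u"
proof -
  have "potential N a (\<lambda>t. g' (u t)) = potential N a (\<lambda>t. g (u t))"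
    using assms by (intro ext potential_cong) (auto simp: ground_profile_def)
  then have "radial_sol N g' a u \<longleftrightarrow> radial_sol N g a u" by (simp only: radial_sol_def)
  then show ?thesis using assms(1) by (simp add: ground_profile_def)
qed

lemma (in transversal_shot) ground_profileI:
  assumes "\<And>r. 0 \<le> r \<Longrightarrow> 0 < u r" "(u \<longlongrightarrow> 0) at_top"
  shows "ground_profile N g a u"
proof -
  have V: "0 < V r" if "0 < r" for r
    using V_pos[of r r] tends_to_zero_imp_energy_nonneg[OF assms(2), of r] that by simp
  have "u r \<le> a" if "0 \<le> r" for r
    using u_antimono[of 0 r] V that u_0 by (simp add: less_imp_le)
  then show ?thesis using assms sol by (simp add: ground_profile_def)
qed

locale base_problem =
  fixes N :: nat and f1 :: "real \<Rightarrow> real" and b \<beta> \<alpha>s :: real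
  assumes N: "N > 2"
    and f1_cont: "continuous_on {0..} f1"
    and f1_C1: "f1 C1_differentiable_on {0<..}"
    and f1_0: "f1 0 = 0"
    and b_nonneg: "b \<ge> 0"
    and f1_pos: "\<forall>s>b. f1 s > 0"
    and f1_nonpos: "\<forall>s\<in>{0..b}. f1 s \<le> 0"
    and f1_neg: "\<exists>e>0. \<forall>s\<in>{0<..<e}. f1 s < 0"
    and \<beta>: "\<beta> \<ge> b" "primitive f1 \<beta> = 0"
    and subcrit: "\<forall>s>\<beta>. deriv (\<lambda>t. primitive f1 t / f1 t) s > (real N - 2) / (2 * real N)"
    and superlin: "mono_on {b<..} (\<lambda>s. f1 s / (s - b))"
    and \<alpha>s: "ground_state_initial_value N f1 \<alpha>s"
begin

definition "g0 s = f1 (max s 0)"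

lemma g0_eq: "0 \<le> s \<Longrightarrow> g0 s = f1 s"
  by (simp add: g0_def)

lemma b: "0 < b"
proof (rule ccontr)
  assume "\<not> 0 < b"
  then have "b = 0" using b_nonneg by simp
  obtain e where "e > 0" "\<forall>s\<in>{0<..<e}. f1 s < 0" using f1_neg by blast
  then have "f1 (e / 2) < 0" "f1 (e / 2) > 0" using f1_pos \<open>b = 0\<close> by auto
  then show False by simp
qed

lemma g0_cont: "continuous_on UNIV g0"
  unfolding g0_def by (intro continuous_on_compose2[OF f1_cont] continuous_intros) auto

lemma g0_well: "well N g0 b h"
proof
  obtain \<epsilon> where "0 < \<epsilon>" "\<forall>s\<in>{0<..<\<epsilon>}. f1 s < 0" using f1_neg by blast
  then show "\<exists>e>0. \<forall>s\<in>{0<..<e}. g0 s < 0" by (intro exI[of _ \<epsilon>]) (auto simp: g0_eq)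
  show "g0 s = 0" if "s \<le> 0" for s using that f1_0 by (simp add: g0_def)
  show "g0 s \<le> 0" if "0 \<le> s" "s \<le> b" for s using that f1_nonpos by (simp add: g0_eq)
  show "0 < g0 s" if "b < s" for s using that f1_pos b by (simp add: g0_eq)
qed (use N g0_cont b in auto)

lemma primitive_g0: "primitive g0 s = primitive f1 s"
  unfolding primitive_def by (intro integral_cong) (simp add: g0_eq)

text \<open>The initial value is positive because the energy at the centre is: it decreases to a
  nonnegative limit, and if it were 0 throughout, the profile would be constant.\<close>

lemma profile:
  obtains U where "ground_profile N g0 \<alpha>s U" "0 < primitive g0 \<alpha>s" "0 < \<alpha>s"
proof -
  obtain U where ivp: "radial_ivp_solution N f1 \<alpha>s U" and pos: "\<And>r. 0 < r \<Longrightarrow> 0 < U r" and lim: "(U \<longlongrightarrow> 0) at_top"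
    using \<alpha>s unfolding ground_state_initial_value_def by blast
  have sol: "radial_sol N g0 \<alpha>s U"
    using radial_ivp_imp_radial_sol[OF N ivp pos f1_cont] unfolding g0_def .
  interpret S: shot N g0 b \<alpha>s U
    using g0_well sol by (simp add: shot_def shot_axioms_def)
  have E: "0 \<le> S.E r" if "0 \<le> r" for r using S.tends_to_zero_imp_energy_nonneg[OF lim that] .
  have Epos: "0 < S.E 0"
  proof (rule ccontr)
    assume "\<not> 0 < S.E 0"
    then have E0: "S.E r = 0" if "0 \<le> r" for r using E[OF that] S.E_antimono[of 0 r] that by simp
    have V0: "S.V r = 0" if r: "0 < r" for r
    proof -
      have "(S.E has_real_derivative 0) (at r)"
        by (rule has_field_derivative_transform_within_open[of "\<lambda>_. 0" _ _ "{0<..}"]) (use r E0 in auto)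
      then have "- (real N - 1) / r * (S.V r)\<^sup>2 = 0" by (rule DERIV_unique[OF S.E_deriv[OF r]])
      then show ?thesis using r N by simp
    qed
    have const: "U r = U 1" if "1 \<le> r" for r
    proof (cases "r = 1")
      case False
      show ?thesis
      proof (rule DERIV_isconst_end[of 1 r U])
        show "continuous_on {1..r} U" by (rule continuous_on_subset[OF S.u_cont]) auto
        show "(U has_real_derivative 0) (at x)" if "1 < x" "x < r" for x
          using S.u_deriv[of x] V0[of x] that by simp
      qed (use that False in auto)
    qed simp
    have "\<forall>\<^sub>F r in at_top. U r < U 1" using order_tendstoD(2)[OF lim] pos[of 1] by simp
    then obtain R where R: "\<And>r. R \<le> r \<Longrightarrow> U r < U 1" by (auto simp: eventually_at_top_linorder)
    then show False using const[of "max R 1"] R[of "max R 1"] by simp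
  qed
  then have F: "0 < primitive g0 \<alpha>s" by (simp add: S.E_0)
  then have a: "0 < \<alpha>s" using S.primitive_0[of \<alpha>s] by force
  have pos': "0 < U r" if "0 \<le> r" for r using pos[of r] that S.u_0 a by (cases "r = 0") auto
  interpret transversal_shot N g0 b \<alpha>s U
  proof
    show "0 < \<alpha>s" by (rule a)
  qed (use pos' in \<open>force dest: less_imp_le\<close>)
  show ?thesis by (rule that[OF ground_profileI[OF pos' lim] F a])
qed

lemma \<beta>_less: "\<beta> < \<alpha>s" and b_less: "b < \<alpha>s" and \<alpha>s_pos: "0 < \<alpha>s"
proof -
  interpret w: well N g0 b \<alpha>s by (rule g0_well)
  obtain F: "0 < primitive g0 \<alpha>s" and a: "0 < \<alpha>s" using profile by blast
  show "0 < \<alpha>s" by (rule a)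
  show b1: "b < \<alpha>s" using w.primitive_neg[of \<alpha>s] a F by force
  show "\<beta> < \<alpha>s"
  proof (rule ccontr)
    assume "\<not> \<beta> < \<alpha>s"
    then have le: "\<alpha>s \<le> \<beta>" by simp
    have "- primitive g0 \<beta> \<le> - primitive g0 \<alpha>s"
    proof (rule decreasing_of_deriv[OF le, of "\<lambda>s. - primitive g0 s"])
      show "continuous_on {\<alpha>s..\<beta>} (\<lambda>s. - primitive g0 s)" by (intro continuous_intros w.primitive_cont)
      fix t assume "\<alpha>s < t" "t < \<beta>"
      then show "\<exists>d. ((\<lambda>s. - primitive g0 s) has_real_derivative d) (at t) \<and> d \<le> 0"
        using f1_pos b b1 by (intro exI[of _ "- g0 t"] conjI DERIV_minus w.primitive_deriv) (auto simp: g0_eq less_imp_le)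
    qed
    then show False using F \<beta>(2) by (simp add: primitive_g0)
  qed
qed

text \<open>The bound on \<open>deriv\<close> carries information only together with differentiability,
  which comes from \<open>f1\<close> being continuously differentiable and positive above
  \<open>b\<close>.\<close>

lemma quotient_deriv:
  assumes s: "\<beta> < s"
  shows "\<exists>q. ((\<lambda>t. primitive g0 t / g0 t) has_real_derivative q) (at s) \<and> (real N - 2) / (2 * real N) < q"
proof -
  interpret w: well N g0 b \<alpha>s by (rule g0_well)
  have s0: "0 < s" "b < s" using s \<beta> b by auto
  obtain D where D: "\<And>x. x \<in> {0<..} \<Longrightarrow> (f1 has_vector_derivative D x) (at x)"
    using f1_C1 unfolding C1_differentiable_on_def by blast
  have f1': "(f1 has_real_derivative D s) (at s)"
    using D[of s] s0 by (simp add: has_real_derivative_iff_has_vector_derivative)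
  have F: "(primitive f1 has_real_derivative f1 s) (at s)"
    using w.primitive_deriv[of s] s0 primitive_g0 by (simp add: g0_eq primitive_g0[abs_def])
  have nz: "f1 s \<noteq> 0" using f1_pos s0 by (simp add: less_imp_neq[symmetric])
  have d: "((\<lambda>t. primitive f1 t / f1 t) has_real_derivative (f1 s * f1 s - primitive f1 s * D s) / (f1 s * f1 s)) (at s)"
    by (rule DERIV_divide[OF F f1' nz])
  define q where "q = (f1 s * f1 s - primitive f1 s * D s) / (f1 s * f1 s)"
  have "deriv (\<lambda>t. primitive f1 t / f1 t) s = q" using d unfolding q_def by (rule DERIV_imp_deriv)
  then have "(real N - 2) / (2 * real N) < q" using subcrit s by auto
  moreover have "((\<lambda>t. primitive g0 t / g0 t) has_real_derivative q) (at s)"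
    by (rule has_field_derivative_transform_within_open[OF d[folded q_def], of "{0<..}"])
       (use s0 in \<open>auto simp: primitive_g0 g0_eq\<close>)
  ultimately show ?thesis by blast
qed

lemma one_more_ground_state:
  assumes e: "0 < e" and g_cont: "continuous_on UNIV g" and low: "\<And>s. s \<le> \<alpha>s + e1 \<Longrightarrow> g s = g0 s"
    and e1: "0 < e1" "e1 \<le> e"
    and g_pos: "\<And>s. b < s \<Longrightarrow> s \<le> \<alpha>s + e \<Longrightarrow> 0 < g s"
    and K: "2 ^ N + 3 * real N \<le> K" and small: "24 * (K * e) < \<alpha>s - b"
    and \<phi>: "continuous_on {\<alpha>s + 2 * e..\<alpha>s + K * e} \<phi>" and m: "0 < m"
    and \<phi>_bounds: "\<And>s. \<alpha>s + 2 * e \<le> s \<Longrightarrow> s \<le> \<alpha>s + K * e \<Longrightarrow> m \<le> \<phi> s \<and> \<phi> s \<le> 2 * m"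
  shows "\<exists>A u. 0 < A \<and>
    ground_profile N (extension g \<phi> (\<alpha>s + e) (\<alpha>s + 2 * e) (\<alpha>s + K * e) A) (\<alpha>s + K * e) u \<and>
    (\<forall>s>b. 0 < extension g \<phi> (\<alpha>s + e) (\<alpha>s + 2 * e) (\<alpha>s + K * e) A s) \<and>
    continuous_on UNIV (extension g \<phi> (\<alpha>s + e) (\<alpha>s + 2 * e) (\<alpha>s + K * e) A)"
proof -
  obtain U where U: "ground_profile N g0 \<alpha>s U" using profile by blast
  have U': "ground_profile N g \<alpha>s U" by (rule ground_profile_cong[OF U]) (use low e1 in auto)
  have prim: "primitive g s = primitive g0 s" if "s \<le> \<alpha>s + e1" for s
    unfolding primitive_def using that low by (intro integral_cong) auto
  interpret w: well N g0 b \<alpha>s by (rule g0_well)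
  have N3: "3 \<le> real N" using N by simp
  have p2: "(2::real) ^ N = 2 * 2 ^ (N - 1)" using N by (metis gr_implies_not0 power_eq_if)
  interpret S: extension_step N g \<phi> U b \<beta> \<alpha>s e "\<alpha>s + K * e" m
  proof
    show "continuous_on UNIV g" by (rule g_cont)
    show "N > 2" "0 < b" by (fact N b)+
    show "g s = 0" if "s \<le> 0" for s using low[of s] w.g_0[OF that] that \<alpha>s_pos e1 by simp
    show "g s \<le> 0" if "0 \<le> s" "s \<le> b" for s using low[of s] w.g_nonpos[OF that] that b_less e1 by simp
    obtain \<epsilon> where \<epsilon>: "0 < \<epsilon>" "\<forall>s\<in>{0<..<\<epsilon>}. g0 s < 0" using w.g_neg by blast
    then show "\<exists>e>0. \<forall>s\<in>{0<..<e}. g s < 0"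
      using \<alpha>s_pos e1 low by (intro exI[of _ "min \<epsilon> \<alpha>s"]) auto
    show "0 < g s" if "b < s" "s \<le> \<alpha>s + e" for s by (rule g_pos[OF that])
    show "radial_sol N g \<alpha>s U" "(U \<longlongrightarrow> 0) at_top" "\<And>r. 0 \<le> r \<Longrightarrow> 0 < U r"
      using U' by (auto simp: ground_profile_def)
    show "g s / (s - b) \<le> g t / (t - b)" if "b < s" "s \<le> t" "t \<le> \<alpha>s" for s t
      using mono_onD[OF superlin, of s t] that b e1 low[of s] low[of t] by (simp add: g0_eq)
    show "b \<le> \<beta>" "\<beta> < \<alpha>s" by (fact \<beta>(1) \<beta>_less)+
    show "primitive g \<beta> = 0" using prim[of \<beta>] \<beta> \<beta>_less e1 by (simp add: primitive_g0)
    show "\<exists>q. ((\<lambda>t. primitive g t / g t) has_real_derivative q) (at s) \<and> (real N - 2) / (2 * real N) < q"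
      if s: "\<beta> < s" "s < \<alpha>s" for s
    proof -
      obtain q where q: "((\<lambda>t. primitive g0 t / g0 t) has_real_derivative q) (at s)" "(real N - 2) / (2 * real N) < q"
        using quotient_deriv[OF s(1)] by blast
      have "((\<lambda>t. primitive g t / g t) has_real_derivative q) (at s)"
        by (rule has_field_derivative_transform_within_open[OF q(1), of "{..<\<alpha>s}"])
           (use s e1 low prim in auto)
      then show ?thesis using q by blast
    qed
    show "0 < e" "0 < m" by (fact e m)+
    have gap: "\<alpha>s + K * e - (\<alpha>s + 2 * e) = (K - 2) * e" by (simp add: algebra_simps)
    have K1: "1 + 3 * real N \<le> K" by (rule order_trans[OF _ K]) simp
    show "3 * (real N - 2) * e \<le> \<alpha>s + K * e - (\<alpha>s + 2 * e)"
      unfolding gap using e K1 by (intro mult_right_mono) auto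
    show "2 ^ (N - 1) * e \<le> \<alpha>s + K * e - (\<alpha>s + 2 * e)"
    proof (unfold gap, rule mult_right_mono)
      have "0 \<le> (2::real) ^ (N - 1)" by simp
      then show "2 ^ (N - 1) \<le> K - 2" using K N3 unfolding p2 by linarith
    qed (use e in simp)
    show "24 * (\<alpha>s + K * e - (\<alpha>s + 2 * e)) < \<alpha>s - b" using small e by simp
    show "continuous_on {\<alpha>s + 2 * e..\<alpha>s + K * e} \<phi>" by (rule \<phi>)
    show "m \<le> \<phi> s \<and> \<phi> s \<le> 2 * m" if "\<alpha>s + 2 * e \<le> s" "s \<le> \<alpha>s + K * e" for s by (rule \<phi>_bounds[OF that])
  qed
  obtain A u where A: "0 < A" and u: "radial_sol N (S.g A) (\<alpha>s + K * e) u" "\<And>r. 0 \<le> r \<Longrightarrow> 0 < u r" "(u \<longlongrightarrow> 0) at_top"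
    using S.new_ground_state by blast
  interpret T: transversal_shot N "S.g A" b "\<alpha>s + K * e" u by (rule S.transversal[OF A u(1)])
  show ?thesis
    using A T.ground_profileI[OF u(2,3)] S.g_pos[OF A] S.g_cont[of A] unfolding S.g_def by blast
qed

text \<open>Induction on the number of pieces. The widths \<open>e i\<close> grow geometrically with ratio
  \<open>K\<close>, so that the \<open>i\<close>-th piece, of length \<open>(K - 2) * e (i -
  1)\<close>, dominates all that lies between \<open>\<alpha>s\<close> and its lower end.
  Every new ground state starts at the upper end of the newest piece; earlier ones do not
  reach it and persist.\<close>

lemma staircase:
  fixes e m :: "nat \<Rightarrow> real" and f :: "nat \<Rightarrow> real \<Rightarrow> real" and K :: real
  assumes e: "\<And>i. 0 < e i" "\<And>i. e (Suc i) = K * e i" and K: "2 ^ N + 3 * real N \<le> K"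
    and small: "24 * e k < \<alpha>s - b"
    and f_cont: "\<And>i. i \<in> {2..k} \<Longrightarrow> continuous_on {\<alpha>s..\<alpha>s + e k} (f i)"
    and m: "\<And>i. i \<in> {2..k} \<Longrightarrow> 0 < m i"
    and f_bounds: "\<And>i s. i \<in> {2..k} \<Longrightarrow> \<alpha>s \<le> s \<Longrightarrow> s \<le> \<alpha>s + e k \<Longrightarrow> m i \<le> f i s \<and> f i s \<le> 2 * m i"
    and n: "1 \<le> n" "n \<le> k"
  shows "\<exists>A g. (\<forall>i\<in>{2..n}. 0 < A i) \<and> continuous_on UNIV g \<and> (\<forall>s\<le>\<alpha>s + e 1. g s = g0 s) \<and>
     (\<forall>s. b < s \<and> s \<le> \<alpha>s + e n \<longrightarrow> 0 < g s) \<and>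
     (\<forall>i\<in>{2..n}. (\<forall>s\<in>{\<alpha>s + 2 * e (i - 1)..\<alpha>s + e i}. g s = (A i)\<^sup>2 * f i s) \<and>
        (\<exists>p c. \<forall>s\<in>{\<alpha>s + e (i - 1)..\<alpha>s + 2 * e (i - 1)}. g s = p * s + c)) \<and>
     (\<forall>i\<in>{1..n}. \<exists>u. ground_profile N g (if i = 1 then \<alpha>s else \<alpha>s + e i) u)"
  using n
proof (induction n rule: dec_induct)
  case base
  interpret w: well N g0 b \<alpha>s by (rule g0_well)
  obtain U where "ground_profile N g0 \<alpha>s U" using profile by blast
  moreover have "0 < g0 s" if "b < s" for s using f1_pos that b by (simp add: g0_eq)
  ultimately show ?case using g0_cont by (intro exI[of _ "\<lambda>_. 1"] exI[of _ g0]) auto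
next
  case (step n)
  have K2: "2 < K"
  proof -
    have "1 \<le> (2::real) ^ N" by simp
    moreover have "3 \<le> real N" using N by simp
    ultimately show ?thesis using K by linarith
  qed
  have e_step: "2 * e i < e (Suc i)" for i using K2 e(1)[of i] e(2)[of i] by simp
  have e_mono: "e i \<le> e j" if "i \<le> j" for i j
    using lift_Suc_mono_le[of e i j] e_step e(1) that by (smt (verit))
  obtain A g where A: "\<forall>i\<in>{2..n}. 0 < A i" and g: "continuous_on UNIV g" "\<forall>s\<le>\<alpha>s + e 1. g s = g0 s"
    and g_pos: "\<forall>s. b < s \<and> s \<le> \<alpha>s + e n \<longrightarrow> 0 < g s"
    and pieces: "\<And>i. i \<in> {2..n} \<Longrightarrow> (\<forall>s\<in>{\<alpha>s + 2 * e (i - 1)..\<alpha>s + e i}. g s = (A i)\<^sup>2 * f i s) \<and>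
        (\<exists>p c. \<forall>s\<in>{\<alpha>s + e (i - 1)..\<alpha>s + 2 * e (i - 1)}. g s = p * s + c)"
    and profiles: "\<And>i. i \<in> {1..n} \<Longrightarrow> \<exists>u. ground_profile N g (if i = 1 then \<alpha>s else \<alpha>s + e i) u"
    using step.IH step.prems by auto
  have ek: "e (Suc n) \<le> e k" using e_mono step.prems by simp
  have Sn: "Suc n \<in> {2..k}" using step by auto
  let ?s1 = "\<alpha>s + e n" and ?s2 = "\<alpha>s + 2 * e n" and ?a = "\<alpha>s + K * e n"
  have sub: "{?s2..?a} \<subseteq> {\<alpha>s..\<alpha>s + e k}" using ek e(1)[of n] e(2)[of n] by auto
  have "\<exists>A u. 0 < A \<and>
    ground_profile N (extension g (f (Suc n)) ?s1 ?s2 ?a A) ?a u \<and>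
    (\<forall>s>b. 0 < extension g (f (Suc n)) ?s1 ?s2 ?a A s) \<and>
    continuous_on UNIV (extension g (f (Suc n)) ?s1 ?s2 ?a A)"
  proof (rule one_more_ground_state[of "e n" g "e 1" K "f (Suc n)" "m (Suc n)"])
    show "0 < e n" "0 < e 1" "e 1 \<le> e n" using e(1) e_mono step.hyps by auto
    show "continuous_on UNIV g" by (rule g(1))
    show "g s = g0 s" if "s \<le> \<alpha>s + e 1" for s using g(2) that by blast
    show "0 < g s" if "b < s" "s \<le> ?s1" for s using g_pos that by blast
    show "2 ^ N + 3 * real N \<le> K" by (rule K)
    show "24 * (K * e n) < \<alpha>s - b" using small ek e(2)[of n] by linarith
    show "continuous_on {?s2..?a} (f (Suc n))" by (rule continuous_on_subset[OF f_cont[OF Sn] sub])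
    show "0 < m (Suc n)" by (rule m[OF Sn])
    show "m (Suc n) \<le> f (Suc n) s \<and> f (Suc n) s \<le> 2 * m (Suc n)" if "?s2 \<le> s" "s \<le> ?a" for s
      using f_bounds[OF Sn, of s] sub that by force
  qed
  then obtain c u where c: "0 < c" and u: "ground_profile N (extension g (f (Suc n)) ?s1 ?s2 ?a c) ?a u"
    and pos: "\<forall>s>b. 0 < extension g (f (Suc n)) ?s1 ?s2 ?a c s"
    and cont: "continuous_on UNIV (extension g (f (Suc n)) ?s1 ?s2 ?a c)"
    by blast
  define g' where "g' = extension g (f (Suc n)) ?s1 ?s2 ?a c"
  define A' where "A' = A(Suc n := c)"
  have en: "0 < e n" "?s1 < ?s2" "?s2 \<le> ?a" using e(1)[of n] K2 by auto
  have low: "g' s = g s" if "s \<le> ?s1" for s unfolding g'_def using en(2) that by (rule extension_low)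
  have new: "(\<forall>s\<in>{?s2..\<alpha>s + e (Suc n)}. g' s = c\<^sup>2 * f (Suc n) s) \<and> (\<exists>p q. \<forall>s\<in>{?s1..?s2}. g' s = p * s + q)"
  proof (intro conjI ballI)
    fix s assume "s \<in> {?s2..\<alpha>s + e (Suc n)}"
    then show "g' s = c\<^sup>2 * f (Suc n) s" unfolding g'_def using en e(2)[of n] by (simp add: extension_high)
  next
    let ?p = "(c\<^sup>2 * f (Suc n) ?s2 - g ?s1) / e n"
    have "g' s = ?p * s + (g ?s1 - ?p * ?s1)" if "s \<in> {?s1..?s2}" for s
    proof -
      have "g' s = (1 - (s - ?s1) / (?s2 - ?s1)) * g ?s1 + (s - ?s1) / (?s2 - ?s1) * (c\<^sup>2 * f (Suc n) ?s2)"
        unfolding g'_def using en that by (intro extension_mid) auto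
      also have "?s2 - ?s1 = e n" by simp
      also have "(1 - (s - ?s1) / e n) * g ?s1 + (s - ?s1) / e n * (c\<^sup>2 * f (Suc n) ?s2) = ?p * s + (g ?s1 - ?p * ?s1)"
        using en(1) by (simp add: field_simps)
      finally show ?thesis .
    qed
    then show "\<exists>p q. \<forall>s\<in>{?s1..?s2}. g' s = p * s + q" by blast
  qed
  have "(\<forall>s\<in>{\<alpha>s + 2 * e (i - 1)..\<alpha>s + e i}. g' s = (A' i)\<^sup>2 * f i s) \<and>
        (\<exists>p c. \<forall>s\<in>{\<alpha>s + e (i - 1)..\<alpha>s + 2 * e (i - 1)}. g' s = p * s + c)" if i: "i \<in> {2..Suc n}" for i
  proof (cases "i = Suc n")
    case True
    then show ?thesis using new by (simp add: A'_def)
  next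
    case False
    then have i': "i \<in> {2..n}" using i by auto
    have "e i \<le> e n" using e_mono i' by simp
    moreover have "2 * e (i - 1) \<le> e i" using e_step[of "i - 1"] i' by simp
    ultimately have "g' s = g s" if "s \<le> \<alpha>s + e i \<or> s \<le> \<alpha>s + 2 * e (i - 1)" for s
      using that by (intro low) auto
    moreover have "A' i = A i" using False by (simp add: A'_def)
    ultimately show ?thesis using pieces[OF i'] by simp
  qed
  moreover have "\<exists>u. ground_profile N g' (if i = 1 then \<alpha>s else \<alpha>s + e i) u" if i: "i \<in> {1..Suc n}" for i
  proof (cases "i = Suc n")
    case True
    then show ?thesis using u step.hyps e(2)[of n] by (auto simp: g'_def)
  next
    case False
    then have i': "i \<in> {1..n}" using i by auto
    obtain v where v: "ground_profile N g (if i = 1 then \<alpha>s else \<alpha>s + e i) v" using profiles[OF i'] by blast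
    have "e i \<le> e n" using e_mono i' by simp
    then have "ground_profile N g' (if i = 1 then \<alpha>s else \<alpha>s + e i) v"
      using en(1) by (intro ground_profile_cong[OF v] low) (auto split: if_splits)
    then show ?thesis by blast
  qed
  moreover have "\<forall>i\<in>{2..Suc n}. 0 < A' i" using A c by (auto simp: A'_def)
  moreover have "\<forall>s\<le>\<alpha>s + e 1. g' s = g0 s"
    using g(2) low e_mono[of 1 n] step.hyps by auto
  ultimately show ?case
    using cont pos unfolding g'_def[symmetric] by (intro exI[of _ A'] exI[of _ g']) auto
qed

end

text \<open>By continuity each \<open>f i\<close> stays within a third of its value at
  \<open>\<alpha>s\<close>; this gives the bounds \<open>2 / 3\<close> and \<open>4 /
  3\<close> times that value.\<close>

lemma uniform_near_endpoint:
  fixes f :: "nat \<Rightarrow> real \<Rightarrow> real" and \<gamma> :: ereal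
  assumes f_cont: "\<forall>i\<in>{2..k}. continuous_on {s. \<alpha>s \<le> s \<and> ereal s < \<gamma>} (f i)"
    and f_pos: "\<forall>i\<in>{2..k}. \<forall>s. \<alpha>s \<le> s \<and> ereal s < \<gamma> \<longrightarrow> f i s > 0"
    and \<gamma>: "ereal \<alpha>s < \<gamma>" and B: "0 < B"
  obtains \<delta> m where "0 < \<delta>" "\<delta> < B" "ereal (\<alpha>s + \<delta>) < \<gamma>"
    "\<And>i. i \<in> {2..k} \<Longrightarrow> 0 < m i"
    "\<And>i s. i \<in> {2..k} \<Longrightarrow> \<alpha>s \<le> s \<Longrightarrow> s \<le> \<alpha>s + \<delta> \<Longrightarrow> m i \<le> f i s \<and> f i s \<le> 2 * m i"
proof -
  let ?S = "{s. \<alpha>s \<le> s \<and> ereal s < \<gamma>}"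
  obtain z where z: "ereal \<alpha>s < ereal z" "ereal z < \<gamma>" using ereal_dense2[OF \<gamma>] by blast
  have pos0: "0 < f i \<alpha>s" if "i \<in> {2..k}" for i using f_pos that \<gamma> by simp
  have "\<exists>d>0. \<forall>s\<in>?S. dist s \<alpha>s < d \<longrightarrow> dist (f i s) (f i \<alpha>s) < f i \<alpha>s / 3" if i: "i \<in> {2..k}" for i
  proof -
    have "continuous_on ?S (f i)" "\<alpha>s \<in> ?S" "0 < f i \<alpha>s / 3" using f_cont i pos0[OF i] \<gamma> by auto
    then show ?thesis unfolding continuous_on_iff by blast
  qed
  then obtain d where d: "\<And>i. i \<in> {2..k} \<Longrightarrow> 0 < d i"
    "\<And>i s. i \<in> {2..k} \<Longrightarrow> s \<in> ?S \<Longrightarrow> dist s \<alpha>s < d i \<Longrightarrow> dist (f i s) (f i \<alpha>s) < f i \<alpha>s / 3"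
    by metis
  \<comment> \<open>all upper bounds that \<open>\<delta>\<close> has to respect\<close>
  define X where "X = insert (z - \<alpha>s) (insert B (d ` {2..k}))"
  define \<delta> where "\<delta> = Min X / 2"
  have X: "finite X" "X \<noteq> {}" "\<forall>x\<in>X. 0 < x" using z B d(1) by (auto simp: X_def)
  have \<delta>0: "0 < \<delta>" using X by (simp add: \<delta>_def)
  have "2 * \<delta> \<le> x" if "x \<in> X" for x using Min_le[OF X(1) that] by (simp add: \<delta>_def)
  then have \<delta>le: "2 * \<delta> \<le> z - \<alpha>s" "2 * \<delta> \<le> B" "i \<in> {2..k} \<Longrightarrow> 2 * \<delta> \<le> d i" for i
    unfolding X_def by blast+
  have \<gamma>': "ereal (\<alpha>s + \<delta>) < \<gamma>"
    using \<delta>0 \<delta>le(1) z(2) by (intro le_less_trans[OF _ z(2)]) simp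
  show ?thesis
  proof (rule that[of \<delta> "\<lambda>i. 2 / 3 * f i \<alpha>s"])
    fix i s assume i: "i \<in> {2..k}" and s: "\<alpha>s \<le> s" "s \<le> \<alpha>s + \<delta>"
    have "ereal s < \<gamma>" using s \<gamma>' by (meson ereal_less_eq(3) le_less_trans)
    then have "dist (f i s) (f i \<alpha>s) < f i \<alpha>s / 3"
      using s \<delta>0 \<delta>le(3)[OF i] by (intro d(2)[OF i]) (auto simp: dist_real_def)
    then have "\<bar>f i s - f i \<alpha>s\<bar> < f i \<alpha>s / 3" by (simp add: dist_real_def)
    then show "2 / 3 * f i \<alpha>s \<le> f i s \<and> f i s \<le> 2 * (2 / 3 * f i \<alpha>s)" by linarith
  qed (use \<delta>0 \<delta>le(2) \<gamma>' pos0 in auto)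
qed

theorem theorem1p4:
  fixes N k :: nat
    and f :: "nat \<Rightarrow> real \<Rightarrow> real"
    and b \<beta> \<alpha>s :: real
    and \<gamma> :: ereal
  assumes N: "N = CARD('n::finite)" "N > 2"
    and k: "k \<ge> 2"
    and f1_cont: "continuous_on {0..} (f 1)"
    and f1_C1: "(f 1) C1_differentiable_on {0<..}"
    and f1_0: "f 1 0 = 0"
    and b: "b \<ge> 0"
    and f1_pos: "\<forall>s>b. f 1 s > 0"
    and f1_nonpos: "\<forall>s\<in>{0..b}. f 1 s \<le> 0"
    and f1_neg: "\<exists>e>0. \<forall>s\<in>{0<..<e}. f 1 s < 0"
    and \<beta>: "\<beta> \<ge> b" "primitive (f 1) \<beta> = 0"
    and \<beta>_unique: "\<forall>s\<ge>b. primitive (f 1) s = 0 \<longrightarrow> s = \<beta>"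
    and subcrit: "\<forall>s>\<beta>. deriv (\<lambda>t. primitive (f 1) t / f 1 t) s > (real N - 2) / (2 * real N)"
    and superlin: "mono_on {b<..} (\<lambda>s. f 1 s / (s - b))"
    and \<alpha>s: "ground_state_initial_value N (f 1) \<alpha>s"
    and \<gamma>: "ereal \<alpha>s < \<gamma>"
    and fi_cont: "\<forall>i\<in>{2..k}. continuous_on {s. \<alpha>s \<le> s \<and> ereal s < \<gamma>} (f i)"
    and fi_pos: "\<forall>i\<in>{2..k}. \<forall>s. \<alpha>s \<le> s \<and> ereal s < \<gamma> \<longrightarrow> f i s > 0"
  shows "\<exists>\<epsilon> A \<alpha> :: nat \<Rightarrow> real.
           (\<forall>i\<in>{1..k - 1}. \<epsilon> i > 0) \<and>
           (\<forall>i\<in>{2..k}. A i > 0) \<and>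
           \<alpha> 1 = \<alpha>s + \<epsilon> 1 \<and>
           (\<forall>i\<in>{2..k - 1}. \<alpha>s < \<alpha> (i - 1) + \<epsilon> (i - 1) \<and> \<alpha> (i - 1) + \<epsilon> (i - 1) < \<alpha> i) \<and>
           ereal (\<alpha> (k - 1) + \<epsilon> (k - 1)) < \<gamma> \<and>
           (\<exists>g. glued \<gamma> k f \<alpha>s \<epsilon> A \<alpha> g \<and>
                (\<exists>U :: (real ^ 'n \<Rightarrow> real) set. finite U \<and> card U = k \<and>
                     (\<forall>u\<in>U. ground_state \<gamma> g u \<and> radially_symmetric u)))"
proof -
  interpret P: base_problem N "f 1" b \<beta> \<alpha>s
    by unfold_locales (fact N(2) f1_cont f1_C1 f1_0 b f1_pos f1_nonpos f1_neg \<beta> subcrit superlin \<alpha>s)+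
  have "0 < (\<alpha>s - b) / 24" using P.b_less by simp
  then obtain \<delta> m where \<delta>: "0 < \<delta>" "\<delta> < (\<alpha>s - b) / 24" "ereal (\<alpha>s + \<delta>) < \<gamma>"
    and m: "\<And>i. i \<in> {2..k} \<Longrightarrow> 0 < m i"
    and bounds: "\<And>i s. i \<in> {2..k} \<Longrightarrow> \<alpha>s \<le> s \<Longrightarrow> s \<le> \<alpha>s + \<delta> \<Longrightarrow> m i \<le> f i s \<and> f i s \<le> 2 * m i"
    using uniform_near_endpoint[OF fi_cont fi_pos \<gamma>] by blast
  define K where "K = 2 ^ N + 3 * real N"
  have K: "2 < K"
  proof -
    have "1 \<le> (2::real) ^ N" by simp
    moreover have "3 \<le> real N" using N by simp
    ultimately show ?thesis unfolding K_def by linarith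
  qed
  \<comment> \<open>normalised so that the last piece ends at \<open>\<alpha>s + \<delta>\<close>\<close>
  define e where "e i = \<delta> * K ^ i / K ^ k" for i
  have e_pos: "0 < e i" for i using \<delta> K by (simp add: e_def)
  have e_Suc: "e (Suc i) = K * e i" for i by (simp add: e_def)
  have ek: "e k = \<delta>" using K by (simp add: e_def)
  have e_step: "2 * e i < e (Suc i)" for i using K e_pos[of i] e_Suc[of i] by simp
  have e_less: "e i < e j" if "i < j" for i j
    using lift_Suc_mono_less[of e i j] e_step e_pos that by (smt (verit))
  have below_\<gamma>: "ereal s < \<gamma>" if "s \<le> \<alpha>s + \<delta>" for s
    using that \<delta>(3) by (meson ereal_less_eq(3) le_less_trans)
  have fi_cont': "continuous_on {\<alpha>s..\<alpha>s + e k} (f i)" if "i \<in> {2..k}" for i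
    by (rule continuous_on_subset[OF bspec[OF fi_cont that]]) (use below_\<gamma> in \<open>auto simp: ek\<close>)
  obtain A g where A: "\<forall>i\<in>{2..k}. 0 < A i" and g: "continuous_on UNIV g" "\<forall>s\<le>\<alpha>s + e 1. g s = P.g0 s"
    and pieces: "\<And>i. i \<in> {2..k} \<Longrightarrow> (\<forall>s\<in>{\<alpha>s + 2 * e (i - 1)..\<alpha>s + e i}. g s = (A i)\<^sup>2 * f i s) \<and>
        (\<exists>p c. \<forall>s\<in>{\<alpha>s + e (i - 1)..\<alpha>s + 2 * e (i - 1)}. g s = p * s + c)"
    and profiles: "\<And>i. i \<in> {1..k} \<Longrightarrow> \<exists>u. ground_profile N g (if i = 1 then \<alpha>s else \<alpha>s + e i) u"
    using P.staircase[of e K k f m k] e_pos e_Suc \<delta> fi_cont' m bounds k unfolding ek K_def by auto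
  define h where "h i = (if i = 1 then \<alpha>s else \<alpha>s + e i)" for i :: nat
  have h_le: "h i \<le> \<alpha>s + \<delta>" if "i \<in> {1..k}" for i
    using that e_less[of i k] ek \<delta>(1) by (cases "i = k") (auto simp: h_def)
  define G where "G s = (if s \<le> \<alpha>s + \<delta> then g s else (A k)\<^sup>2 * f k s)" for s
  have kk: "k \<in> {2..k}" using k by simp
  have e_km: "2 * e (k - 1) < \<delta>" using e_step[of "k - 1"] k ek by simp
  have top: "g s = (A k)\<^sup>2 * f k s" if "\<alpha>s + 2 * e (k - 1) \<le> s" "s \<le> \<alpha>s + \<delta>" for s
    using pieces[OF kk] that ek by auto
  have G_eq: "G s = g s" if "s \<le> \<alpha>s + \<delta>" for s using that by (simp add: G_def)
  have e_le: "e i \<le> \<delta>" if "i \<le> k" for i using that e_less[of i k] ek by (cases "i = k") auto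
  have e_pair: "2 * e (i - 1) < e i" if "1 \<le> i" for i using e_step[of "i - 1"] that by simp
  have glued: "glued \<gamma> k f \<alpha>s e A (\<lambda>i. \<alpha>s + e i) G"
    unfolding glued_def
  proof (intro conjI ballI allI impI)
    let ?S = "{s. 0 \<le> s \<and> ereal s < \<gamma>}"
    show "continuous_on ?S G"
      unfolding G_def
    proof (rule continuous_on_cases_le[where h = "\<lambda>s. s"])
      show "continuous_on {t \<in> ?S. \<alpha>s + \<delta> \<le> t} (\<lambda>s. (A k)\<^sup>2 * f k s)"
        using \<delta>(1) by (intro continuous_on_mult continuous_on_const continuous_on_subset[OF bspec[OF fi_cont kk]]) auto
      show "continuous_on {t \<in> ?S. t \<le> \<alpha>s + \<delta>} g" by (rule continuous_on_subset[OF g(1)]) simp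
      fix t assume "t \<in> ?S" "t = \<alpha>s + \<delta>"
      then show "g t = (A k)\<^sup>2 * f k t" using e_km by (intro top) auto
    qed (rule continuous_on_id)
  next
    fix s assume "s \<in> {0..\<alpha>s + e 1}"
    then show "G s = f 1 s" using g(2) e_le[of 1] k P.g0_eq[of s] by (simp add: G_eq)
  next
    fix i s assume i: "i \<in> {2..k - 1}" and s: "s \<in> {\<alpha>s + e (i - 1) + e (i - 1)..\<alpha>s + e i}"
    have i': "i \<in> {2..k}" using i by auto
    have "s \<le> \<alpha>s + \<delta>" using s e_le[of i] i' by simp
    then show "G s = (A i)\<^sup>2 * f i s" using pieces[OF i'] s by (simp add: G_eq)
  next
    fix s assume s: "\<alpha>s + e (k - 1) + e (k - 1) \<le> s \<and> ereal s < \<gamma>"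
    then show "G s = (A k)\<^sup>2 * f k s" using top[of s] by (simp add: G_def)
  next
    fix i assume i: "i \<in> {2..k}"
    obtain p c where pc: "\<forall>s\<in>{\<alpha>s + e (i - 1)..\<alpha>s + 2 * e (i - 1)}. g s = p * s + c"
      using pieces[OF i] by blast
    have "G s = p * s + c" if s: "s \<in> {\<alpha>s + e (i - 1)..\<alpha>s + e (i - 1) + e (i - 1)}" for s
    proof -
      have "s \<le> \<alpha>s + \<delta>" using s e_le[of i] e_pair[of i] i by simp
      then show ?thesis using pc s by (simp add: G_eq)
    qed
    then show "\<exists>m c. \<forall>s\<in>{\<alpha>s + e (i - 1)..\<alpha>s + e (i - 1) + e (i - 1)}. G s = m * s + c" by blast
  qed
  obtain u where u: "\<And>i. i \<in> {1..k} \<Longrightarrow> ground_profile N g (h i) (u i)"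
    using profiles unfolding h_def by metis
  define L where "L i = (\<lambda>x::real ^ 'n. u i (norm x))" for i
  have ground: "ground_state \<gamma> G (L i) \<and> radially_symmetric (L i)" if i: "i \<in> {1..k}" for i
    unfolding L_def
    using ground_profile_lift[OF N g(1), of "h i" "u i" \<gamma> G] u[OF i] h_le[OF i] below_\<gamma>[OF h_le[OF i]]
    by (simp add: ground_profile_def G_eq)
  have L0: "L i 0 = h i" if i: "i \<in> {1..k}" for i
    using u[OF i] unfolding L_def ground_profile_def by (simp add: radial_sol_0[of N g])
  have h_inj: "h i \<noteq> h j" if "i \<in> {1..k}" "j \<in> {1..k}" "i < j" for i j
    using that e_less[of i j] e_pos[of j] by (auto simp: h_def)
  have "inj_on L {1..k}"
  proof (rule inj_onI, rule ccontr)
    fix i j assume ij: "i \<in> {1..k}" "j \<in> {1..k}" "L i = L j" "i \<noteq> j"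
    then have "h i = h j" using L0[of i] L0[of j] by simp
    then show False using h_inj[of i j] h_inj[of j i] ij by (cases i j rule: linorder_cases) auto
  qed
  then have card: "card (L ` {1..k}) = k" by (simp add: card_image)
  show ?thesis
  proof (rule exI[of _ e], rule exI[of _ A], rule exI[of _ "\<lambda>i. \<alpha>s + e i"], intro conjI exI[of _ G] exI[of _ "L ` {1..k}"])
    show "\<forall>i\<in>{2..k - 1}. \<alpha>s < \<alpha>s + e (i - 1) + e (i - 1) \<and> \<alpha>s + e (i - 1) + e (i - 1) < \<alpha>s + e i"
      using e_pos e_pair by (auto simp: add_pos_pos)
    show "ereal (\<alpha>s + e (k - 1) + e (k - 1)) < \<gamma>" using e_km by (intro below_\<gamma>) simp
  qed (use e_pos A glued card ground in auto)
qed

end
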